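(* Let $N$ be a positive integer and let $\xi\in\mathbb{C}^\times$ satisfy $\xi^{2N}=-1$. Then in $\mathcal{S}_\xi(\mathbb{A}_{io})$, $$T_N(z)\bullet e=-\,e\bullet T_N(z).$$
   Context: Let $R=\mathbb{C}[t^{\pm1}]$. For an oriented surface $\Sigma$ with a finite (possibly empty) set $\mathcal{P}\subset\partial\Sigma=\partial\Sigma\times0$ of marked points, a relative framed link is a compact framed 1-submanifold $X\subset\Sigma\times[-1,1]$ with $\partial X=\mathcal{P}=X\cap\partial(\Sigma\times[-1,1])$, perpendicular to the boundary, with vertical framing at $\mathcal{P}$. The skein module $\mathcal{S}(\Sigma,\mathcal{P})$ (written $\mathcal{S}(\Sigma)$ if $\mathcal{P}=\emptyset$) is the $R$-module spanned by isotopy classes of relative framed links modulo $L=tL_++t^{-1}L_-$ and $L\sqcup U=-(t^2+t^{-2})L$. Here $L,L_+,L_-$ are identical outside a ball in which $L$ is a crossing, $L_+$ is the smoothing joining the two regions swept out when the overstrand is rotated counterclockwise to the understrand, and $L_-$ is the other smoothing; $U$ is the trivial framed knot in a ball disjoint from $L$. For $\xi\in\mathbb{C}^\times$, the subscript $\xi$ denotes the quotient by $(t-\xi)$. $\mathcal{S}(\Sigma)$ is an algebra with $L_1L_2$ given by placing $L_1$ on top of $L_2$. $\mathbb{A}=\{x\in\mathbb{R}^2:1\le|x|\le2\}$, with core $z=\{|x|=3/2\}$, and $\mathcal{S}(\mathbb{A})=R[z]$. $\mathbb{A}_{io}$ is $\mathbb{A}$ with marked points $P_1=(0,1)$, $P_2=(0,2)$,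 and $e$ is the straight radial segment from $P_1$ to $P_2$ (with vertical framing). For $L\in\mathcal{S}(\mathbb{A})$ and $K\in\mathcal{S}(\mathbb{A}_{io})$, $L\bullet K$ is obtained by placing $L$ above $K$ (in the $[-1,1]$ direction) and $K\bullet L$ by placing $K$ above $L$. Chebyshev polynomials of type 1: $T_0(z)=2$, $T_1(z)=z$, $T_n(z)=zT_{n-1}(z)-T_{n-2}(z)$ for $n\ge2$. *)

theory Defs
  imports "HOL-Analysis.Analysis" "HOL-Analysis.Cross3" "HOL-Library.Poly_Mapping"
begin

section \<open>Smooth maps\<close>

text \<open>Continuous differentiability of order \<open>k\<close> on an open set, by recursion on \<open>k\<close>: all
  directional derivatives are of order \<open>k - 1\<close>.\<close>

primrec C_on :: "nat \<Rightarrow> ('a::real_normed_vector \<Rightarrow> 'b::real_normed_vector) \<Rightarrow> 'a set \<Rightarrow> bool" where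
  "C_on 0 f U \<longleftrightarrow> continuous_on U f"
| "C_on (Suc k) f U \<longleftrightarrow>
     (\<forall>x\<in>U. f differentiable (at x)) \<and> (\<forall>v. C_on k (\<lambda>x. frechet_derivative f (at x) v) U)"

text \<open>On a set that need not be open, smoothness means smoothness on an open neighbourhood; this
  is what makes two-sided derivatives at the endpoints of an arc meaningful.\<close>

definition smooth_on :: "'a::real_normed_vector set \<Rightarrow> ('a \<Rightarrow> 'b::real_normed_vector) \<Rightarrow> bool" where
  "smooth_on S f \<longleftrightarrow> (\<exists>U. open U \<and> S \<subseteq> U \<and> (\<forall>k. C_on k f U))"


section \<open>Relative framed links in the thickened annulus\<close>

type_synonym point = "real^3"

definition annulus :: "(real^2) set" where
  "annulus = {x. 1 \<le> norm x \<and> norm x \<le> 2}"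

definition proj :: "point \<Rightarrow> real^2" where
  "proj p = vector [p $ 1, p $ 2]"

definition thick_annulus :: "point set" where
  "thick_annulus = {p. proj p \<in> annulus \<and> -1 \<le> p $ 3 \<and> p $ 3 \<le> 1}"

abbreviation vertical :: "point" where
  "vertical \<equiv> axis 3 1"

text \<open>A framed 1-submanifold \<open>X\<close> with framing \<open>v\<close> is stored as the set of pairs
  \<open>(p, v p)\<close> with \<open>p \<in> X\<close>.  The empty set is the empty link.\<close>

type_synonym framed_set = "(point \<times> point) set"

text \<open>Framed 1-submanifolds are the images of framed embeddings of finite disjoint unions of circles
  and closed intervals.  A component is given by a flag, \<open>True\<close> for a circle (the curve then has
  period 1) and \<open>False\<close> for an interval, and a curve of points together with framing vectors.\<close>

type_synonym component = "bool \<times> (real \<Rightarrow> point \<times> point)"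

definition param_dom :: "bool \<Rightarrow> real set" where
  "param_dom cl = (if cl then {0..<1} else {0..1})"

definition smooth_dom :: "bool \<Rightarrow> real set" where
  "smooth_dom cl = (if cl then UNIV else {0..1})"

definition tangent :: "(real \<Rightarrow> point \<times> point) \<Rightarrow> real \<Rightarrow> point" where
  "tangent \<gamma> u = vector_derivative (\<lambda>w. fst (\<gamma> w)) (at u)"

definition framed_trace :: "component \<Rightarrow> framed_set" where
  "framed_trace c = snd c ` param_dom (fst c)"

definition point_trace :: "component \<Rightarrow> point set" where
  "point_trace c = fst ` framed_trace c"

text \<open>The cross product is nonzero iff the tangent vector and the framing vector are linearly
  independent: the curve is an immersion, and the framing is a nonvanishing section of its normal
  bundle.\<close>

definition framed_embedding :: "component \<Rightarrow> bool" where
  "framed_embedding c \<longleftrightarrow> (case c of (cl, \<gamma>) \<Rightarrow>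
     smooth_on (smooth_dom cl) \<gamma> \<and>
     (cl \<longrightarrow> (\<forall>u. \<gamma> (u + 1) = \<gamma> u)) \<and>
     inj_on (\<lambda>u. fst (\<gamma> u)) (param_dom cl) \<and>
     (\<forall>u\<in>param_dom cl. cross3 (tangent \<gamma> u) (snd (\<gamma> u)) \<noteq> 0))"

definition endpoints :: "component \<Rightarrow> point set" where
  "endpoints c = (if fst c then {} else {fst (snd c 0), fst (snd c 1)})"

text \<open>\<open>P\<close> is a set of marked points on the boundary of the annulus, at height 0.  At such a point
  the normal direction of the boundary is the direction of the position vector, which is what
  perpendicularity refers to.\<close>

definition relative_framed_link :: "point set \<Rightarrow> component list \<Rightarrow> bool" where
  "relative_framed_link P cs \<longleftrightarrow>
     (\<forall>c\<in>set cs. framed_embedding c \<and> point_trace c \<subseteq> thick_annulus) \<and>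
     sorted_wrt (\<lambda>c d. disjnt (point_trace c) (point_trace d)) cs \<and>
     (\<Union>c\<in>set cs. endpoints c) = P \<and>
     (\<Union>c\<in>set cs. point_trace c) \<inter> frontier thick_annulus = P \<and>
     (\<forall>(cl, \<gamma>)\<in>set cs. \<forall>u\<in>param_dom cl. fst (\<gamma> u) \<in> P \<longrightarrow>
        (\<exists>a. tangent \<gamma> u = a *\<^sub>R fst (\<gamma> u)) \<and> (\<exists>a>0. snd (\<gamma> u) = a *\<^sub>R vertical))"

definition framed_image :: "component list \<Rightarrow> framed_set" where
  "framed_image cs = (\<Union>c\<in>set cs. framed_trace c)"

definition links :: "point set \<Rightarrow> framed_set set" where
  "links P = {framed_image cs | cs. relative_framed_link P cs}"

text \<open>Isotopy through relative framed links; a family of components has an additional (first)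
  time argument.\<close>

type_synonym component_family = "bool \<times> (real \<times> real \<Rightarrow> point \<times> point)"

definition at_time :: "real \<Rightarrow> component_family \<Rightarrow> component" where
  "at_time s F = (fst F, \<lambda>u. snd F (s, u))"

definition isotopic :: "point set \<Rightarrow> framed_set \<Rightarrow> framed_set \<Rightarrow> bool" where
  "isotopic P L L' \<longleftrightarrow> (\<exists>Fs :: component_family list.
     (\<forall>F\<in>set Fs. smooth_on ({0..1} \<times> smooth_dom (fst F)) (snd F)) \<and>
     (\<forall>s\<in>{0..1}. relative_framed_link P (map (at_time s) Fs)) \<and>
     L = framed_image (map (at_time 0) Fs) \<and>
     L' = framed_image (map (at_time 1) Fs))"


section \<open>The skein relations\<close>

text \<open>The model ball is the cylinder over the closed unit disc; a ball in the thickened annulus is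
  its image under an orientation-preserving smooth embedding.\<close>

definition cylinder :: "point set" where
  "cylinder = {p. proj p \<in> cball 0 1 \<and> -1 \<le> p $ 3 \<and> p $ 3 \<le> 1}"

definition ball_chart :: "(point \<Rightarrow> point) \<Rightarrow> bool" where
  "ball_chart h \<longleftrightarrow> smooth_on cylinder h \<and> inj_on h cylinder \<and>
     (\<forall>p\<in>cylinder. det (matrix (frechet_derivative h (at p))) > 0) \<and>
     h ` cylinder \<subseteq> interior thick_annulus"

definition outside :: "(point \<Rightarrow> point) \<Rightarrow> framed_set \<Rightarrow> framed_set" where
  "outside h L = {(p, v) \<in> L. p \<notin> h ` cylinder}"

text \<open>Inside the ball, \<open>L\<close> is the image of the subset \<open>T\<close> of the cylinder, with the framing that is
  vertical in the coordinates of the ball.\<close>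

definition looks_like :: "(point \<Rightarrow> point) \<Rightarrow> framed_set \<Rightarrow> point set \<Rightarrow> bool" where
  "looks_like h L T \<longleftrightarrow> T \<subseteq> cylinder \<and> fst ` L \<inter> h ` cylinder = h ` T \<and>
     (\<forall>p\<in>T. \<forall>v. (h p, v) \<in> L \<longrightarrow> (\<exists>a>0. v = a *\<^sub>R frechet_derivative h (at p) vertical))"

text \<open>In the crossing, the overstrand lies over the first coordinate axis and the understrand over
  the second one; \<open>f\<close> and \<open>g\<close> are their heights.\<close>

definition crossing :: "point set \<Rightarrow> bool" where
  "crossing T \<longleftrightarrow> (\<exists>f g :: real \<Rightarrow> real.
     (\<forall>x\<in>{-1..1}. \<bar>f x\<bar> < 1 \<and> \<bar>g x\<bar> < 1) \<and> g 0 < f 0 \<and>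
     T = (\<lambda>x. vector [x, 0, f x]) ` {-1..1} \<union> (\<lambda>y. vector [0, y, g y]) ` {-1..1})"

text \<open>An arc from over the point \<open>x\<close> to over the point \<open>y\<close> of the unit circle whose projection to
  the disc is embedded.  Immersivity of the projection need not be required: it follows from the
  vertical framing being transverse to the link.\<close>

definition flat_arc :: "(real \<Rightarrow> point) \<Rightarrow> real^2 \<Rightarrow> real^2 \<Rightarrow> bool" where
  "flat_arc a x y \<longleftrightarrow> path a \<and> arc (proj \<circ> a) \<and> proj (a 0) = x \<and> proj (a 1) = y \<and>
     (\<forall>u\<in>{0<..<1}. proj (a u) \<in> ball 0 1) \<and> (\<forall>u\<in>{0..1}. \<bar>a u $ 3\<bar> < 1)"

definition smoothing :: "real^2 \<Rightarrow> real^2 \<Rightarrow> real^2 \<Rightarrow> real^2 \<Rightarrow> point set \<Rightarrow> bool" where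
  "smoothing x y x' y' T \<longleftrightarrow> (\<exists>a b. flat_arc a x y \<and> flat_arc b x' y' \<and>
     disjnt (path_image (proj \<circ> a)) (path_image (proj \<circ> b)) \<and> T = path_image a \<union> path_image b)"

abbreviation "east \<equiv> vector [1, 0] :: real^2"
abbreviation "north \<equiv> vector [0, 1] :: real^2"
abbreviation "west \<equiv> vector [-1, 0] :: real^2"
abbreviation "south \<equiv> vector [0, -1] :: real^2"

text \<open>Rotated counterclockwise to the understrand, the overstrand (the first axis) sweeps out the
  first and third quadrants.  The positive smoothing joins these two regions, so its arcs cut off
  the second and fourth quadrants.\<close>

definition skein_triple ::
  "point set \<Rightarrow> framed_set \<Rightarrow> framed_set \<Rightarrow> framed_set \<Rightarrow> bool" where
  "skein_triple P L Lp Lm \<longleftrightarrow> L \<in> links P \<and> Lp \<in> links P \<and> Lm \<in> links P \<and>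
     (\<exists>h. ball_chart h \<and> outside h L = outside h Lp \<and> outside h L = outside h Lm \<and>
        (\<exists>T. crossing T \<and> looks_like h L T) \<and>
        (\<exists>T. smoothing north west south east T \<and> looks_like h Lp T) \<and>
        (\<exists>T. smoothing east north west south T \<and> looks_like h Lm T))"

definition push :: "(point \<Rightarrow> point) \<Rightarrow> framed_set \<Rightarrow> framed_set" where
  "push h L = (\<lambda>(p, v). (h p, frechet_derivative h (at p) v)) ` L"

definition flat_circle :: "real \<Rightarrow> framed_set" where
  "flat_circle r = {(p, vertical) | p. norm (proj p) = r \<and> p $ 3 = 0}"

definition adds_trivial_knot :: "point set \<Rightarrow> framed_set \<Rightarrow> framed_set \<Rightarrow> bool" where
  "adds_trivial_knot P L LU \<longleftrightarrow> L \<in> links P \<and>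
     (\<exists>h. ball_chart h \<and> fst ` L \<inter> h ` cylinder = {} \<and> LU = L \<union> push h (flat_circle (1/2)))"


section \<open>Skein modules\<close>

text \<open>Laurent polynomials over the complex numbers: the group algebra of the integers.\<close>

type_synonym laurent = "int \<Rightarrow>\<^sub>0 complex"

abbreviation t_pow :: "int \<Rightarrow> laurent" where
  "t_pow k \<equiv> Poly_Mapping.single k 1"

abbreviation const :: "complex \<Rightarrow> laurent" where
  "const a \<equiv> Poly_Mapping.single 0 a"

type_synonym chain = "framed_set \<Rightarrow>\<^sub>0 laurent"

definition chain_scale :: "laurent \<Rightarrow> chain \<Rightarrow> chain" where
  "chain_scale r x = Poly_Mapping.map (\<lambda>s. r * s) x"

lemma lookup_chain_scale [simp]:
  "Poly_Mapping.lookup (chain_scale r x) L = r * Poly_Mapping.lookup x L"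
  by (simp add: chain_scale_def Poly_Mapping.map.rep_eq when_def)

interpretation chain: module chain_scale
  by unfold_locales (auto intro!: poly_mapping_eqI simp: lookup_add algebra_simps)

abbreviation gen :: "framed_set \<Rightarrow> chain" where
  "gen L \<equiv> Poly_Mapping.single L 1"

definition chains :: "point set \<Rightarrow> chain set" where
  "chains P = {x. Poly_Mapping.keys x \<subseteq> links P}"

definition relators :: "point set \<Rightarrow> chain set" where
  "relators P =
     {gen L - gen L' | L L'. isotopic P L L'} \<union>
     {gen L - (chain_scale (t_pow 1) (gen Lp) + chain_scale (t_pow (-1)) (gen Lm))
        | L Lp Lm. skein_triple P L Lp Lm} \<union>
     {gen LU - chain_scale (- (t_pow 2 + t_pow (-2))) (gen L)
        | L LU. adds_trivial_knot P L LU}"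

definition skein_eq :: "point set \<Rightarrow> (chain \<times> chain) set" where
  "skein_eq P = {(x, y). x \<in> chains P \<and> y \<in> chains P \<and> x - y \<in> chain.span (relators P)}"

type_synonym skein_elem = "chain set"

definition skein :: "point set \<Rightarrow> skein_elem set" where
  "skein P = chains P // skein_eq P"

definition cls :: "point set \<Rightarrow> chain \<Rightarrow> skein_elem" where
  "cls P x = skein_eq P `` {x}"

text \<open>Operations on skein modules are induced by operations on chains, in the manner of
  \<^theory>\<open>HOL.Equiv_Relations\<close>: the union over all representatives is a single class because the
  operation on chains respects the relation.\<close>

definition skein_minus :: "point set \<Rightarrow> skein_elem \<Rightarrow> skein_elem \<Rightarrow> skein_elem" where
  "skein_minus P X Y = (\<Union>x\<in>X. \<Union>y\<in>Y. cls P (x - y))"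

definition skein_uminus :: "point set \<Rightarrow> skein_elem \<Rightarrow> skein_elem" where
  "skein_uminus P X = (\<Union>x\<in>X. cls P (- x))"

definition skein_scale :: "point set \<Rightarrow> laurent \<Rightarrow> skein_elem \<Rightarrow> skein_elem" where
  "skein_scale P r X = (\<Union>x\<in>X. cls P (chain_scale r x))"


subsection \<open>Stacking\<close>

text \<open>Affine changes of height that carry the interval from -1 to 1 to pairwise disjoint
  subintervals.  The middle one fixes height 0, hence the marked points.\<close>

definition raise :: "point \<Rightarrow> point" where
  "raise p = vector [p $ 1, p $ 2, (p $ 3 + 3) / 4]"

definition squeeze :: "point \<Rightarrow> point" where
  "squeeze p = vector [p $ 1, p $ 2, p $ 3 / 4]"

definition lower :: "point \<Rightarrow> point" where
  "lower p = vector [p $ 1, p $ 2, (p $ 3 - 3) / 4]"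

definition stack_over :: "framed_set \<Rightarrow> framed_set \<Rightarrow> framed_set" where
  "stack_over L K = push raise L \<union> push squeeze K"

definition stack_under :: "framed_set \<Rightarrow> framed_set \<Rightarrow> framed_set" where
  "stack_under L K = push lower L \<union> push squeeze K"

definition bilinear_ext :: "(framed_set \<Rightarrow> framed_set \<Rightarrow> framed_set) \<Rightarrow> chain \<Rightarrow> chain \<Rightarrow> chain" where
  "bilinear_ext op x y = (\<Sum>L\<in>Poly_Mapping.keys x. \<Sum>K\<in>Poly_Mapping.keys y.
     Poly_Mapping.single (op L K) (Poly_Mapping.lookup x L * Poly_Mapping.lookup y K))"

text \<open>For \<open>X\<close> in the skein algebra of the annulus and \<open>Y\<close> in the skein module with marked points
  \<open>P\<close>, the following are the products of \<open>X\<close> and \<open>Y\<close> with \<open>X\<close> above \<open>Y\<close> and with \<open>Y\<close> above \<open>X\<close>.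
  Without marked points, the first one is the multiplication of the skein algebra.\<close>

definition act_over :: "point set \<Rightarrow> skein_elem \<Rightarrow> skein_elem \<Rightarrow> skein_elem" where
  "act_over P X Y = (\<Union>x\<in>X. \<Union>y\<in>Y. cls P (bilinear_ext stack_over x y))"

definition act_under :: "point set \<Rightarrow> skein_elem \<Rightarrow> skein_elem \<Rightarrow> skein_elem" where
  "act_under P X Y = (\<Union>x\<in>X. \<Union>y\<in>Y. cls P (bilinear_ext stack_under x y))"

abbreviation skein_mult :: "skein_elem \<Rightarrow> skein_elem \<Rightarrow> skein_elem" where
  "skein_mult \<equiv> act_over {}"

abbreviation skein_one :: skein_elem where
  "skein_one \<equiv> cls {} (gen {})"

text \<open>Chebyshev polynomials of type 1, evaluated in the skein algebra of the annulus.\<close>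

fun chebyshev_T :: "nat \<Rightarrow> skein_elem \<Rightarrow> skein_elem" where
  "chebyshev_T 0 X = skein_scale {} 2 skein_one"
| "chebyshev_T (Suc 0) X = X"
| "chebyshev_T (Suc (Suc n)) X =
     skein_minus {} (skein_mult X (chebyshev_T (Suc n) X)) (chebyshev_T n X)"


subsection \<open>Specialisation of the parameter\<close>

text \<open>The quotient of the skein module by its submodule of multiples of \<open>t - \<xi>\<close>:
  elements \<open>X\<close> and \<open>Y\<close> of the skein module have the same image in the quotient iff the pair
  \<open>(X, Y)\<close> belongs to the relation.\<close>

definition skein_at_eq :: "complex \<Rightarrow> point set \<Rightarrow> (skein_elem \<times> skein_elem) set" where
  "skein_at_eq \<xi> P = {(X, Y). X \<in> skein P \<and> Y \<in> skein P \<and>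
     (\<exists>W\<in>skein P. skein_minus P X Y = skein_scale P (t_pow 1 - const \<xi>) W)}"

definition skein_at :: "complex \<Rightarrow> point set \<Rightarrow> skein_elem set set" where
  "skein_at \<xi> P = skein P // skein_at_eq \<xi> P"


section \<open>The annulus with two marked points\<close>

definition io :: "point set" where
  "io = {vector [0, 1, 0], vector [0, 2, 0]}"

definition core_z :: skein_elem where
  "core_z = cls {} (gen (flat_circle (3/2)))"

definition arc_e :: skein_elem where
  "arc_e = cls io (gen {(vector [0, y, 0], vertical) | y. 1 \<le> y \<and> y \<le> 2})"

end

theory Submission
  imports Defs
begin

text \<open>A circle \<open>z\<close> placed over an arc \<open>u_k\<close> that winds \<open>k\<close> times around the annulus meets it in a
  single crossing, whose two smoothings are isotopic to \<open>u_(k+1)\<close> and \<open>u_(k-1)\<close>. So, with \<open>u\<close> denoting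
  the shift \<open>u_k \<mapsto> u_(k+1)\<close>, the circle acts from above as \<open>t u + t^-1 u^-1\<close> and from below, where
  the crossing is reversed, as \<open>t^-1 u + t u^-1\<close>. Since \<open>T_N (x + x^-1) = x^N + x^-N\<close>, the products of
  \<open>T_N(z)\<close> with \<open>e = u_0\<close> are \<open>t^N u_N + t^-N u_-N\<close> and \<open>t^-N u_N + t^N u_-N\<close>. Their sum is
  \<open>(t^N + t^-N) (u_N + u_-N)\<close>, and \<open>t - \<xi>\<close> divides \<open>t^N + t^-N\<close> if \<open>\<xi>^(2N) = -1\<close>.

  Stacking changes heights affinely, and such changes transport links, isotopies, ball charts and skein
  triples; this makes the products well defined.\<close>

section \<open>Calculus of smooth maps\<close>

text \<open>A skein triple demands literal equality of three framed links outside one ball, not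
  equality up to isotopy. This shapes the geometry: outside the ball the smoothed curve must
  coincide, framing lengths included, with the stacked circle and spiral, yet be smooth at its two
  corners. Hence the functions built from exp(-1/x), a radius that is exactly 3/2 on a whole
  parameter interval, and a framing of length 1/4, which is what stacking leaves of a unit framing.
  The spirals wind between the radii 9/8 and 5/4 because the ball covers the radii from 5/4 to 7/4,
  where the strand has to be radial, and because arcs have to leave the marked points radially. The
  numerical bounds serve to show that the corners lie inside the ball, which spans the angles from
  -1 to 1. The literal curve is then straightened to a spiral linearly in cylindrical coordinates,
  for which a monotone radius suffices. On the algebraic side, stacking above is a left action and
  stacking below a right action, so the two Chebyshev inductions apply the next factor at opposite
  ends.\<close>

text \<open>Openness is what carries the agreement over to derivatives: functions that agree near a
  point have the same derivative there, so the induction can continue with the derivatives.\<close>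

lemma C_on_cong:
  assumes "open U" "\<And>x. x \<in> U \<Longrightarrow> f x = g x" "C_on k f U"
  shows "C_on k g U"
  using assms(2,3)
proof (induction k arbitrary: f g)
  case 0
  then show ?case by (simp cong: continuous_on_cong)
next
  case (Suc k)
  have d: "(g has_derivative frechet_derivative f (at x)) (at x)" if "x \<in> U" for x
    using Suc.prems assms(1) that
    by (intro has_derivative_transform_within_open[of f _ _ _ U g])
       (auto simp: frechet_derivative_works[symmetric])
  show ?case
  proof (clarsimp, intro conjI ballI allI)
    fix x assume "x \<in> U" then show "g differentiable (at x)"
      using d differentiableI by blast
  next
    fix v
    show "C_on k (\<lambda>x. frechet_derivative g (at x) v) U"
    proof (rule Suc.IH[of "\<lambda>x. frechet_derivative f (at x) v"])
      show "C_on k (\<lambda>x. frechet_derivative f (at x) v) U" using Suc.prems by simp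
    next
      fix x assume "x \<in> U"
      from frechet_derivative_at[OF d[OF this]]
      show "frechet_derivative f (at x) v = frechet_derivative g (at x) v" by simp
    qed
  qed
qed

text \<open>Allows the derivative to be exhibited in any convenient form \<open>f'\<close> instead
  of as a \<open>frechet_derivative\<close>.\<close>

lemma C_on_SucI:
  assumes "open U" and d: "\<And>x. x \<in> U \<Longrightarrow> (f has_derivative f' x) (at x)"
    and "\<And>v. C_on k (\<lambda>x. f' x v) U"
  shows "C_on (Suc k) f U"
proof (simp, intro conjI ballI allI)
  fix x assume "x \<in> U" then show "f differentiable (at x)"
    using d differentiableI by blast
next
  fix v
  show "C_on k (\<lambda>x. frechet_derivative f (at x) v) U"
  proof (rule C_on_cong[OF assms(1) _ assms(3)])
    fix x assume "x \<in> U"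
    from frechet_derivative_at[OF d[OF this]]
    show "f' x v = frechet_derivative f (at x) v" by (rule fun_cong)
  qed
qed

lemma C_on_Suc_has_derivative:
  "C_on (Suc k) f U \<Longrightarrow> x \<in> U \<Longrightarrow> (f has_derivative frechet_derivative f (at x)) (at x)"
  using frechet_derivative_works by auto

lemma C_on_SucD: "C_on (Suc k) f U \<Longrightarrow> C_on k (\<lambda>x. frechet_derivative f (at x) v) U"
  by simp

lemma C_on_Suc_imp: "C_on (Suc k) f U \<Longrightarrow> C_on k f U"
proof (induction k arbitrary: f)
  case 0
  then show ?case
    by (auto intro!: continuous_at_imp_continuous_on differentiable_imp_continuous_within)
next
  case (Suc k)
  have "C_on k (\<lambda>x. frechet_derivative f (at x) v) U" for v
    using Suc by simp
  then show ?case using Suc.prems by simp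
qed

lemma C_on_imp_continuous_on: "C_on k f U \<Longrightarrow> continuous_on U f"
  by (induction k) (simp, metis C_on_Suc_imp)

lemma C_on_subset: "C_on k f U \<Longrightarrow> V \<subseteq> U \<Longrightarrow> C_on k f V"
  by (induction k arbitrary: f) (auto intro: continuous_on_subset)

lemma C_on_const: "open U \<Longrightarrow> C_on k (\<lambda>x. c) U"
proof (induction k arbitrary: c)
  case (Suc k)
  then show ?case by (intro C_on_SucI[where f' = "\<lambda>_ _. 0"]) (auto intro!: derivative_eq_intros)
qed simp

lemma C_on_linear_comp:
  assumes "open U" "bounded_linear h" "C_on k f U"
  shows "C_on k (\<lambda>x. h (f x)) U"
  using assms(3)
proof (induction k arbitrary: f)
  case 0
  then show ?case using assms(2)
    by (simp add: bounded_linear.continuous_on)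
next
  case (Suc k)
  show ?case
  proof (rule C_on_SucI[where f' = "\<lambda>x v. h (frechet_derivative f (at x) v)"])
    fix x assume "x \<in> U"
    then show "((\<lambda>x. h (f x)) has_derivative (\<lambda>v. h (frechet_derivative f (at x) v))) (at x)"
      using Suc.prems by (intro bounded_linear.has_derivative[OF assms(2)] C_on_Suc_has_derivative)
  qed (use Suc assms in auto)
qed

lemma C_on_linear:
  assumes "open U" "bounded_linear h"
  shows "C_on k h U"
proof (cases k)
  case 0
  then show ?thesis using assms(2)
    using linear_continuous_on by auto
next
  case (Suc n)
  show ?thesis unfolding Suc
    by (rule C_on_SucI[where f' = "\<lambda>x. h"])
       (use assms in \<open>auto intro!: C_on_const bounded_linear_imp_has_derivative\<close>)
qed

lemma C_on_add:
  assumes "open U" "C_on k f U" "C_on k g U"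
  shows "C_on k (\<lambda>x. f x + g x) U"
  using assms(2,3)
proof (induction k arbitrary: f g)
  case 0
  then show ?case by (simp add: continuous_on_add)
next
  case (Suc k)
  show ?case
  proof (rule C_on_SucI[where f' = "\<lambda>x v. frechet_derivative f (at x) v + frechet_derivative g (at x) v"])
    fix x assume "x \<in> U"
    then show "((\<lambda>x. f x + g x) has_derivative (\<lambda>v. frechet_derivative f (at x) v + frechet_derivative g (at x) v)) (at x)"
      using Suc.prems by (intro has_derivative_add C_on_Suc_has_derivative)
  qed (use Suc assms in auto)
qed

lemma C_on_sum:
  assumes "open U" "\<And>i. i \<in> I \<Longrightarrow> C_on k (f i) U"
  shows "C_on k (\<lambda>x. \<Sum>i\<in>I. f i x) U"
  using assms(2)
  by (induction I rule: infinite_finite_induct) (auto intro!: C_on_add C_on_const assms(1))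

lemma C_on_bilinear:
  assumes "open U" "bounded_bilinear p" "C_on k f U" "C_on k g U"
  shows "C_on k (\<lambda>x. p (f x) (g x)) U"
  using assms(3,4)
proof (induction k arbitrary: f g)
  case 0
  then show ?case using assms(2) by (simp add: bounded_bilinear.continuous_on)
next
  case (Suc k)
  show ?case
  proof (rule C_on_SucI[where f' = "\<lambda>x v. p (f x) (frechet_derivative g (at x) v) + p (frechet_derivative f (at x) v) (g x)"])
    fix x assume "x \<in> U"
    then show "((\<lambda>x. p (f x) (g x)) has_derivative (\<lambda>v. p (f x) (frechet_derivative g (at x) v) + p (frechet_derivative f (at x) v) (g x))) (at x)"
      using Suc.prems by (intro bounded_bilinear.FDERIV[OF assms(2)] C_on_Suc_has_derivative)
  next
    fix v
    show "C_on k (\<lambda>x. p (f x) (frechet_derivative g (at x) v) + p (frechet_derivative f (at x) v) (g x)) U"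
      by (intro C_on_add assms Suc.IH C_on_SucD[OF Suc.prems(1)] C_on_SucD[OF Suc.prems(2)]
           C_on_Suc_imp[OF Suc.prems(1)] C_on_Suc_imp[OF Suc.prems(2)])
  qed fact
qed

text \<open>\<open>C_on\<close> controls derivatives in fixed directions only, while the chain rule
  differentiates \<open>g\<close> in a direction that varies with \<open>x\<close>. Expanding this
  direction in a basis gives a finite sum of scalar coefficients times derivatives in fixed
  directions; hence the Euclidean space in the middle.\<close>

lemma C_on_compose:
  fixes g :: "'b::euclidean_space \<Rightarrow> 'c::real_normed_vector"
  assumes "open U" "open V" "C_on k f U" "C_on k g V" "f ` U \<subseteq> V"
  shows "C_on k (\<lambda>x. g (f x)) U"
  using assms(3,4,5)
proof (induction k arbitrary: g)
  case 0
  then show ?case by (auto intro: continuous_on_compose2)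
next
  case (Suc k)
  let ?D = "\<lambda>x v. \<Sum>b\<in>Basis. (frechet_derivative f (at x) v \<bullet> b) *\<^sub>R frechet_derivative g (at (f x)) b"
  show ?case
  proof (rule C_on_SucI[where f' = ?D])
    fix x assume x: "x \<in> U"
    then have fx: "f x \<in> V" using Suc.prems by auto
    have g: "(g has_derivative frechet_derivative g (at (f x))) (at (f x))"
      using Suc.prems(2) fx by (rule C_on_Suc_has_derivative)
    have f: "(f has_derivative frechet_derivative f (at x)) (at x)"
      using Suc.prems(1) x by (rule C_on_Suc_has_derivative)
    have lin: "linear (frechet_derivative g (at (f x)))"
      using g by (simp add: has_derivative_linear)
    have eq: "frechet_derivative g (at (f x)) w = (\<Sum>b\<in>Basis. (w \<bullet> b) *\<^sub>R frechet_derivative g (at (f x)) b)" for w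
    proof -
      have "frechet_derivative g (at (f x)) w = frechet_derivative g (at (f x)) (\<Sum>b\<in>Basis. (w \<bullet> b) *\<^sub>R b)"
        by (simp only: euclidean_representation)
      also have "\<dots> = (\<Sum>b\<in>Basis. (w \<bullet> b) *\<^sub>R frechet_derivative g (at (f x)) b)"
        by (simp only: linear_sum[OF lin] linear_cmul[OF lin])
      finally show ?thesis .
    qed
    have "?D x = (\<lambda>v. frechet_derivative g (at (f x)) (frechet_derivative f (at x) v))"
      by (rule ext) (rule eq[symmetric])
    from has_derivative_compose[OF f g, folded this]
    show "((\<lambda>x. g (f x)) has_derivative ?D x) (at x)" .
  next
    fix v
    show "C_on k (\<lambda>x. ?D x v) U"
    proof (intro C_on_sum assms(1) C_on_bilinear[OF assms(1) bounded_bilinear_scaleR])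
      fix b :: 'b assume "b \<in> Basis"
      show "C_on k (\<lambda>x. frechet_derivative f (at x) v \<bullet> b) U"
        by (rule C_on_linear_comp[OF assms(1) bounded_linear_inner_left]) (rule C_on_SucD[OF Suc.prems(1)])
      show "C_on k (\<lambda>x. frechet_derivative g (at (f x)) b) U"
        by (rule Suc.IH[OF C_on_Suc_imp[OF Suc.prems(1)] C_on_SucD[OF Suc.prems(2)] Suc.prems(3)])
    qed
  qed fact
qed

text \<open>Induction on the order for all members at once: differentiation never leaves the linear
  span of the family. It serves for shifted sines, for powers of the inverse and for
  \<open>flat\<close>.\<close>

lemma C_on_deriv_family:
  fixes f :: "nat \<Rightarrow> real \<Rightarrow> real"
  assumes "open U"
    and "\<And>n x. x \<in> U \<Longrightarrow> (f n has_real_derivative (a n * f (Suc n) x + b n * f (Suc (Suc n)) x)) (at x)"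
  shows "C_on k (f n) U"
proof (induction k arbitrary: n)
  case 0
  then show ?case using assms
    by (auto intro!: continuous_at_imp_continuous_on DERIV_isCont)
next
  case (Suc k)
  show ?case
  proof (rule C_on_SucI[where f' = "\<lambda>x v. (a n * f (Suc n) x + b n * f (Suc (Suc n)) x) * v"])
    fix x assume "x \<in> U"
    then show "(f n has_derivative (*) (a n * f (Suc n) x + b n * f (Suc (Suc n)) x)) (at x)"
      using assms(2) by (simp add: has_field_derivative_def)
  next
    fix v
    show "C_on k (\<lambda>x. (a n * f (Suc n) x + b n * f (Suc (Suc n)) x) * v) U"
      by (intro C_on_bilinear[OF _ bounded_bilinear_mult] C_on_add C_on_const Suc assms(1))
  qed fact
qed

section \<open>Closure properties of smoothness on arbitrary sets\<close>

named_theorems smooth_intros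

lemma smooth_onE:
  assumes "smooth_on S f"
  obtains U where "open U" "S \<subseteq> U" "\<And>k. C_on k f U"
  using assms by (auto simp: smooth_on_def)

lemma smooth_onI: "open U \<Longrightarrow> S \<subseteq> U \<Longrightarrow> (\<And>k. C_on k f U) \<Longrightarrow> smooth_on S f"
  by (auto simp: smooth_on_def)

lemma smooth_on_subset: "smooth_on S f \<Longrightarrow> T \<subseteq> S \<Longrightarrow> smooth_on T f"
  unfolding smooth_on_def by blast

lemma smooth_on_const [smooth_intros]: "smooth_on S (\<lambda>x. c)"
  by (rule smooth_onI[of UNIV]) (auto intro: C_on_const)

lemma smooth_on_linear: "bounded_linear h \<Longrightarrow> smooth_on S h"
  by (rule smooth_onI[of UNIV]) (auto intro: C_on_linear)

lemma smooth_on_id [smooth_intros]: "smooth_on S (\<lambda>x. x)"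
  by (rule smooth_on_linear) (rule bounded_linear_ident)

lemma smooth_on_compose:
  fixes g :: "'b::euclidean_space \<Rightarrow> 'c::real_normed_vector"
  assumes "smooth_on T g" "smooth_on S f" "f ` S \<subseteq> T"
  shows "smooth_on S (\<lambda>x. g (f x))"
proof -
  from assms(1) obtain V where V: "open V" "T \<subseteq> V" "\<And>k. C_on k g V" by (rule smooth_onE) blast
  from assms(2) obtain U where U: "open U" "S \<subseteq> U" "\<And>k. C_on k f U" by (rule smooth_onE) blast
  \<comment> \<open>The neighbourhood of \<open>S\<close> is shrunk until \<open>f\<close> maps it
    into \<open>V\<close>.\<close>
  define W where "W = U \<inter> f -` V"
  have "continuous_on U f" using U(3)[of 0] by simp
  then have W: "open W" unfolding W_def using U(1) V(1)
    by (blast intro: continuous_open_preimage)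
  show ?thesis
  proof (rule smooth_onI[OF W])
    show "S \<subseteq> W" using U(2) V(2) assms(3) unfolding W_def by blast
    show "C_on k (\<lambda>x. g (f x)) W" for k
      by (rule C_on_compose[OF W V(1) C_on_subset[OF U(3)] V(3)]) (auto simp: W_def)
  qed
qed

lemma smooth_on_linear_comp:
  assumes "bounded_linear h" "smooth_on S f"
  shows "smooth_on S (\<lambda>x. h (f x))"
  using assms(2) unfolding smooth_on_def using C_on_linear_comp[OF _ assms(1)] by metis

lemma smooth_on_bilinear:
  assumes "bounded_bilinear p" "smooth_on S f" "smooth_on S g"
  shows "smooth_on S (\<lambda>x. p (f x) (g x))"
proof -
  from assms(2) obtain U where U: "open U" "S \<subseteq> U" "\<And>k. C_on k f U" by (rule smooth_onE) blast
  from assms(3) obtain V where V: "open V" "S \<subseteq> V" "\<And>k. C_on k g V" by (rule smooth_onE) blast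
  show ?thesis
    by (rule smooth_onI[of "U \<inter> V"])
       (use U V in \<open>auto intro!: C_on_bilinear[OF _ assms(1)] intro: C_on_subset[OF U(3)] C_on_subset[OF V(3)]\<close>)
qed

lemma smooth_on_add [smooth_intros]:
  assumes "smooth_on S f" "smooth_on S g"
  shows "smooth_on S (\<lambda>x. f x + g x)"
proof -
  from assms(1) obtain U where U: "open U" "S \<subseteq> U" "\<And>k. C_on k f U" by (rule smooth_onE) blast
  from assms(2) obtain V where V: "open V" "S \<subseteq> V" "\<And>k. C_on k g V" by (rule smooth_onE) blast
  show ?thesis
    by (rule smooth_onI[of "U \<inter> V"])
       (use U V in \<open>auto intro!: C_on_add intro: C_on_subset[OF U(3)] C_on_subset[OF V(3)]\<close>)
qed

lemma smooth_on_scaleR [smooth_intros]: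
  "smooth_on S f \<Longrightarrow> smooth_on S g \<Longrightarrow> smooth_on S (\<lambda>x. f x *\<^sub>R g x)"
  by (rule smooth_on_bilinear[OF bounded_bilinear_scaleR])

lemma smooth_on_mult [smooth_intros]:
  fixes f g :: "'a::real_normed_vector \<Rightarrow> real"
  shows "smooth_on S f \<Longrightarrow> smooth_on S g \<Longrightarrow> smooth_on S (\<lambda>x. f x * g x)"
  by (rule smooth_on_bilinear[OF bounded_bilinear_mult])

lemma smooth_on_minus [smooth_intros]: "smooth_on S f \<Longrightarrow> smooth_on S (\<lambda>x. - f x)"
  by (rule smooth_on_linear_comp[OF bounded_linear_minus[OF bounded_linear_ident]])

lemma smooth_on_diff [smooth_intros]:
  "smooth_on S f \<Longrightarrow> smooth_on S g \<Longrightarrow> smooth_on S (\<lambda>x. f x - g x)"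
  using smooth_on_add[of S f "\<lambda>x. - g x"] smooth_on_minus[of S g] by simp

lemma smooth_on_fst [smooth_intros]: "smooth_on S f \<Longrightarrow> smooth_on S (\<lambda>x. fst (f x))"
  by (rule smooth_on_linear_comp[OF bounded_linear_fst])

lemma smooth_on_snd [smooth_intros]: "smooth_on S f \<Longrightarrow> smooth_on S (\<lambda>x. snd (f x))"
  by (rule smooth_on_linear_comp[OF bounded_linear_snd])

lemma smooth_on_nth [smooth_intros]: "smooth_on S f \<Longrightarrow> smooth_on S (\<lambda>x. f x $ i)"
  by (rule smooth_on_linear_comp[OF bounded_linear_vec_nth])

lemma smooth_on_Pair [smooth_intros]:
  assumes "smooth_on S f" "smooth_on S g"
  shows "smooth_on S (\<lambda>x. (f x, g x))"
proof -
  have "smooth_on S (\<lambda>x. (f x, 0) + (0, g x))"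
    by (intro smooth_on_add smooth_on_linear_comp[OF _ assms(1)] smooth_on_linear_comp[OF _ assms(2)]
      bounded_linear_Pair bounded_linear_ident bounded_linear_zero)
  then show ?thesis by simp
qed

lemma vector3_eq_axis:
  "(vector [a, b, c] :: real^3) = a *\<^sub>R axis 1 1 + b *\<^sub>R axis 2 1 + c *\<^sub>R axis 3 1"
  by (simp add: vec_eq_iff forall_3 axis_def)

lemma smooth_on_vector3 [smooth_intros]:
  assumes "smooth_on S f" "smooth_on S g" "smooth_on S h"
  shows "smooth_on S (\<lambda>x. vector [f x, g x, h x] :: real^3)"
  unfolding vector3_eq_axis by (intro smooth_intros assms)

section \<open>Smoothness of elementary functions\<close>

text \<open>Differentiation shifts a sine by a quarter period, so the shifted sines form a family
  closed under differentiation.\<close>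

lemma C_on_sin_shift: "C_on k (\<lambda>x::real. sin (x + real n * (pi / 2))) UNIV"
proof (rule C_on_deriv_family[where a = "\<lambda>_. 1" and b = "\<lambda>_. 0"])
  fix n :: nat and x :: real
  show "((\<lambda>x. sin (x + real n * (pi / 2))) has_real_derivative
      1 * sin (x + real (Suc n) * (pi / 2)) + 0 * sin (x + real (Suc (Suc n)) * (pi / 2))) (at x)"
  proof -
    have "sin (x + real (Suc n) * (pi / 2)) = sin ((x + real n * (pi / 2)) + pi / 2)"
      by (intro arg_cong[where f = sin]) (simp add: field_simps)
    also have "\<dots> = cos (x + real n * (pi / 2))"
      by (subst sin_add) simp
    finally show ?thesis by (auto intro!: derivative_eq_intros)
  qed
qed simp

lemma smooth_on_sin [smooth_intros]:
  fixes f :: "'a::real_normed_vector \<Rightarrow> real"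
  assumes "smooth_on S f" shows "smooth_on S (\<lambda>x. sin (f x))"
proof (rule smooth_on_compose[OF _ assms])
  show "smooth_on UNIV (sin :: real \<Rightarrow> real)"
    using C_on_sin_shift[of _ 0] by (intro smooth_onI[of UNIV]) auto
qed simp

lemma smooth_on_cos [smooth_intros]:
  fixes f :: "'a::real_normed_vector \<Rightarrow> real"
  assumes "smooth_on S f" shows "smooth_on S (\<lambda>x. cos (f x))"
  using smooth_on_sin[OF smooth_on_diff[OF smooth_on_const[of _ "pi/2"] assms]]
  by (simp add: cos_sin_eq)

lemma inverse_power_has_derivative:
  "x \<noteq> 0 \<Longrightarrow> ((\<lambda>x. inverse x ^ n) has_real_derivative - real n * inverse x ^ Suc n) (at (x::real))"
  using DERIV_power[OF DERIV_inverse, of x n] by (cases n) (auto simp: algebra_simps)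

lemma smooth_on_inverse [smooth_intros]:
  fixes f :: "'a::real_normed_vector \<Rightarrow> real"
  assumes "smooth_on S f" "\<And>x. x \<in> S \<Longrightarrow> f x \<noteq> 0" shows "smooth_on S (\<lambda>x. inverse (f x))"
proof (rule smooth_on_compose[OF _ assms(1)])
  have o: "open (- {0::real})" by (rule open_Compl) simp
  have "C_on k (\<lambda>x::real. inverse x ^ Suc 0) (- {0})" for k
  proof (rule C_on_deriv_family[where f = "\<lambda>n x. inverse x ^ n" and a = "\<lambda>n. - real n" and b = "\<lambda>_. 0", OF o])
    fix n :: nat and x :: real assume "x \<in> - {0}"
    then show "((\<lambda>x. inverse x ^ n) has_real_derivative - real n * inverse x ^ Suc n + 0 * inverse x ^ Suc (Suc n)) (at x)"
      using inverse_power_has_derivative[of x n] by simp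
  qed
  then show "smooth_on (- {0}) (inverse :: real \<Rightarrow> real)"
    by (intro smooth_onI[OF o]) auto
qed (use assms in auto)

lemma smooth_on_divide [smooth_intros]:
  fixes f :: "'a::real_normed_vector \<Rightarrow> real"
  assumes "smooth_on S f" "smooth_on S g" "\<And>x. x \<in> S \<Longrightarrow> g x \<noteq> 0" shows "smooth_on S (\<lambda>x. f x / g x)"
  unfolding divide_inverse by (intro smooth_intros assms)

lemma smooth_on_has_derivative:
  assumes "smooth_on S f" "x \<in> S"
  shows "(f has_derivative frechet_derivative f (at x)) (at x)"
  using assms by (meson C_on_Suc_has_derivative smooth_onE subsetD)

lemma smooth_on_real_differentiable:
  fixes f :: "real \<Rightarrow> real"
  assumes "smooth_on UNIV f"
  shows "(f has_real_derivative deriv f x) (at x)"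
  using smooth_on_has_derivative[OF assms, of x]
  by (metis DERIV_deriv_iff_real_differentiable UNIV_I differentiableI)

lemma smooth_on_continuous_on: "smooth_on S f \<Longrightarrow> continuous_on S f"
  by (meson C_on_imp_continuous_on continuous_on_subset smooth_onE)


section \<open>Flat functions and smooth steps\<close>

text \<open>This family is closed under differentiation up to linear combinations, which makes all its members smooth.\<close>

definition flat :: "nat \<Rightarrow> real \<Rightarrow> real" where
  "flat n x = (if x > 0 then inverse x ^ n * exp (- inverse x) else 0)"

text \<open>From the right, the substitution y = 1/x turns the claim into the decay of y^n / exp y
  at infinity.\<close>

lemma flat_tendsto_0: "(flat n \<longlongrightarrow> 0) (at 0)"
proof -
  have "((\<lambda>x. inverse x ^ n * exp (- inverse x)) \<longlongrightarrow> (0::real)) (at_right 0)"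
  proof -
    have "((\<lambda>y::real. y ^ n / exp y) \<longlongrightarrow> 0) at_top"
      by (rule tendsto_power_div_exp_0)
    then have "((\<lambda>x::real. inverse x ^ n / exp (inverse x)) \<longlongrightarrow> 0) (at_right 0)"
      by (rule filterlim_compose) (rule filterlim_inverse_at_top_right)
    then show ?thesis by (simp add: exp_minus field_simps)
  qed
  then have r: "(flat n \<longlongrightarrow> 0) (at_right 0)"
    by (rule Lim_transform_eventually)
       (auto simp: flat_def eventually_at_right_field intro!: exI[of _ 1])
  have l: "(flat n \<longlongrightarrow> 0) (at_left 0)"
    by (rule Lim_transform_eventually[OF tendsto_const])
       (auto simp: flat_def eventually_at_left_field intro!: exI[of _ "-1"])
  from l r show ?thesis by (simp add: filterlim_at_split)
qed

lemma flat_has_derivative: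
  "(flat n has_real_derivative - real n * flat (Suc n) x + 1 * flat (Suc (Suc n)) x) (at x)"
proof -
  consider "x > 0" | "x < 0" | "x = 0" by linarith
  then show ?thesis
  proof cases
    case 1
    have "((\<lambda>x. inverse x ^ n * exp (- inverse x)) has_real_derivative
        - real n * flat (Suc n) x + 1 * flat (Suc (Suc n)) x) (at x)"
    proof -
      have "((\<lambda>x. exp (- inverse x)) has_real_derivative exp (- inverse x) * (inverse x)\<^sup>2) (at x)"
        using 1 by (auto intro!: derivative_eq_intros simp: power2_eq_square)
      from DERIV_mult[OF inverse_power_has_derivative[of x n] this] 1
      show ?thesis by (simp add: flat_def algebra_simps power2_eq_square)
    qed
    then show ?thesis
      by (rule has_field_derivative_transform_within_open[of _ _ _ "{0<..}"]) (use 1 in \<open>auto simp: flat_def\<close>)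
  next
    case 2
    have "((\<lambda>x. 0) has_real_derivative
        - real n * flat (Suc n) x + 1 * flat (Suc (Suc n)) x) (at x)"
      using 2 by (auto intro!: derivative_eq_intros simp: flat_def)
    then show ?thesis
      by (rule has_field_derivative_transform_within_open[of _ _ _ "{..<0}"]) (use 2 in \<open>auto simp: flat_def\<close>)
  next
    case 3
    \<comment> \<open>At 0 the difference quotient of \<open>flat n\<close> is
      \<open>flat (Suc n)\<close>, whose limit is already known.\<close>
    have "((\<lambda>y. (flat n y - flat n 0) / (y - 0)) \<longlongrightarrow> 0) (at 0)"
      by (rule Lim_transform_eventually[OF flat_tendsto_0[of "Suc n"]])
         (auto simp: flat_def eventually_at_filter divide_inverse algebra_simps)
    then show ?thesis using 3 by (simp add: has_field_derivative_iff flat_def)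
  qed
qed

text \<open>The classical smooth function exp(-1/x), extended by 0 to the nonpositive
  numbers.\<close>

definition bump :: "real \<Rightarrow> real" where "bump = flat 0"

lemma bump_eq: "bump x = (if x > 0 then exp (- (1 / x)) else 0)"
  by (simp add: bump_def flat_def divide_inverse)

lemma smooth_on_bump [smooth_intros]:
  assumes "smooth_on S f" shows "smooth_on S (\<lambda>x. bump (f x))"
proof (rule smooth_on_compose[OF _ assms])
  show "smooth_on UNIV bump"
    unfolding bump_def
    by (rule smooth_onI[of UNIV])
       (auto intro: C_on_deriv_family[where f = flat, OF open_UNIV flat_has_derivative])
qed simp

lemma bump_nonneg [simp]: "bump x \<ge> 0"
  by (simp add: bump_eq)

lemma bump_pos [simp]: "bump x > 0 \<longleftrightarrow> x > 0"
  by (simp add: bump_eq)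

lemma bump_eq_0 [simp]: "bump x = 0 \<longleftrightarrow> x \<le> 0"
  by (auto simp: bump_eq)

lemma bump_has_derivative: "(bump has_real_derivative flat 2 x) (at x)"
  using flat_has_derivative[of 0 x] by (simp add: bump_def numeral_2_eq_2)

lemma bump_strict_mono: "x < y \<Longrightarrow> 0 < y \<Longrightarrow> bump x < bump y"
  by (auto simp: bump_eq field_simps)

lemma bump_mono: "x \<le> y \<Longrightarrow> bump x \<le> bump y"
  by (auto simp: bump_eq field_simps)

lemma flat_nonneg: "flat n x \<ge> 0" by (simp add: flat_def)
lemma flat_pos: "flat n x > 0 \<longleftrightarrow> x > 0" by (simp add: flat_def)

text \<open>For a < b, the standard smooth transition from 0 on the left of \<open>a\<close> to 1 on
  the right of \<open>b\<close>.\<close>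

definition step :: "real \<Rightarrow> real \<Rightarrow> real \<Rightarrow> real" where
  "step a b u = bump (u - a) / (bump (u - a) + bump (b - u))"

lemma step_denominator_pos: "a < b \<Longrightarrow> bump (u - a) + bump (b - u) > 0"
  by (smt (verit) bump_nonneg bump_pos)

lemma smooth_on_step [smooth_intros]:
  assumes "smooth_on S f" "a < b" shows "smooth_on S (\<lambda>x. step a b (f x))"
  unfolding step_def
  by (intro smooth_intros assms) (metis step_denominator_pos assms(2) less_irrefl)

lemma step_eq_0 [simp]: "u \<le> a \<Longrightarrow> step a b u = 0"
  by (simp add: step_def)

lemma step_eq_1 [simp]: "a < b \<Longrightarrow> b \<le> u \<Longrightarrow> step a b u = 1"
  using bump_pos[of "u - a"] bump_eq_0[of "b - u"] unfolding step_def by (simp del: bump_pos bump_eq_0)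

lemma step_bounds: "0 \<le> step a b u" "step a b u \<le> 1"
  by (auto simp: step_def divide_le_eq_1 add_nonneg_nonneg
      intro!: divide_nonneg_nonneg) (smt (verit) bump_nonneg)+

text \<open>The hypotheses exclude exactly that both points lie in the same region of
  constancy.\<close>

lemma step_strict_mono:
  assumes "u < v" "a < v" "u < b" "a < b"
  shows "step a b u < step a b v"
proof -
  let ?p = "bump (u - a)" and ?q = "bump (b - u)" and ?p' = "bump (v - a)" and ?q' = "bump (b - v)"
  have "?p < ?p'" "?q' \<le> ?q" "0 < ?q" "0 < ?p'"
    using assms by (auto intro: bump_strict_mono bump_mono)
  \<comment> \<open>Cross-multiplying p / (p + q) < p' / (p' + q') and cancelling p p' leaves this
    inequality.\<close>
  then have "?p * ?q' < ?p' * ?q"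
    by (smt (verit, ccfv_SIG) bump_nonneg mult_less_le_imp_less mult_left_mono mult_strict_right_mono)
  then have "?p * (?p' + ?q') < ?p' * (?p + ?q)" by (simp add: algebra_simps)
  then show ?thesis
    unfolding step_def using step_denominator_pos[OF assms(4)]
    by (simp add: pos_divide_less_eq pos_less_divide_eq)
qed

lemma step_mono: "u \<le> v \<Longrightarrow> a < b \<Longrightarrow> step a b u \<le> step a b v"
  by (smt (verit) step_eq_0 step_eq_1 step_bounds step_strict_mono)

text \<open>The reflection u -> a + b - u exchanges the two bumps in the quotient.\<close>

lemma step_reflect: "a + b = c \<Longrightarrow> a < b \<Longrightarrow> step a b (c - u) = 1 - step a b u"
  using step_denominator_pos[of a b u]
  by (auto simp: step_def field_simps)

lemma step_has_derivative_pos: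
  assumes "a < u" "u < b"
  shows "\<exists>d>0. (step a b has_real_derivative d) (at u)"
proof -
  let ?p = "bump (u - a)" and ?q = "bump (b - u)"
  let ?d = "(flat 2 (u - a) * (?p + ?q) - ?p * (flat 2 (u - a) - flat 2 (b - u))) / (?p + ?q)\<^sup>2"
  have s: "?p + ?q > 0" using assms by (intro step_denominator_pos) auto
  have "((\<lambda>u. bump (u - a)) has_real_derivative flat 2 (u - a) * 1) (at u)"
    by (rule DERIV_chain2[OF bump_has_derivative]) (auto intro!: derivative_eq_intros)
  moreover have "((\<lambda>u. bump (b - u)) has_real_derivative flat 2 (b - u) * (-1)) (at u)"
    by (rule DERIV_chain2[OF bump_has_derivative]) (auto intro!: derivative_eq_intros)
  ultimately have "(step a b has_real_derivative ?d) (at u)"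
    unfolding step_def [abs_def] using s
    by (auto intro!: derivative_eq_intros simp: power2_eq_square)
  moreover have "?d > 0"
  proof -
    have "flat 2 (u - a) * (?p + ?q) - ?p * (flat 2 (u - a) - flat 2 (b - u)) = flat 2 (u - a) * ?q + ?p * flat 2 (b - u)"
      by (simp add: algebra_simps)
    also have "\<dots> > 0" using assms by (intro add_pos_pos mult_pos_pos) (auto simp: flat_pos)
    finally show ?thesis using s by simp
  qed
  ultimately show ?thesis by blast
qed

section \<open>The thickened annulus and changes of height\<close>

lemma proj_nth [simp]: "proj p $ 1 = p $ 1" "proj p $ 2 = p $ 2"
  by (simp_all add: proj_def)

lemma norm_proj: "norm (proj p) = sqrt ((p $ 1)\<^sup>2 + (p $ 2)\<^sup>2)"
  by (simp add: norm_vec_def L2_set_def sum_2)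

lemma proj_scaleR: "proj (c *\<^sub>R p) = c *\<^sub>R proj p"
  by (simp add: vec_eq_iff forall_2)

definition open_thick :: "point set" where
  "open_thick = {p. 1 < norm (proj p) \<and> norm (proj p) < 2 \<and> -1 < p $ 3 \<and> p $ 3 < 1}"

lemma thick_annulus_iff:
  "p \<in> thick_annulus \<longleftrightarrow> 1 \<le> norm (proj p) \<and> norm (proj p) \<le> 2 \<and> -1 \<le> p $ 3 \<and> p $ 3 \<le> 1"
  by (simp add: thick_annulus_def annulus_def)

text \<open>For the inclusion of the interior, a point is scaled by 1 + t and by 1 - t. Both results
  remain in the closed set, and the scaling moves strictly with respect to each bounding surface,
  which makes all inequalities strict.\<close>

lemma interior_thick_annulus: "interior thick_annulus = open_thick"
proof
  have "open open_thick"
    unfolding open_thick_def norm_proj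
    by (intro open_Collect_conj open_Collect_less continuous_intros)
  then show "open_thick \<subseteq> interior thick_annulus"
    by (rule interior_maximal[rotated]) (auto simp: open_thick_def thick_annulus_iff)
next
  show "interior thick_annulus \<subseteq> open_thick"
  proof
    fix p assume "p \<in> interior thick_annulus"
    then obtain e where e: "e > 0" "ball p e \<subseteq> thick_annulus" by (auto simp: mem_interior)
    \<comment> \<open>Small enough that both scaled points stay in the ball of radius
      \<open>e\<close>; the summand 1 keeps the denominator positive.\<close>
    define t where "t = min (1/2) (e / (2 * (norm p + 1)))"
    have t: "0 < t" "t < 1" using e by (auto simp: t_def add_nonneg_pos)
    have "t * norm p \<le> e / (2 * (norm p + 1)) * norm p"
      by (intro mult_right_mono) (auto simp: t_def)
    also have "\<dots> < e"
    proof -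
      have "e * norm p < e * (2 * (norm p + 1))"
        using e(1) by (intro mult_strict_left_mono) (auto intro: add_nonneg_pos)
      moreover have "0 < 2 * (norm p + 1)" by (simp add: add_nonneg_pos)
      ultimately show ?thesis by (simp only: times_divide_eq_left pos_divide_less_eq)
    qed
    finally have tp: "t * norm p < e" .
    have "(1 + c) *\<^sub>R p \<in> thick_annulus" if "\<bar>c\<bar> = t" for c
    proof -
      have "dist p ((1 + c) *\<^sub>R p) = t * norm p"
        using that by (simp add: dist_norm algebra_simps)
      then show ?thesis using e tp by auto
    qed
    from this[of t] this[of "- t"] t
    have *: "(1 + t) *\<^sub>R p \<in> thick_annulus" "(1 - t) *\<^sub>R p \<in> thick_annulus" by auto
    have "1 \<le> (1 - t) * norm (proj p)" "(1 + t) * norm (proj p) \<le> 2"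
        "- 1 \<le> (1 + t) * p $ 3" "(1 + t) * p $ 3 \<le> 1"
      using * t by (auto simp: thick_annulus_iff proj_scaleR)
    have "norm (proj p) \<noteq> 0" using \<open>1 \<le> (1 - t) * norm (proj p)\<close> by auto
    then have pos: "norm (proj p) > 0" by simp
    have "(1 - t) * norm (proj p) < 1 * norm (proj p)" "1 * norm (proj p) < (1 + t) * norm (proj p)"
      using t pos by (auto intro!: mult_strict_right_mono simp del: mult_1)
    moreover have "- 1 < p $ 3"
    proof (rule ccontr)
      assume "\<not> - 1 < p $ 3"
      then have "(1 + t) * p $ 3 \<le> (1 + t) * (-1)" using t by (intro mult_left_mono) auto
      then show False using * t \<open>- 1 \<le> (1 + t) * p $ 3\<close> by (simp add: thick_annulus_iff)
    qed
    moreover have "p $ 3 < 1"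
    proof (rule ccontr)
      assume "\<not> p $ 3 < 1"
      then have "(1 + t) * 1 \<le> (1 + t) * p $ 3" using t by (intro mult_left_mono) auto
      also have "\<dots> \<le> 1" by fact
      finally show False using t by simp
    qed
    ultimately show "p \<in> open_thick"
      using \<open>1 \<le> (1 - t) * norm (proj p)\<close> \<open>(1 + t) * norm (proj p) \<le> 2\<close>
      by (simp add: open_thick_def)
  qed
qed

lemma closed_thick_annulus: "closed thick_annulus"
proof -
  have "thick_annulus = {p. 1 \<le> norm (proj p) \<and> norm (proj p) \<le> 2 \<and> -1 \<le> p $ 3 \<and> p $ 3 \<le> 1}"
    using thick_annulus_iff by blast
  also have "closed \<dots>"
    unfolding norm_proj by (intro closed_Collect_conj closed_Collect_le continuous_intros)
  finally show ?thesis .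
qed

lemma frontier_thick_annulus: "frontier thick_annulus = thick_annulus - open_thick"
  by (simp add: frontier_def interior_thick_annulus closed_thick_annulus closure_closed)

section \<open>Affine changes of height\<close>

text \<open>One family containing \<open>raise\<close>, \<open>squeeze\<close> and
  \<open>lower\<close> and closed under composition. Its derivative is \<open>hmap a 0\<close>, so
  points and framings are transformed within the same family.\<close>

definition hmap :: "real \<Rightarrow> real \<Rightarrow> point \<Rightarrow> point" where
  "hmap a b p = vector [p $ 1, p $ 2, a * p $ 3 + b]"

lemma hmap_nth [simp]: "hmap a b p $ 1 = p $ 1" "hmap a b p $ 2 = p $ 2" "hmap a b p $ 3 = a * p $ 3 + b"
  by (simp_all add: hmap_def)

lemma point_eq_iff: "(p :: point) = q \<longleftrightarrow> p $ 1 = q $ 1 \<and> p $ 2 = q $ 2 \<and> p $ 3 = q $ 3"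
  by (simp add: vec_eq_iff forall_3)

lemma raise_eq: "raise = hmap (1/4) (3/4)"
  and squeeze_eq: "squeeze = hmap (1/4) 0"
  and lower_eq: "lower = hmap (1/4) (-3/4)"
  by (auto simp: raise_def squeeze_def lower_def point_eq_iff fun_eq_iff field_simps)

lemma proj_hmap [simp]: "proj (hmap a b p) = proj p"
  by (simp add: vec_eq_iff forall_2)

lemma inj_hmap: "a \<noteq> 0 \<Longrightarrow> inj (hmap a b)"
  by (auto intro!: injI simp: point_eq_iff)

lemma hmap_hmap [simp]: "hmap a b (hmap c d p) = hmap (a * c) (a * d + b) p"
  by (simp add: point_eq_iff algebra_simps)

lemma hmap_fixes: "p $ 3 = 0 \<Longrightarrow> hmap a 0 p = p"
  by (simp add: point_eq_iff)

lemma bounded_linear_hmap: "bounded_linear (hmap a 0)"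
  unfolding linear_conv_bounded_linear[symmetric] by (auto intro!: linearI simp: point_eq_iff algebra_simps)

lemma linear_hmap: "linear (hmap a 0)"
  using bounded_linear_hmap by (rule bounded_linear.linear)

lemma hmap_eq: "hmap a b = (\<lambda>p. hmap a 0 p + hmap a b 0)"
  by (auto simp: point_eq_iff fun_eq_iff)

lemma hmap_has_derivative: "(hmap a b has_derivative hmap a 0) (at x within S)"
proof -
  have "((\<lambda>p. hmap a 0 p + hmap a b 0) has_derivative (\<lambda>p. hmap a 0 p + 0)) (at x within S)"
    by (intro has_derivative_add bounded_linear_imp_has_derivative bounded_linear_hmap has_derivative_const)
  then show ?thesis by (simp add: hmap_eq[symmetric])
qed

lemma frechet_derivative_hmap: "frechet_derivative (hmap a b) (at x) = hmap a 0"
  using frechet_derivative_at[OF hmap_has_derivative] by simp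

lemma push_hmap: "push (hmap a b) L = map_prod (hmap a b) (hmap a 0) ` L"
  by (simp add: push_def frechet_derivative_hmap map_prod_def)

lemma push_hmap_hmap: "push (hmap a b) (push (hmap c d) L) = push (hmap (a * c) (a * d + b)) L"
  by (simp add: push_hmap image_image map_prod_def case_prod_unfold)

lemma push_Un: "push h (L \<union> K) = push h L \<union> push h K"
  by (simp add: push_def image_Un)

lemma push_empty [simp]: "push h {} = {}"
  by (simp add: push_def)

lemma fst_push: "fst ` push h L = h ` fst ` L"
  by (force simp: push_def)

text \<open>Heights are carried into the interval of radius \<open>a\<close> around
  \<open>b\<close>, which a + |b| \<le> 1 keeps within [-1, 1]. The second conclusion locates the
  layer and later proves layers disjoint.\<close>

lemma hmap_thick:
  assumes "p \<in> thick_annulus" "0 < a" "a + \<bar>b\<bar> \<le> 1"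
  shows "hmap a b p \<in> thick_annulus" "\<bar>hmap a b p $ 3 - b\<bar> \<le> a"
proof -
  have "\<bar>p $ 3\<bar> \<le> 1" using assms(1) by (auto simp: thick_annulus_iff)
  then have "\<bar>a * p $ 3\<bar> \<le> a" using assms(2) by (simp add: abs_mult mult_left_le)
  then show "hmap a b p \<in> thick_annulus" "\<bar>hmap a b p $ 3 - b\<bar> \<le> a"
    using assms by (auto simp: thick_annulus_iff)
qed

lemma hmap_open_thick:
  assumes "p \<in> open_thick" "0 < a" "a + \<bar>b\<bar> \<le> 1"
  shows "hmap a b p \<in> open_thick"
proof -
  have "\<bar>p $ 3\<bar> < 1" using assms(1) by (auto simp: open_thick_def)
  then have "\<bar>a * p $ 3\<bar> < a" using assms(2) by (simp add: abs_mult)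
  then show ?thesis
    using assms by (auto simp: open_thick_def)
qed


section \<open>Height changes acting on components and links\<close>

definition hcomp :: "real \<Rightarrow> real \<Rightarrow> component \<Rightarrow> component" where
  "hcomp a b c = (fst c, \<lambda>u. map_prod (hmap a b) (hmap a 0) (snd c u))"

lemma fst_hcomp [simp]: "fst (hcomp a b c) = fst c"
  by (simp add: hcomp_def)

lemma framed_trace_hcomp: "framed_trace (hcomp a b c) = push (hmap a b) (framed_trace c)"
  by (simp add: framed_trace_def hcomp_def push_hmap image_image)

lemma point_trace_hcomp: "point_trace (hcomp a b c) = hmap a b ` point_trace c"
  by (simp add: point_trace_def framed_trace_hcomp fst_push)

lemma endpoints_hcomp: "endpoints (hcomp a b c) = hmap a b ` endpoints c"
  by (simp add: endpoints_def hcomp_def)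

lemma framed_image_hcomp: "framed_image (map (hcomp a b) cs) = push (hmap a b) (framed_image cs)"
  unfolding framed_image_def set_map UN_simps framed_trace_hcomp by (simp add: push_def image_UN)

lemma framed_image_append: "framed_image (cs @ ds) = framed_image cs \<union> framed_image ds"
  by (simp add: framed_image_def)

lemma fst_framed_image: "fst ` framed_image cs = (\<Union>c\<in>set cs. point_trace c)"
  by (auto simp: framed_image_def point_trace_def)

lemma param_dom_subset: "param_dom cl \<subseteq> smooth_dom cl"
  by (auto simp: param_dom_def smooth_dom_def)

lemma smooth_on_has_tangent:
  assumes "smooth_on S \<gamma>" "u \<in> S"
  shows "((\<lambda>w. fst (\<gamma> w)) has_vector_derivative tangent \<gamma> u) (at u)"
proof -
  have "(\<lambda>w. fst (\<gamma> w)) differentiable at u"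
    using smooth_on_has_derivative[OF smooth_on_fst[OF assms(1)] assms(2)] differentiableI by blast
  then show ?thesis
    unfolding tangent_def by (simp add: vector_derivative_works)
qed

lemma tangent_hcomp:
  assumes "smooth_on S (snd c)" "u \<in> S"
  shows "tangent (snd (hcomp a b c)) u = hmap a 0 (tangent (snd c) u)"
proof -
  have "((\<lambda>w. hmap a b (fst (snd c w))) has_vector_derivative hmap a 0 (tangent (snd c) u)) (at u)"
    using has_derivative_compose[OF smooth_on_has_tangent[OF assms, unfolded has_vector_derivative_def] hmap_has_derivative]
    by (simp add: has_vector_derivative_def linear_cmul[OF linear_hmap])
  then show ?thesis
    unfolding tangent_def hcomp_def by (simp add: vector_derivative_at)
qed

text \<open>Scaling heights by \<open>a\<close> multiplies the first two coordinates of the cross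
  product by \<open>a\<close> and preserves the third.\<close>

lemma cross3_hmap_nonzero:
  assumes "cross3 x y \<noteq> 0" "a > 0"
  shows "cross3 (hmap a 0 x) (hmap a 0 y) \<noteq> 0"
proof
  assume "cross3 (hmap a 0 x) (hmap a 0 y) = 0"
  then have "a * (x $ 2 * y $ 3 - x $ 3 * y $ 2) = 0" "a * (x $ 3 * y $ 1 - x $ 1 * y $ 3) = 0"
      "x $ 1 * y $ 2 - x $ 2 * y $ 1 = 0"
    by (simp_all add: cross3_def point_eq_iff algebra_simps)
  with assms show False by (simp add: cross3_def point_eq_iff)
qed

lemma framed_embedding_hcomp:
  assumes "framed_embedding c" "0 < a"
  shows "framed_embedding (hcomp a b c)"
proof -
  obtain cl \<gamma> where c: "c = (cl, \<gamma>)" by (cases c)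
  from assms(1) have sm: "smooth_on (smooth_dom cl) \<gamma>"
    and per: "cl \<Longrightarrow> \<gamma> (u + 1) = \<gamma> u"
    and inj: "inj_on (\<lambda>u. fst (\<gamma> u)) (param_dom cl)"
    and cr: "\<And>u. u \<in> param_dom cl \<Longrightarrow> cross3 (tangent \<gamma> u) (snd (\<gamma> u)) \<noteq> 0" for u
    by (auto simp: framed_embedding_def c)
  have "smooth_on (smooth_dom cl) (\<lambda>u. map_prod (hmap a b) (hmap a 0) (\<gamma> u))"
    unfolding map_prod_def case_prod_unfold hmap_def by (intro smooth_intros sm)
  moreover have "inj_on (\<lambda>u. hmap a b (fst (\<gamma> u))) (param_dom cl)"
    using inj assms(2) inj_hmap[of a b] by (auto simp: inj_on_def)
  moreover have "cross3 (tangent (snd (hcomp a b c)) u) (hmap a 0 (snd (\<gamma> u))) \<noteq> 0" if "u \<in> param_dom cl" for u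
  proof -
    have "tangent (snd (hcomp a b c)) u = hmap a 0 (tangent \<gamma> u)"
      using tangent_hcomp[of "smooth_dom cl" c u a b] sm that param_dom_subset by (auto simp: c)
    then show ?thesis using cr[OF that] assms(2) by (auto dest: cross3_hmap_nonzero)
  qed
  ultimately show ?thesis
    by (auto simp: framed_embedding_def hcomp_def c per)
qed

definition boundary_normal :: "point set \<Rightarrow> component \<Rightarrow> bool" where
  "boundary_normal P c \<longleftrightarrow> (\<forall>u\<in>param_dom (fst c). fst (snd c u) \<in> P \<longrightarrow>
     (\<exists>a. tangent (snd c) u = a *\<^sub>R fst (snd c u)) \<and> (\<exists>a>0. snd (snd c u) = a *\<^sub>R vertical))"

lemma relative_framed_link_iff:
  "relative_framed_link P cs \<longleftrightarrow>
     (\<forall>c\<in>set cs. framed_embedding c \<and> point_trace c \<subseteq> thick_annulus) \<and>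
     sorted_wrt (\<lambda>c d. disjnt (point_trace c) (point_trace d)) cs \<and>
     (\<Union>c\<in>set cs. endpoints c) = P \<and>
     (\<Union>c\<in>set cs. point_trace c) \<inter> frontier thick_annulus = P \<and>
     (\<forall>c\<in>set cs. boundary_normal P c)"
  unfolding relative_framed_link_def boundary_normal_def case_prod_unfold by blast

text \<open>The marked points have height 0, which a shift by \<open>b\<close> would destroy; so a
  layer away from the middle may carry closed components only. Interior points stay interior under
  \<open>hmap\<close>, hence no new contact with the boundary arises.\<close>

lemma relative_framed_link_hcomp:
  assumes link: "relative_framed_link P cs" and a: "0 < a" "a + \<bar>b\<bar> \<le> 1"
    and P: "P = {} \<or> b = 0 \<and> (\<forall>p\<in>P. p $ 3 = 0)"
  shows "relative_framed_link P (map (hcomp a b) cs)"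
  unfolding relative_framed_link_iff
proof (intro conjI)
  have hP: "hmap a b p = p" if "p \<in> P" for p using P that by (auto intro: hmap_fixes)
  then have hPi: "hmap a b ` P = P" by force
  have emb: "\<And>c. c \<in> set cs \<Longrightarrow> framed_embedding c" "\<And>c. c \<in> set cs \<Longrightarrow> point_trace c \<subseteq> thick_annulus"
    and disj: "sorted_wrt (\<lambda>c d. disjnt (point_trace c) (point_trace d)) cs"
    and ends: "(\<Union>c\<in>set cs. endpoints c) = P"
    and front: "(\<Union>c\<in>set cs. point_trace c) \<inter> frontier thick_annulus = P"
    and tang: "\<And>c. c \<in> set cs \<Longrightarrow> boundary_normal P c"
    using link unfolding relative_framed_link_iff by auto
  have inP: "p \<in> P" if "p \<in> point_trace c" "c \<in> set cs" "hmap a b p \<in> frontier thick_annulus" for p c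
  proof -
    have "p \<notin> open_thick"
      using hmap_open_thick[of p a b] a that(3) by (auto simp: frontier_thick_annulus)
    then have "p \<in> frontier thick_annulus"
      using emb(2)[OF that(2)] that(1) by (auto simp: frontier_thick_annulus)
    then show ?thesis using front that by auto
  qed
  show "\<forall>c\<in>set (map (hcomp a b) cs). framed_embedding c \<and> point_trace c \<subseteq> thick_annulus"
    using emb a by (fastforce simp: point_trace_hcomp intro: framed_embedding_hcomp hmap_thick)
  have "sorted_wrt (\<lambda>c d. disjnt (hmap a b ` point_trace c) (hmap a b ` point_trace d)) cs"
    using disj by (rule sorted_wrt_mono_rel[rotated])
      (use inj_hmap[of a b] a in \<open>auto simp: disjnt_def image_Int[symmetric]\<close>)
  then show "sorted_wrt (\<lambda>c d. disjnt (point_trace c) (point_trace d)) (map (hcomp a b) cs)"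
    by (simp add: sorted_wrt_map point_trace_hcomp)
  have "(\<Union>c\<in>set (map (hcomp a b) cs). endpoints c) = hmap a b ` (\<Union>c\<in>set cs. endpoints c)"
    by (auto simp: endpoints_hcomp)
  then show "(\<Union>c\<in>set (map (hcomp a b) cs). endpoints c) = P"
    by (simp add: ends hPi)
  show "(\<Union>c\<in>set (map (hcomp a b) cs). point_trace c) \<inter> frontier thick_annulus = P"
  proof
    show "(\<Union>c\<in>set (map (hcomp a b) cs). point_trace c) \<inter> frontier thick_annulus \<subseteq> P"
    proof
      fix x assume "x \<in> (\<Union>c\<in>set (map (hcomp a b) cs). point_trace c) \<inter> frontier thick_annulus"
      then obtain c p where "c \<in> set cs" "p \<in> point_trace c" "x = hmap a b p" "x \<in> frontier thick_annulus"
        by (auto simp: point_trace_hcomp)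
      then show "x \<in> P" using inP[of p c] hP[of p] by simp
    qed
    show "P \<subseteq> (\<Union>c\<in>set (map (hcomp a b) cs). point_trace c) \<inter> frontier thick_annulus"
    proof
      fix p assume p: "p \<in> P"
      then obtain c where "c \<in> set cs" "p \<in> point_trace c" "p \<in> frontier thick_annulus" using front by blast
      then show "p \<in> (\<Union>c\<in>set (map (hcomp a b) cs). point_trace c) \<inter> frontier thick_annulus"
        using hP[OF p] by (force simp: point_trace_hcomp)
    qed
  qed
  show "\<forall>c\<in>set (map (hcomp a b) cs). boundary_normal P c"
    unfolding boundary_normal_def
  proof (intro ballI impI)
    fix c' u
    assume "c' \<in> set (map (hcomp a b) cs)" and u: "u \<in> param_dom (fst c')" and P': "fst (snd c' u) \<in> P"
    then obtain c where c: "c \<in> set cs" "c' = hcomp a b c" by auto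
    obtain cl \<gamma> where c2: "c = (cl, \<gamma>)" by (cases c)
    define \<gamma>' where "\<gamma>' = snd c'"
    have \<gamma>': "\<gamma>' u = map_prod (hmap a b) (hmap a 0) (\<gamma> u)" and u: "u \<in> param_dom cl" and P': "fst (\<gamma>' u) \<in> P"
      using c c2 u P' by (auto simp: hcomp_def \<gamma>'_def)
    have "fst (\<gamma> u) \<in> point_trace c" using u by (auto simp: point_trace_def framed_trace_def c2)
    moreover have "hmap a b (fst (\<gamma> u)) \<in> P" using P' \<gamma>' by simp
    ultimately have P2: "fst (\<gamma> u) \<in> P" using inP c(1) front by blast
    obtain k l where kl: "tangent \<gamma> u = k *\<^sub>R fst (\<gamma> u)" "l > 0" "snd (\<gamma> u) = l *\<^sub>R vertical"
      using tang[OF c(1)] c2 u P2 unfolding boundary_normal_def by (metis fst_conv snd_conv)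
    have P3: "fst (\<gamma> u) $ 3 = 0" "b = 0" using P P2 by auto
    have "smooth_on (smooth_dom cl) \<gamma>" using emb(1)[OF c(1)] by (auto simp: framed_embedding_def c2)
    then have "tangent \<gamma>' u = hmap a 0 (tangent \<gamma> u)"
      using tangent_hcomp[of "smooth_dom cl" c u a b] u param_dom_subset c(2) c2 by (auto simp: \<gamma>'_def)
    then have "tangent \<gamma>' u = k *\<^sub>R fst (\<gamma>' u)"
      using kl P3 by (simp add: \<gamma>' linear_cmul[OF linear_hmap])
    moreover have "snd (\<gamma>' u) = (a * l) *\<^sub>R vertical"
      using kl by (simp add: \<gamma>' point_eq_iff axis_def)
    ultimately show "(\<exists>a. tangent (snd c') u = a *\<^sub>R fst (snd c' u)) \<and> (\<exists>a>0. snd (snd c' u) = a *\<^sub>R vertical)"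
      using kl a unfolding \<gamma>'_def by (meson mult_pos_pos)
  qed
qed

text \<open>A link without marked points stays off the frontier, which contains \<open>P\<close>;
  for its components the boundary condition is vacuous.\<close>

lemma relative_framed_link_append:
  assumes cs: "relative_framed_link {} cs" and ds: "relative_framed_link P ds"
    and disj: "\<And>c d. c \<in> set cs \<Longrightarrow> d \<in> set ds \<Longrightarrow> disjnt (point_trace c) (point_trace d)"
  shows "relative_framed_link P (cs @ ds)"
proof -
  have P: "P \<subseteq> frontier thick_annulus" and cf: "(\<Union>c\<in>set cs. point_trace c) \<inter> frontier thick_annulus = {}"
    using cs ds by (auto simp: relative_framed_link_iff)
  have "boundary_normal P c" if "c \<in> set cs" for c
  proof -
    have "fst (snd c u) \<in> point_trace c" if "u \<in> param_dom (fst c)" for u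
      using that by (auto simp: point_trace_def framed_trace_def)
    then have "fst (snd c u) \<notin> P" if "u \<in> param_dom (fst c)" for u
      using P cf \<open>c \<in> set cs\<close> that by blast
    then show ?thesis by (simp add: boundary_normal_def)
  qed
  moreover have "(\<Union>c\<in>set (cs @ ds). endpoints c) = P"
    using cs ds by (simp add: relative_framed_link_iff)
  moreover have "(\<Union>c\<in>set (cs @ ds). point_trace c) \<inter> frontier thick_annulus = P"
    using cs ds by (simp add: relative_framed_link_iff Int_Un_distrib2)
  moreover have "sorted_wrt (\<lambda>c d. disjnt (point_trace c) (point_trace d)) (cs @ ds)"
    using cs ds disj by (simp add: relative_framed_link_iff sorted_wrt_append)
  ultimately show ?thesis
    using cs ds unfolding relative_framed_link_iff by auto
qed

section \<open>Layers and stacking\<close>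

definition isotopy_family :: "point set \<Rightarrow> component_family list \<Rightarrow> bool" where
  "isotopy_family P Fs \<longleftrightarrow>
     (\<forall>F\<in>set Fs. smooth_on ({0..1} \<times> smooth_dom (fst F)) (snd F)) \<and>
     (\<forall>s\<in>{0..1}. relative_framed_link P (map (at_time s) Fs))"

lemma isotopic_iff:
  "isotopic P L L' \<longleftrightarrow> (\<exists>Fs. isotopy_family P Fs \<and> L = framed_image (map (at_time 0) Fs) \<and>
     L' = framed_image (map (at_time 1) Fs))"
  by (auto simp: isotopic_def isotopy_family_def)

text \<open>Slope and offset depend on time, so that layers can slide past their old positions; the
  associativity of stacking is obtained from such slides.\<close>

definition hfam :: "(real \<Rightarrow> real) \<Rightarrow> (real \<Rightarrow> real) \<Rightarrow> component_family \<Rightarrow> component_family" where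
  "hfam a b F = (fst F, \<lambda>x. map_prod (hmap (a (fst x)) (b (fst x))) (hmap (a (fst x)) 0) (snd F x))"

definition constant_family :: "component \<Rightarrow> component_family" where
  "constant_family c = (fst c, \<lambda>x. snd c (snd x))"

lemma at_time_hfam: "at_time s (hfam a b F) = hcomp (a s) (b s) (at_time s F)"
  by (simp add: at_time_def hfam_def hcomp_def)

lemma at_time_constant_family [simp]: "at_time s (constant_family c) = c"
  by (simp add: at_time_def constant_family_def)

lemma map_at_time_hfam: "map (at_time s) (map (hfam a b) Fs) = map (hcomp (a s) (b s)) (map (at_time s) Fs)"
  by (simp add: at_time_hfam)

lemma map_at_time_constant_family: "map (at_time s) (map constant_family cs) = cs"
  by (simp add: map_idI)

lemma isotopy_family_constant:
  assumes "relative_framed_link P cs"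
  shows "isotopy_family P (map constant_family cs)"
proof -
  have "smooth_on ({0..1} \<times> smooth_dom (fst c)) (\<lambda>x. snd c (snd x))" if "c \<in> set cs" for c
  proof (rule smooth_on_compose[of "smooth_dom (fst c)" "snd c" _ snd])
    have "framed_embedding c" using assms that by (simp add: relative_framed_link_iff)
    then show "smooth_on (smooth_dom (fst c)) (snd c)"
      by (simp add: framed_embedding_def case_prod_unfold)
  qed (auto intro: smooth_intros)
  then show ?thesis
    using assms by (auto simp: isotopy_family_def constant_family_def o_def at_time_def)
qed

lemma isotopy_family_hfam:
  assumes F: "isotopy_family P Fs" and sm: "smooth_on UNIV a" "smooth_on UNIV b"
    and ab: "\<And>s. s \<in> {0..1} \<Longrightarrow> 0 < a s \<and> a s + \<bar>b s\<bar> \<le> 1"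
    and P: "P = {} \<or> (\<forall>s\<in>{0..1}. b s = 0) \<and> (\<forall>p\<in>P. p $ 3 = 0)"
  shows "isotopy_family P (map (hfam a b) Fs)"
  unfolding isotopy_family_def
proof (intro conjI ballI)
  fix G assume "G \<in> set (map (hfam a b) Fs)"
  then obtain F where G: "F \<in> set Fs" "G = hfam a b F" by auto
  then have 1: "smooth_on ({0..1} \<times> smooth_dom (fst F)) (snd F)" using F by (auto simp: isotopy_family_def)
  have 2: "smooth_on S (\<lambda>x. a (fst x))" "smooth_on S (\<lambda>x. b (fst x))" for S :: "(real \<times> real) set"
    using smooth_on_compose[OF sm(1) smooth_on_fst[OF smooth_on_id[of S]]]
      smooth_on_compose[OF sm(2) smooth_on_fst[OF smooth_on_id[of S]]] by auto
  show "smooth_on ({0..1} \<times> smooth_dom (fst G)) (snd G)"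
    unfolding G hfam_def fst_conv snd_conv map_prod_def case_prod_unfold hmap_def
    by (intro smooth_intros 1 2)
next
  fix s :: real assume s: "s \<in> {0..1}"
  show "relative_framed_link P (map (at_time s) (map (hfam a b) Fs))"
    unfolding map_at_time_hfam
    by (rule relative_framed_link_hcomp) (use F s ab P in \<open>auto simp: isotopy_family_def\<close>)
qed

text \<open>The last inequality separates the two height intervals, of radii \<open>a\<close>,
  \<open>a'\<close> around \<open>b\<close>, \<open>b'\<close>.\<close>

lemma disjnt_layers:
  assumes "relative_framed_link P cs" "relative_framed_link Q ds" "c \<in> set cs" "d \<in> set ds"
    "0 < a" "a + \<bar>b\<bar> \<le> 1" "0 < a'" "a' + \<bar>b'\<bar> \<le> 1" "a + a' < \<bar>b - b'\<bar>"
  shows "disjnt (point_trace (hcomp a b c)) (point_trace (hcomp a' b' d))"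
proof -
  have "point_trace c \<subseteq> thick_annulus" "point_trace d \<subseteq> thick_annulus"
    using assms by (auto simp: relative_framed_link_iff)
  then have bounds: "\<bar>hmap a b p $ 3 - b\<bar> \<le> a" "\<bar>hmap a' b' q $ 3 - b'\<bar> \<le> a'"
    if "p \<in> point_trace c" "q \<in> point_trace d" for p q
    using that assms(5-8) hmap_thick(2)[of p a b] hmap_thick(2)[of q a' b'] by blast+
  have "hmap a b p \<noteq> hmap a' b' q" if "p \<in> point_trace c" "q \<in> point_trace d" for p q
  proof
    assume "hmap a b p = hmap a' b' q"
    then have "\<bar>hmap a b p $ 3 - b\<bar> \<le> a" "\<bar>hmap a b p $ 3 - b'\<bar> \<le> a'"
      using bounds[OF that] by metis+
    then show False using assms(9) by linarith
  qed
  then show ?thesis by (auto simp: disjnt_def point_trace_hcomp)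
qed

lemma isotopy_family_append:
  assumes "isotopy_family {} Fs" "isotopy_family P Gs"
    and "\<And>s F G. s \<in> {0..1} \<Longrightarrow> F \<in> set Fs \<Longrightarrow> G \<in> set Gs \<Longrightarrow>
      disjnt (point_trace (at_time s F)) (point_trace (at_time s G))"
  shows "isotopy_family P (Fs @ Gs)"
  unfolding isotopy_family_def
proof (intro conjI ballI)
  fix s :: real assume "s \<in> {0..1}"
  then show "relative_framed_link P (map (at_time s) (Fs @ Gs))"
    unfolding map_append using assms
    by (intro relative_framed_link_append) (auto simp: isotopy_family_def)
qed (use assms in \<open>auto simp: isotopy_family_def\<close>)


lemma isotopy_family_layers:
  assumes F: "isotopy_family {} Fs" and G: "isotopy_family P Gs"
    and sm: "smooth_on UNIV a" "smooth_on UNIV b" "smooth_on UNIV c"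
    and ab: "\<And>s. s \<in> {0..1} \<Longrightarrow> 0 < a s \<and> a s + \<bar>b s\<bar> \<le> 1 \<and> 0 < c s \<and> c s \<le> 1 \<and> a s + c s < \<bar>b s\<bar>"
    and P: "\<forall>p\<in>P. p $ 3 = 0"
  shows "isotopy_family P (map (hfam a b) Fs @ map (hfam c (\<lambda>_. 0)) Gs)"
proof (rule isotopy_family_append)
  show "isotopy_family {} (map (hfam a b) Fs)"
    by (rule isotopy_family_hfam[OF F sm(1,2)]) (use ab in auto)
  show "isotopy_family P (map (hfam c (\<lambda>_. 0)) Gs)"
    by (rule isotopy_family_hfam[OF G sm(3) smooth_on_const]) (use ab P in auto)
next
  fix s :: real and F' G' assume s: "s \<in> {0..1}" and "F' \<in> set (map (hfam a b) Fs)" "G' \<in> set (map (hfam c (\<lambda>_. 0)) Gs)"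
  then obtain F0 G0 where "F0 \<in> set Fs" "G0 \<in> set Gs" "F' = hfam a b F0" "G' = hfam c (\<lambda>_. 0) G0" by auto
  then show "disjnt (point_trace (at_time s F')) (point_trace (at_time s G'))"
    using F G s ab[OF s] unfolding isotopy_family_def
    by (auto simp: at_time_hfam intro!: disjnt_layers[of "{}" "map (at_time s) Fs" P "map (at_time s) Gs"])
qed

section \<open>Stacked links and associativity\<close>

text \<open>Treats both products together: \<open>L\<close> is on top for c = 3/4 and at the bottom
  for c = -3/4.\<close>

definition stack :: "real \<Rightarrow> framed_set \<Rightarrow> framed_set \<Rightarrow> framed_set" where
  "stack c L K = push (hmap (1/4) c) L \<union> push (hmap (1/4) 0) K"

lemma stack_over_eq: "stack_over = stack (3/4)" and stack_under_eq: "stack_under = stack (-3/4)"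
  by (auto simp: fun_eq_iff stack_over_def stack_under_def stack_def raise_eq squeeze_eq lower_eq)

lemma isotopic_refl: "L \<in> links P \<Longrightarrow> isotopic P L L"
  unfolding isotopic_iff links_def
  by (clarify, intro exI conjI, erule isotopy_family_constant) (simp_all only: map_at_time_constant_family)

lemma isotopic_links: "isotopic P L L' \<Longrightarrow> L \<in> links P \<and> L' \<in> links P"
  unfolding isotopic_iff isotopy_family_def links_def by force

lemma isotopic_stack:
  assumes "isotopic {} L L'" "isotopic P K K'" "\<forall>p\<in>P. p $ 3 = 0" "\<bar>c\<bar> = 3/4"
  shows "isotopic P (stack c L K) (stack c L' K')"
proof -
  obtain Fs where Fs: "isotopy_family {} Fs" "L = framed_image (map (at_time 0) Fs)" "L' = framed_image (map (at_time 1) Fs)"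
    using assms(1) isotopic_iff by blast
  obtain Gs where Gs: "isotopy_family P Gs" "K = framed_image (map (at_time 0) Gs)" "K' = framed_image (map (at_time 1) Gs)"
    using assms(2) isotopic_iff by blast
  have "isotopy_family P (map (hfam (\<lambda>_. 1/4) (\<lambda>_. c)) Fs @ map (hfam (\<lambda>_. 1/4) (\<lambda>_. 0)) Gs)"
    by (rule isotopy_family_layers[OF Fs(1) Gs(1) smooth_on_const smooth_on_const smooth_on_const])
       (use assms in auto)
  then show ?thesis
    unfolding isotopic_iff
    by (intro exI conjI, assumption)
       (simp_all only: map_append map_at_time_hfam framed_image_append framed_image_hcomp stack_def Fs Gs)
qed

lemma stack_in_links:
  "L \<in> links {} \<Longrightarrow> K \<in> links P \<Longrightarrow> \<forall>p\<in>P. p $ 3 = 0 \<Longrightarrow> \<bar>c\<bar> = 3/4 \<Longrightarrow> stack c L K \<in> links P"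
  using isotopic_links[OF isotopic_stack[OF isotopic_refl isotopic_refl]] by simp

text \<open>The height intervals move but remain pairwise disjoint at all times. Only the layer of
  \<open>K\<close> is held at offset 0, because it may end at marked points.\<close>

lemma isotopic_three_layers:
  fixes a1 b1 a2 b2 a3 :: "real \<Rightarrow> real"
  assumes L: "L1 \<in> links {}" "L2 \<in> links {}" "K \<in> links P" and P: "\<forall>p\<in>P. p $ 3 = 0"
    and sm: "smooth_on UNIV a1" "smooth_on UNIV b1" "smooth_on UNIV a2" "smooth_on UNIV b2" "smooth_on UNIV a3"
    and ab: "\<And>s. s \<in> {0..1} \<Longrightarrow> 0 < a1 s \<and> a1 s + \<bar>b1 s\<bar> \<le> 1 \<and> 0 < a2 s \<and> a2 s + \<bar>b2 s\<bar> \<le> 1 \<and>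
      0 < a3 s \<and> a3 s \<le> 1 \<and> a1 s + a2 s < \<bar>b1 s - b2 s\<bar> \<and> a1 s + a3 s < \<bar>b1 s\<bar> \<and> a2 s + a3 s < \<bar>b2 s\<bar>"
  defines "S \<equiv> \<lambda>s. push (hmap (a1 s) (b1 s)) L1 \<union> (push (hmap (a2 s) (b2 s)) L2 \<union> push (hmap (a3 s) 0) K)"
  shows "isotopic P (S 0) (S 1)"
proof -
  obtain cs1 cs2 ds where l: "relative_framed_link {} cs1" "L1 = framed_image cs1"
      "relative_framed_link {} cs2" "L2 = framed_image cs2" "relative_framed_link P ds" "K = framed_image ds"
    using L unfolding links_def by auto
  note f = isotopy_family_constant[OF l(1)] isotopy_family_constant[OF l(3)] isotopy_family_constant[OF l(5)]
  let ?F1 = "map (hfam a1 b1) (map constant_family cs1)"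
  let ?F2 = "map (hfam a2 b2) (map constant_family cs2)"
  let ?G = "map (hfam a3 (\<lambda>_. 0)) (map constant_family ds)"
  have "isotopy_family P (?F1 @ (?F2 @ ?G))"
  proof (rule isotopy_family_append)
    show "isotopy_family {} ?F1"
      by (rule isotopy_family_hfam[OF f(1) sm(1,2)]) (use ab in auto)
    show "isotopy_family P (?F2 @ ?G)"
      by (rule isotopy_family_layers[OF f(2,3) sm(3,4,5)]) (use ab P in auto)
  next
    fix s :: real and F G assume s: "s \<in> {0..1}" and F: "F \<in> set ?F1" and G: "G \<in> set (?F2 @ ?G)"
    from F obtain c where c: "c \<in> set cs1" "at_time s F = hcomp (a1 s) (b1 s) c" by (auto simp: at_time_hfam)
    from G consider d where "d \<in> set cs2" "at_time s G = hcomp (a2 s) (b2 s) d"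
      | d where "d \<in> set ds" "at_time s G = hcomp (a3 s) 0 d" by (auto simp: at_time_hfam)
    then show "disjnt (point_trace (at_time s F)) (point_trace (at_time s G))"
    proof cases
      case 1
      show ?thesis unfolding c 1
        by (rule disjnt_layers[OF l(1,3) c(1) 1(1)]) (use ab[OF s] in auto)
    next
      case 2
      show ?thesis unfolding c 2
        by (rule disjnt_layers[OF l(1,5) c(1) 2(1)]) (use ab[OF s] in auto)
    qed
  qed
  then show ?thesis
    unfolding isotopic_iff S_def
    by (intro exI conjI, assumption)
       (simp_all only: map_append map_at_time_hfam map_at_time_constant_family framed_image_append framed_image_hcomp l)
qed

text \<open>Brings iterated stackings into the shape of three layers, so that associativity becomes
  a comparison of slopes and offsets.\<close>

lemma stack_stack_eq:
  "stack c (stack d L1 L2) K = push (hmap (1/16) (d/4 + c)) L1 \<union> (push (hmap (1/16) c) L2 \<union> push (hmap (1/4) 0) K)"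
  "stack c L1 (stack d L2 K) = push (hmap (1/4) c) L1 \<union> (push (hmap (1/16) (d/4)) L2 \<union> push (hmap (1/16) 0) K)"
  by (simp_all add: stack_def push_Un push_hmap_hmap Un_assoc)

lemma isotopic_stack_over_assoc:
  assumes "L1 \<in> links {}" "L2 \<in> links {}" "K \<in> links P" "\<forall>p\<in>P. p $ 3 = 0"
  shows "isotopic P (stack (3/4) (stack (3/4) L1 L2) K) (stack (3/4) L1 (stack (3/4) L2 K))"
proof -
  \<comment> \<open>Linear interpolations between the slopes and offsets of the two iterated
    stackings in \<open>stack_stack_eq\<close>.\<close>
  have sm: "smooth_on UNIV (\<lambda>s::real. 1/16 + s * (3/16))" "smooth_on UNIV (\<lambda>s::real. 15/16 - s * (3/16))" "smooth_on UNIV (\<lambda>s::real. 1/16)" "smooth_on UNIV (\<lambda>s::real. 3/4 - s * (9/16))" "smooth_on UNIV (\<lambda>s::real. 1/4 - s * (3/16))"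
    by (intro smooth_intros)+
  show ?thesis
    unfolding stack_stack_eq
    using isotopic_three_layers[OF assms sm] by (auto)
qed

text \<open>Below \<open>K\<close>, the upper factor \<open>L1\<close> of the product is the one
  next to \<open>K\<close>. It therefore acts first, and the order of the factors is reversed
  compared with stacking above.\<close>

lemma isotopic_stack_under_assoc:
  assumes "L1 \<in> links {}" "L2 \<in> links {}" "K \<in> links P" "\<forall>p\<in>P. p $ 3 = 0"
  shows "isotopic P (stack (-3/4) (stack (3/4) L1 L2) K) (stack (-3/4) L2 (stack (-3/4) L1 K))"
proof -
  have sm: "smooth_on UNIV (\<lambda>s::real. 1/16)" "smooth_on UNIV (\<lambda>s::real. - (9/16) + s * (6/16))" "smooth_on UNIV (\<lambda>s::real. 1/16 + s * (3/16))" "smooth_on UNIV (\<lambda>s::real. - (3/4))" "smooth_on UNIV (\<lambda>s::real. 1/4 - s * (3/16))"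
    by (intro smooth_intros)+
  show ?thesis
    unfolding stack_stack_eq
    using isotopic_three_layers[OF assms sm] by (auto simp: Un_ac)
qed

section \<open>Transport of balls and skein relations into a layer\<close>

text \<open>The linear part \<open>hmap a 0\<close> has determinant \<open>a\<close>, which is
  positive, so the orientation is preserved. The chain rule is available only on the cylinder, where
  \<open>h\<close> is known to be differentiable.\<close>

lemma ball_chart_hmap:
  assumes h: "ball_chart h" and a: "0 < a" "a + \<bar>b\<bar> \<le> 1"
  shows "ball_chart (\<lambda>p. hmap a b (h p))"
    and "\<And>p. p \<in> cylinder \<Longrightarrow> frechet_derivative (\<lambda>p. hmap a b (h p)) (at p) = (\<lambda>v. hmap a 0 (frechet_derivative h (at p) v))"
proof -
  have sm: "smooth_on cylinder h" using h by (simp add: ball_chart_def)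
  have hd: "(h has_derivative frechet_derivative h (at p)) (at p)" if "p \<in> cylinder" for p
    using smooth_on_has_derivative[OF sm that] .
  show fd: "frechet_derivative (\<lambda>p. hmap a b (h p)) (at p) = (\<lambda>v. hmap a 0 (frechet_derivative h (at p) v))"
    if "p \<in> cylinder" for p
    using frechet_derivative_at[OF has_derivative_compose[OF hd[OF that] hmap_has_derivative]] by simp
  have det_hmap: "det (matrix (hmap a 0)) = a"
    by (simp add: det_3 matrix_def axis_def)
  have "smooth_on cylinder (\<lambda>p. hmap a b (h p))"
    unfolding hmap_def by (intro smooth_intros sm)
  moreover have "inj_on (\<lambda>p. hmap a b (h p)) cylinder"
    using h inj_hmap[of a b] a by (auto simp: ball_chart_def inj_on_def)
  moreover have "det (matrix (frechet_derivative (\<lambda>p. hmap a b (h p)) (at p))) > 0" if "p \<in> cylinder" for p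
  proof -
    have "matrix (\<lambda>v. hmap a 0 (frechet_derivative h (at p) v)) = matrix (hmap a 0) ** matrix (frechet_derivative h (at p))"
      using matrix_compose[of "frechet_derivative h (at p)" "hmap a 0"] hd[OF that] linear_hmap
      by (simp add: o_def has_derivative_linear)
    then show ?thesis
      using h a that by (simp add: fd det_mul det_hmap ball_chart_def)
  qed
  moreover have "(\<lambda>p. hmap a b (h p)) ` cylinder \<subseteq> interior thick_annulus"
    using h a hmap_open_thick by (auto simp: ball_chart_def interior_thick_annulus)
  ultimately show "ball_chart (\<lambda>p. hmap a b (h p))"
    by (simp add: ball_chart_def)
qed

text \<open>\<open>M\<close> is the other layer of a stack. It misses the whole image of the thick
  annulus, hence also the transported ball, in which only the pushed link is visible.\<close>

lemma push_hmap_Un_not_in_chart: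
  assumes h: "ball_chart h" and a: "0 < a" and M: "fst ` M \<inter> hmap a b ` thick_annulus = {}"
  shows "outside (\<lambda>p. hmap a b (h p)) (push (hmap a b) L \<union> M) = push (hmap a b) (outside h L) \<union> M" (is ?A)
    and "fst ` (push (hmap a b) L \<union> M) \<inter> (\<lambda>p. hmap a b (h p)) ` cylinder = hmap a b ` (fst ` L \<inter> h ` cylinder)" (is ?B)
proof -
  have i: "inj (hmap a b)" using a by (intro inj_hmap) auto
  have img: "(\<lambda>p. hmap a b (h p)) ` cylinder = hmap a b ` h ` cylinder" by (simp add: image_image)
  have "h ` cylinder \<subseteq> thick_annulus"
    using h interior_subset by (fastforce simp: ball_chart_def)
  then have M': "fst ` M \<inter> hmap a b ` h ` cylinder = {}" using M by blast
  have *: "p \<notin> hmap a b ` h ` cylinder" if "(p, v) \<in> M" for p v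
    using M' that by (metis disjoint_iff fst_conv image_eqI)
  show ?A
    unfolding outside_def img
    using * i by (auto simp: push_hmap inj_image_mem_iff[OF i] inj_eq)
  show ?B
    unfolding img image_Un fst_push Int_Un_distrib2 M' image_Int[OF i] by simp
qed

lemma looks_like_layer:
  assumes h: "ball_chart h" and a: "0 < a" "a + \<bar>b\<bar> \<le> 1" and M: "fst ` M \<inter> hmap a b ` thick_annulus = {}"
    and l: "looks_like h L T"
  shows "looks_like (\<lambda>p. hmap a b (h p)) (push (hmap a b) L \<union> M) T"
  unfolding looks_like_def push_hmap_Un_not_in_chart[OF h a(1) M]
proof (intro conjI ballI allI impI)
  from l have T: "T \<subseteq> cylinder" "fst ` L \<inter> h ` cylinder = h ` T"
    and fr: "\<And>p v. p \<in> T \<Longrightarrow> (h p, v) \<in> L \<Longrightarrow> \<exists>a>0. v = a *\<^sub>R frechet_derivative h (at p) vertical"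
    by (auto simp: looks_like_def)
  show "T \<subseteq> cylinder" by fact
  show "hmap a b ` (fst ` L \<inter> h ` cylinder) = (\<lambda>p. hmap a b (h p)) ` T"
    by (simp add: T(2) image_image)
  fix p v assume p: "p \<in> T" and v: "(hmap a b (h p), v) \<in> push (hmap a b) L \<union> M"
  have "h p \<in> thick_annulus" using h T p interior_subset by (fastforce simp: ball_chart_def)
  then have "(hmap a b (h p), v) \<notin> M" using M by (metis disjoint_iff fst_conv image_eqI)
  with v obtain q w where q: "(q, w) \<in> L" "hmap a b (h p) = hmap a b q" "v = hmap a 0 w" by (auto simp: push_hmap)
  then have "h p = q" using inj_hmap[of a b] a by (simp add: inj_eq)
  then obtain k where "k > 0" "w = k *\<^sub>R frechet_derivative h (at p) vertical" using fr p q by blast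
  then show "\<exists>k>0. v = k *\<^sub>R frechet_derivative (\<lambda>p. hmap a b (h p)) (at p) vertical"
    using ball_chart_hmap(2)[OF h a, of p] p T(1) q(3) by (auto simp: linear_cmul[OF linear_hmap] subset_iff)
qed

lemma skein_triple_layer:
  assumes t: "skein_triple Q L Lp Lm" and a: "0 < a" "a + \<bar>b\<bar> \<le> 1"
    and M: "fst ` M \<inter> hmap a b ` thick_annulus = {}"
    and links: "\<And>L. L \<in> links Q \<Longrightarrow> push (hmap a b) L \<union> M \<in> links P"
  shows "skein_triple P (push (hmap a b) L \<union> M) (push (hmap a b) Lp \<union> M) (push (hmap a b) Lm \<union> M)"
proof -
  from t obtain h where h: "ball_chart h" "outside h L = outside h Lp" "outside h L = outside h Lm"
      "\<exists>T. crossing T \<and> looks_like h L T"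
      "\<exists>T. smoothing north west south east T \<and> looks_like h Lp T"
      "\<exists>T. smoothing east north west south T \<and> looks_like h Lm T"
    unfolding skein_triple_def by blast
  let ?h = "\<lambda>p. hmap a b (h p)"
  have ll: "\<And>L T. looks_like h L T \<Longrightarrow> looks_like ?h (push (hmap a b) L \<union> M) T"
    by (rule looks_like_layer[OF h(1) a M])
  have "ball_chart ?h" by (rule ball_chart_hmap(1)[OF h(1) a])
  moreover have "outside ?h (push (hmap a b) L \<union> M) = outside ?h (push (hmap a b) Lp \<union> M)"
      "outside ?h (push (hmap a b) L \<union> M) = outside ?h (push (hmap a b) Lm \<union> M)"
    unfolding push_hmap_Un_not_in_chart(1)[OF h(1) a(1) M] using h(2,3) by simp_all
  ultimately show ?thesis
    unfolding skein_triple_def using t links h(4-6) ll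
    by (intro conjI exI[of _ ?h]) (auto simp: skein_triple_def)
qed

lemma adds_trivial_knot_layer:
  assumes t: "adds_trivial_knot Q L LU" and a: "0 < a" "a + \<bar>b\<bar> \<le> 1"
    and M: "fst ` M \<inter> hmap a b ` thick_annulus = {}"
    and links: "push (hmap a b) L \<union> M \<in> links P"
  shows "adds_trivial_knot P (push (hmap a b) L \<union> M) (push (hmap a b) LU \<union> M)"
proof -
  from t obtain h where h: "ball_chart h" "fst ` L \<inter> h ` cylinder = {}" "LU = L \<union> push h (flat_circle (1/2))"
    unfolding adds_trivial_knot_def by blast
  let ?h = "\<lambda>p. hmap a b (h p)"
  \<comment> \<open>The new knot lies where the derivative of \<open>?h\<close> is given by the
    chain rule, so that its framing is transported correctly.\<close>
  have "p \<in> cylinder" if "(p, v) \<in> flat_circle (1/2)" for p v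
    using that by (auto simp: flat_circle_def cylinder_def)
  then have "push ?h (flat_circle (1/2)) = push (hmap a b) (push h (flat_circle (1/2)))"
    unfolding push_hmap using ball_chart_hmap(2)[OF h(1) a]
    unfolding push_def image_image by (intro image_cong) (auto simp: case_prod_unfold)
  then have "push (hmap a b) LU \<union> M = (push (hmap a b) L \<union> M) \<union> push ?h (flat_circle (1/2))"
    by (auto simp: h(3) push_Un)
  moreover have "fst ` (push (hmap a b) L \<union> M) \<inter> ?h ` cylinder = {}"
    using push_hmap_Un_not_in_chart(2)[OF h(1) a(1) M] h(2) by simp
  ultimately show ?thesis
    unfolding adds_trivial_knot_def using links ball_chart_hmap(1)[OF h(1) a] by blast
qed

lemma fst_push_disjoint:
  assumes "K \<in> links P" "0 < a" "a + \<bar>b\<bar> \<le> 1" "0 < a'" "a' + \<bar>b'\<bar> \<le> 1" "a + a' < \<bar>b - b'\<bar>"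
  shows "fst ` push (hmap a' b') K \<inter> hmap a b ` thick_annulus = {}"
proof -
  have "fst ` K \<subseteq> thick_annulus"
    using assms(1) by (auto simp: links_def relative_framed_link_iff fst_framed_image[symmetric] framed_image_def point_trace_def)
  moreover have "hmap a' b' q \<noteq> hmap a b p" if "p \<in> thick_annulus" "q \<in> thick_annulus" for p q
  proof
    assume "hmap a' b' q = hmap a b p"
    then have "\<bar>hmap a b p $ 3 - b\<bar> \<le> a" "\<bar>hmap a b p $ 3 - b'\<bar> \<le> a'"
      using hmap_thick(2)[OF that(1) assms(2,3)] hmap_thick(2)[OF that(2) assms(4,5)] by metis+
    then show False using assms(6) by linarith
  qed
  ultimately show ?thesis unfolding fst_push by blast
qed

lemma skein_triple_stack_left:
  assumes "skein_triple {} L Lp Lm" "K \<in> links P" "\<forall>p\<in>P. p $ 3 = 0" "\<bar>c\<bar> = 3/4"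
  shows "skein_triple P (stack c L K) (stack c Lp K) (stack c Lm K)"
  unfolding stack_def using assms
  by (intro skein_triple_layer[OF assms(1)] fst_push_disjoint[OF assms(2)] stack_in_links[unfolded stack_def]) auto

lemma skein_triple_stack_right:
  assumes "skein_triple P K Kp Km" "L \<in> links {}" "\<forall>p\<in>P. p $ 3 = 0" "\<bar>c\<bar> = 3/4"
  shows "skein_triple P (stack c L K) (stack c L Kp) (stack c L Km)"
proof -
  have st: "stack c L K = push (hmap (1/4) 0) K \<union> push (hmap (1/4) c) L" for K
    by (auto simp: stack_def)
  have "stack c L K \<in> links P" if "K \<in> links P" for K
    using assms(2-4) that by (intro stack_in_links) auto
  then show ?thesis
    unfolding st using assms
    by (intro skein_triple_layer[OF assms(1)] fst_push_disjoint[OF assms(2)]) (auto simp: adds_trivial_knot_def)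
qed

lemma adds_trivial_knot_stack_left:
  assumes "adds_trivial_knot {} L LU" "K \<in> links P" "\<forall>p\<in>P. p $ 3 = 0" "\<bar>c\<bar> = 3/4"
  shows "adds_trivial_knot P (stack c L K) (stack c LU K)"
  unfolding stack_def using assms
  by (intro adds_trivial_knot_layer[OF assms(1)] fst_push_disjoint[OF assms(2)] stack_in_links[unfolded stack_def])
     (auto simp: adds_trivial_knot_def)

lemma adds_trivial_knot_stack_right:
  assumes "adds_trivial_knot P K KU" "L \<in> links {}" "\<forall>p\<in>P. p $ 3 = 0" "\<bar>c\<bar> = 3/4"
  shows "adds_trivial_knot P (stack c L K) (stack c L KU)"
proof -
  have st: "stack c L K = push (hmap (1/4) 0) K \<union> push (hmap (1/4) c) L" for K
    by (auto simp: stack_def)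
  have "stack c L K \<in> links P" if "K \<in> links P" for K
    using assms(2-4) that by (intro stack_in_links) auto
  then show ?thesis
    unfolding st using assms
    by (intro adds_trivial_knot_layer[OF assms(1)] fst_push_disjoint[OF assms(2)]) (auto simp: adds_trivial_knot_def)
qed

section \<open>Skein modules and their products\<close>

lemma chains_iff: "x \<in> chains P \<longleftrightarrow> (\<forall>L. Poly_Mapping.lookup x L \<noteq> 0 \<longrightarrow> L \<in> links P)"
  by (auto simp: chains_def in_keys_iff)

lemma chains_gen [intro]: "L \<in> links P \<Longrightarrow> gen L \<in> chains P"
  by (auto simp: chains_iff lookup_single when_def)

lemma chains_add [intro]: "x \<in> chains P \<Longrightarrow> y \<in> chains P \<Longrightarrow> x + y \<in> chains P"
  by (auto simp: chains_iff lookup_add) (metis add.left_neutral)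

lemma chains_minus [intro]: "x \<in> chains P \<Longrightarrow> - x \<in> chains P"
  by (auto simp: chains_iff)

lemma chains_diff [intro]: "x \<in> chains P \<Longrightarrow> y \<in> chains P \<Longrightarrow> x - y \<in> chains P"
  using chains_add[of x P "- y"] by auto

lemma chains_scale [intro]: "x \<in> chains P \<Longrightarrow> chain_scale r x \<in> chains P"
  by (auto simp: chains_iff)

lemma chains_zero [intro]: "0 \<in> chains P"
  by (auto simp: chains_iff)

lemma chain_scale_single: "chain_scale r (Poly_Mapping.single L c) = Poly_Mapping.single L (r * c)"
  by (rule poly_mapping_eqI) (simp add: lookup_single when_def)

lemma chain_decompose: "x = (\<Sum>L\<in>Poly_Mapping.keys x. chain_scale (Poly_Mapping.lookup x L) (gen L))"
  by (rule poly_mapping_eqI)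
     (simp add: lookup_sum lookup_single when_def in_keys_iff sum.If_cases if_distrib cong: if_cong)

lemma chains_eq_span: "x \<in> chains P \<Longrightarrow> x \<in> chain.span (gen ` links P)"
  by (subst chain_decompose, intro chain.span_sum chain.span_scale chain.span_base) (auto simp: chains_def)

text \<open>Congruence of chains modulo the skein relations, without the side condition that the chains
  consist of links.\<close>

definition skein_cong :: "point set \<Rightarrow> chain \<Rightarrow> chain \<Rightarrow> bool" where
  "skein_cong P x y \<longleftrightarrow> x - y \<in> chain.span (relators P)"

lemma skein_cong_refl [intro!, simp]: "skein_cong P x x"
  by (simp add: skein_cong_def chain.span_zero)

lemma skein_cong_sym: "skein_cong P x y \<Longrightarrow> skein_cong P y x"
  unfolding skein_cong_def by (metis chain.span_neg minus_diff_eq)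

lemma skein_cong_trans [trans]: "skein_cong P x y \<Longrightarrow> skein_cong P y z \<Longrightarrow> skein_cong P x z"
  unfolding skein_cong_def using chain.span_add[of "x - y" _ "y - z"] by simp

lemma skein_cong_add: "skein_cong P x y \<Longrightarrow> skein_cong P x' y' \<Longrightarrow> skein_cong P (x + x') (y + y')"
  unfolding skein_cong_def using chain.span_add[of "x - y" _ "x' - y'"] by (simp add: algebra_simps)

lemma skein_cong_diff: "skein_cong P x y \<Longrightarrow> skein_cong P x' y' \<Longrightarrow> skein_cong P (x - x') (y - y')"
  unfolding skein_cong_def using chain.span_diff[of "x - y" _ "x' - y'"] by (simp add: algebra_simps)

lemma skein_cong_minus: "skein_cong P x y \<Longrightarrow> skein_cong P (- x) (- y)"
  using skein_cong_diff[of P 0 0 x y] by simp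

lemma skein_cong_scale: "skein_cong P x y \<Longrightarrow> skein_cong P (chain_scale r x) (chain_scale r y)"
  unfolding skein_cong_def by (metis chain.span_scale chain.scale_right_diff_distrib)

lemma skein_cong_isotopic: "isotopic P L L' \<Longrightarrow> skein_cong P (gen L) (gen L')"
  unfolding skein_cong_def by (rule chain.span_base) (auto simp: relators_def)

lemma skein_cong_triple:
  "skein_triple P L Lp Lm \<Longrightarrow>
   skein_cong P (gen L) (chain_scale (t_pow 1) (gen Lp) + chain_scale (t_pow (-1)) (gen Lm))"
  unfolding skein_cong_def by (rule chain.span_base) (unfold relators_def, blast)

lemma skein_cong_trivial_knot:
  "adds_trivial_knot P L LU \<Longrightarrow> skein_cong P (gen LU) (chain_scale (- (t_pow 2 + t_pow (-2))) (gen L))"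
  unfolding skein_cong_def by (rule chain.span_base) (unfold relators_def, blast)

lemma skein_eq_iff: "(x, y) \<in> skein_eq P \<longleftrightarrow> x \<in> chains P \<and> y \<in> chains P \<and> skein_cong P x y"
  by (simp add: skein_eq_def skein_cong_def)

lemma equiv_skein_eq: "equiv (chains P) (skein_eq P)"
proof (rule equivI)
  show "skein_eq P \<subseteq> chains P \<times> chains P" by (auto simp: skein_eq_iff)
  show "refl_on (chains P) (skein_eq P)" by (auto simp: refl_on_def skein_eq_iff)
  show "sym (skein_eq P)" by (auto simp: sym_def skein_eq_iff intro: skein_cong_sym)
  show "trans (skein_eq P)" unfolding trans_def skein_eq_iff using skein_cong_trans by blast
qed

lemma cls_eqI: "x \<in> chains P \<Longrightarrow> y \<in> chains P \<Longrightarrow> skein_cong P x y \<Longrightarrow> cls P x = cls P y"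
  unfolding cls_def by (rule equiv_class_eq[OF equiv_skein_eq]) (simp add: skein_eq_iff)

lemma cls_in_skein: "x \<in> chains P \<Longrightarrow> cls P x \<in> skein P"
  unfolding cls_def skein_def by (rule quotientI)

lemma mem_cls_iff: "y \<in> cls P x \<longleftrightarrow> x \<in> chains P \<and> y \<in> chains P \<and> skein_cong P x y"
  by (auto simp: cls_def skein_eq_iff)

text \<open>All representatives contribute the same class, and \<open>x\<close> itself is one of
  them, so the union collapses.\<close>

lemma UN_cls:
  assumes x: "x \<in> chains P"
    and f: "\<And>x. x \<in> chains P \<Longrightarrow> f x \<in> chains Q"
    and c: "\<And>x y. x \<in> chains P \<Longrightarrow> y \<in> chains P \<Longrightarrow> skein_cong P x y \<Longrightarrow> skein_cong Q (f x) (f y)"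
  shows "(\<Union>x\<in>cls P x. cls Q (f x)) = cls Q (f x)"
proof -
  have "cls Q (f y) = cls Q (f x)" if "y \<in> cls P x" for y
    using that f c by (intro cls_eqI) (auto simp: mem_cls_iff intro: skein_cong_sym)
  moreover have "x \<in> cls P x" using x by (simp add: mem_cls_iff)
  ultimately show ?thesis by blast
qed

lemma UN_UN_cls:
  assumes x: "x \<in> chains P" and y: "y \<in> chains Q"
    and f: "\<And>x y. x \<in> chains P \<Longrightarrow> y \<in> chains Q \<Longrightarrow> f x y \<in> chains R"
    and c: "\<And>x y x' y'. x \<in> chains P \<Longrightarrow> y \<in> chains Q \<Longrightarrow> x' \<in> chains P \<Longrightarrow> y' \<in> chains Q \<Longrightarrow>
       skein_cong P x x' \<Longrightarrow> skein_cong Q y y' \<Longrightarrow> skein_cong R (f x y) (f x' y')"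
  shows "(\<Union>x\<in>cls P x. \<Union>y\<in>cls Q y. cls R (f x y)) = cls R (f x y)"
proof -
  have "(\<Union>y\<in>cls Q y. cls R (f x' y)) = cls R (f x' y)" if "x' \<in> chains P" for x'
    using that f c by (intro UN_cls[OF y]) auto
  then have "(\<Union>x\<in>cls P x. \<Union>y\<in>cls Q y. cls R (f x y)) = (\<Union>x\<in>cls P x. cls R (f x y))"
    by (auto simp: mem_cls_iff)
  also have "\<dots> = cls R (f x y)"
    using y f c by (intro UN_cls[OF x]) auto
  finally show ?thesis .
qed

lemma skein_minus_cls: "x \<in> chains P \<Longrightarrow> y \<in> chains P \<Longrightarrow> skein_minus P (cls P x) (cls P y) = cls P (x - y)"
  unfolding skein_minus_def by (rule UN_UN_cls) (auto intro: skein_cong_diff)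

lemma skein_uminus_cls: "x \<in> chains P \<Longrightarrow> skein_uminus P (cls P x) = cls P (- x)"
  unfolding skein_uminus_def by (rule UN_cls) (auto intro: skein_cong_minus)

lemma skein_scale_cls: "x \<in> chains P \<Longrightarrow> skein_scale P r (cls P x) = cls P (chain_scale r x)"
  unfolding skein_scale_def by (rule UN_cls) (auto intro: skein_cong_scale)


section \<open>Bilinear extension of stacking\<close>

text \<open>The defining sums run over exact supports, which change under addition. Over common
  finite supersets the extra terms vanish and bilinearity can be read off term by term.\<close>

lemma bilinear_ext_superset:
  assumes "finite A" "finite B" "Poly_Mapping.keys x \<subseteq> A" "Poly_Mapping.keys y \<subseteq> B"
  shows "bilinear_ext op x y = (\<Sum>L\<in>A. \<Sum>K\<in>B.
     Poly_Mapping.single (op L K) (Poly_Mapping.lookup x L * Poly_Mapping.lookup y K))"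
proof -
  have "(\<Sum>L\<in>A. \<Sum>K\<in>B. Poly_Mapping.single (op L K) (Poly_Mapping.lookup x L * Poly_Mapping.lookup y K))
      = (\<Sum>L\<in>A. \<Sum>K\<in>Poly_Mapping.keys y. Poly_Mapping.single (op L K) (Poly_Mapping.lookup x L * Poly_Mapping.lookup y K))"
    using assms by (intro sum.cong sum.mono_neutral_right refl) (auto simp: in_keys_iff)
  also have "\<dots> = bilinear_ext op x y"
    unfolding bilinear_ext_def
    using assms by (intro sum.mono_neutral_right) (auto simp: in_keys_iff)
  finally show ?thesis by simp
qed

lemma bilinear_ext_diff_left: "bilinear_ext op (x - x') y = bilinear_ext op x y - bilinear_ext op x' y"
proof -
  let ?A = "Poly_Mapping.keys x \<union> Poly_Mapping.keys x'" and ?B = "Poly_Mapping.keys y"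
  have "Poly_Mapping.keys (x - x') \<subseteq> ?A" by (auto simp: in_keys_iff lookup_minus)
  then show ?thesis
    by (simp add: bilinear_ext_superset[of ?A ?B] lookup_minus left_diff_distrib single_diff sum_subtractf)
qed

lemma bilinear_ext_diff_right: "bilinear_ext op x (y - y') = bilinear_ext op x y - bilinear_ext op x y'"
proof -
  let ?A = "Poly_Mapping.keys x" and ?B = "Poly_Mapping.keys y \<union> Poly_Mapping.keys y'"
  have "Poly_Mapping.keys (y - y') \<subseteq> ?B" by (auto simp: in_keys_iff lookup_minus)
  then show ?thesis
    by (simp add: bilinear_ext_superset[of ?A ?B] lookup_minus right_diff_distrib single_diff sum_subtractf)
qed

lemma bilinear_ext_zero [simp]: "bilinear_ext op 0 y = 0" "bilinear_ext op x 0 = 0"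
  by (simp_all add: bilinear_ext_def)

lemma bilinear_ext_add_left: "bilinear_ext op (x + x') y = bilinear_ext op x y + bilinear_ext op x' y"
  using bilinear_ext_diff_left[of op x "- x'" y] bilinear_ext_diff_left[of op 0 x' y] by simp

lemma bilinear_ext_add_right: "bilinear_ext op x (y + y') = bilinear_ext op x y + bilinear_ext op x y'"
  using bilinear_ext_diff_right[of op x y "- y'"] bilinear_ext_diff_right[of op x 0 y'] by simp

lemma bilinear_ext_scale_left: "bilinear_ext op (chain_scale r x) y = chain_scale r (bilinear_ext op x y)"
proof -
  have "Poly_Mapping.keys (chain_scale r x) \<subseteq> Poly_Mapping.keys x" by (auto simp: in_keys_iff)
  then show ?thesis
    by (simp add: bilinear_ext_superset[of "Poly_Mapping.keys x" "Poly_Mapping.keys y"]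
         chain.scale_sum_right chain_scale_single mult.assoc)
qed

lemma bilinear_ext_scale_right: "bilinear_ext op x (chain_scale r y) = chain_scale r (bilinear_ext op x y)"
proof -
  have "Poly_Mapping.keys (chain_scale r y) \<subseteq> Poly_Mapping.keys y" by (auto simp: in_keys_iff)
  then show ?thesis
    by (simp add: bilinear_ext_superset[of "Poly_Mapping.keys x" "Poly_Mapping.keys y"]
         chain.scale_sum_right chain_scale_single mult.left_commute)
qed

lemma bilinear_ext_gen [simp]: "bilinear_ext op (gen L) (gen K) = gen (op L K)"
  by (simp add: bilinear_ext_def)

lemmas bilinear_ext_linear =
  bilinear_ext_diff_left bilinear_ext_diff_right bilinear_ext_add_left bilinear_ext_add_right
  bilinear_ext_scale_left bilinear_ext_scale_right bilinear_ext_gen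

section \<open>Products are well defined on classes\<close>

lemma chains_induct [consumes 1, case_names gen zero add scale]:
  assumes "x \<in> chains P" "\<And>L. L \<in> links P \<Longrightarrow> Q (gen L)" "Q 0"
    "\<And>x y. Q x \<Longrightarrow> Q y \<Longrightarrow> Q (x + y)" "\<And>r x. Q x \<Longrightarrow> Q (chain_scale r x)"
  shows "Q x"
  using chains_eq_span[OF assms(1)]
proof (induction rule: chain.span_induct)
  case base
  show ?case using assms(3-5) by (auto simp: chain.subspace_def)
next
  case (step x)
  then show ?case using assms(2) by auto
qed

text \<open>By linearity only the three families of relators have to be checked. Applied to stacking
  with one argument fixed, in either variable, this makes the products independent of
  representatives.\<close>

lemma span_relators_image:
  assumes z: "z \<in> chain.span (relators Q)"
    and lin: "\<And>x y. f (x + y) = f x + f y" "\<And>r x. f (chain_scale r x) = chain_scale r (f x)"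
    and gen: "\<And>L. f (gen L) = gen (op L)"
    and op: "\<And>L L'. isotopic Q L L' \<Longrightarrow> isotopic P (op L) (op L')"
      "\<And>L Lp Lm. skein_triple Q L Lp Lm \<Longrightarrow> skein_triple P (op L) (op Lp) (op Lm)"
      "\<And>L LU. adds_trivial_knot Q L LU \<Longrightarrow> adds_trivial_knot P (op L) (op LU)"
  shows "f z \<in> chain.span (relators P)"
  using z
proof (induction rule: chain.span_induct)
  case base
  have "f 0 = 0" using lin(2)[of 0 0] by simp
  then show ?case by (auto simp: chain.subspace_def lin chain.span_zero chain.span_add chain.span_scale)
next
  case (step z)
  have diff: "f (x - y) = f x - f y" for x y using lin(1)[of "x - y" y] by simp
  from step consider L L' where "z = gen L - gen L'" "isotopic Q L L'"
    | L Lp Lm where "z = gen L - (chain_scale (t_pow 1) (gen Lp) + chain_scale (t_pow (-1)) (gen Lm))"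
        "skein_triple Q L Lp Lm"
    | L LU where "z = gen LU - chain_scale (- (t_pow 2 + t_pow (-2))) (gen L)" "adds_trivial_knot Q L LU"
    unfolding relators_def by blast
  then show ?case
  proof cases
    case 1
    show ?thesis using skein_cong_isotopic[OF op(1)[OF 1(2)]]
      by (simp only: 1 diff lin gen skein_cong_def)
  next
    case 2
    show ?thesis using skein_cong_triple[OF op(2)[OF 2(2)]]
      by (simp only: 2 diff lin gen skein_cong_def)
  next
    case 3
    show ?thesis using skein_cong_trivial_knot[OF op(3)[OF 3(2)]]
      by (simp only: 3 diff lin gen skein_cong_def)
  qed
qed

context
  fixes P :: "point set" and c :: real
  assumes P: "\<forall>p\<in>P. p $ 3 = 0" and c: "\<bar>c\<bar> = 3/4"
begin

lemma bilinear_ext_stack_chains: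
  assumes "x \<in> chains {}" "y \<in> chains P"
  shows "bilinear_ext (stack c) x y \<in> chains P"
  using assms(1)
proof (induction rule: chains_induct)
  case (gen L)
  show ?case using assms(2)
    by (induction rule: chains_induct) (use gen stack_in_links[OF _ _ P c] in \<open>auto simp: bilinear_ext_linear\<close>)
qed (auto simp: bilinear_ext_linear)

lemma bilinear_ext_relator_left:
  assumes "z \<in> chain.span (relators {})" "y \<in> chains P"
  shows "bilinear_ext (stack c) z y \<in> chain.span (relators P)"
  using assms(2)
proof (induction rule: chains_induct)
  case (gen K)
  show ?case
    by (rule span_relators_image[OF assms(1) _ _ _ isotopic_stack[OF _ isotopic_refl[OF gen] P c]
          skein_triple_stack_left[OF _ gen P c] adds_trivial_knot_stack_left[OF _ gen P c]])
       (simp_all add: bilinear_ext_linear)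
qed (auto simp: bilinear_ext_linear chain.span_zero chain.span_add chain.span_scale)

lemma bilinear_ext_relator_right:
  assumes "z \<in> chain.span (relators P)" "x \<in> chains {}"
  shows "bilinear_ext (stack c) x z \<in> chain.span (relators P)"
  using assms(2)
proof (induction rule: chains_induct)
  case (gen K)
  show ?case
    by (rule span_relators_image[OF assms(1) _ _ _ isotopic_stack[OF isotopic_refl[OF gen] _ P c]
          skein_triple_stack_right[OF _ gen P c] adds_trivial_knot_stack_right[OF _ gen P c]])
       (simp_all add: bilinear_ext_linear)
qed (auto simp: bilinear_ext_linear chain.span_zero chain.span_add chain.span_scale)

lemma skein_cong_bilinear_ext_right:
  "skein_cong P y y' \<Longrightarrow> x \<in> chains {} \<Longrightarrow> skein_cong P (bilinear_ext (stack c) x y) (bilinear_ext (stack c) x y')"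
  unfolding skein_cong_def bilinear_ext_diff_right[symmetric] by (rule bilinear_ext_relator_right)

lemma skein_cong_bilinear_ext_left:
  "skein_cong {} x x' \<Longrightarrow> y \<in> chains P \<Longrightarrow> skein_cong P (bilinear_ext (stack c) x y) (bilinear_ext (stack c) x' y)"
  unfolding skein_cong_def bilinear_ext_diff_left[symmetric] by (rule bilinear_ext_relator_left)

text \<open>Representatives are exchanged one at a time: the first with the second fixed, then the
  second.\<close>

lemma act_cls:
  assumes "x \<in> chains {}" "y \<in> chains P"
  shows "(\<Union>x\<in>cls {} x. \<Union>y\<in>cls P y. cls P (bilinear_ext (stack c) x y)) = cls P (bilinear_ext (stack c) x y)"
  using assms
  by (rule UN_UN_cls)
     (auto intro: bilinear_ext_stack_chains skein_cong_trans[OF skein_cong_bilinear_ext_left skein_cong_bilinear_ext_right])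

end

lemma act_over_cls:
  "\<forall>p\<in>P. p $ 3 = 0 \<Longrightarrow> x \<in> chains {} \<Longrightarrow> y \<in> chains P \<Longrightarrow>
   act_over P (cls {} x) (cls P y) = cls P (bilinear_ext (stack (3/4)) x y)"
  unfolding act_over_def stack_over_eq by (rule act_cls) auto

lemma act_under_cls:
  "\<forall>p\<in>P. p $ 3 = 0 \<Longrightarrow> x \<in> chains {} \<Longrightarrow> y \<in> chains P \<Longrightarrow>
   act_under P (cls {} x) (cls P y) = cls P (bilinear_ext (stack (-3/4)) x y)"
  unfolding act_under_def stack_under_eq by (rule act_cls) auto

section \<open>Chebyshev polynomials acting on spirals\<close>

text \<open>Runs the recursion on chains rather than on classes, so that no unions over
  representatives appear; \<open>chebyshev_T_cls\<close> identifies its class.\<close>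

fun chebyshev_chain :: "framed_set \<Rightarrow> nat \<Rightarrow> chain" where
  "chebyshev_chain Z 0 = chain_scale 2 (gen {})"
| "chebyshev_chain Z (Suc 0) = gen Z"
| "chebyshev_chain Z (Suc (Suc n)) =
     bilinear_ext (stack (3/4)) (gen Z) (chebyshev_chain Z (Suc n)) - chebyshev_chain Z n"

lemma empty_in_links: "{} \<in> links {}"
proof -
  have "relative_framed_link {} []" by (simp add: relative_framed_link_def)
  moreover have "framed_image [] = {}" by (simp add: framed_image_def)
  ultimately show ?thesis unfolding links_def by (smt (verit) mem_Collect_eq)
qed

lemma chebyshev_chain_in_chains: "Z \<in> links {} \<Longrightarrow> chebyshev_chain Z n \<in> chains {}"
  by (induction Z n rule: chebyshev_chain.induct)
     (auto intro!: empty_in_links chains_diff bilinear_ext_stack_chains)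

lemma chebyshev_T_cls:
  "Z \<in> links {} \<Longrightarrow> chebyshev_T n (cls {} (gen Z)) = cls {} (chebyshev_chain Z n)"
proof (induction Z n rule: chebyshev_chain.induct)
  case (1 Z)
  then show ?case by (simp add: skein_scale_cls chains_gen empty_in_links)
next
  case (2 Z)
  then show ?case by simp
next
  case (3 Z n)
  have "skein_mult (cls {} (gen Z)) (cls {} (chebyshev_chain Z (Suc n)))
      = cls {} (bilinear_ext (stack (3/4)) (gen Z) (chebyshev_chain Z (Suc n)))"
    using 3 by (intro act_over_cls) (auto intro: chebyshev_chain_in_chains)
  then show ?case
    using 3 by (simp add: skein_minus_cls chebyshev_chain_in_chains bilinear_ext_stack_chains chains_gen)
qed

lemma bilinear_ext_over_assoc:
  assumes "Z \<in> links {}" "x \<in> chains {}" "K \<in> links P" "\<forall>p\<in>P. p $ 3 = 0"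
  shows "skein_cong P (bilinear_ext (stack (3/4)) (bilinear_ext (stack (3/4)) (gen Z) x) (gen K))
     (bilinear_ext (stack (3/4)) (gen Z) (bilinear_ext (stack (3/4)) x (gen K)))"
  using assms(2)
  by (induction rule: chains_induct)
     (use assms in \<open>auto simp: bilinear_ext_linear intro: skein_cong_isotopic isotopic_stack_over_assoc skein_cong_add skein_cong_scale\<close>)

text \<open>Here \<open>Z\<close> lies above \<open>x\<close> and both lie below \<open>K\<close>;
  so \<open>Z\<close> is adjacent to \<open>K\<close> and is absorbed first. On generators this is
  \<open>isotopic_stack_under_assoc\<close>.\<close>

lemma bilinear_ext_under_assoc:
  assumes "Z \<in> links {}" "x \<in> chains {}" "K \<in> links P" "\<forall>p\<in>P. p $ 3 = 0"
  shows "skein_cong P (bilinear_ext (stack (-3/4)) (bilinear_ext (stack (3/4)) (gen Z) x) (gen K))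
     (bilinear_ext (stack (-3/4)) x (gen (stack (-3/4) Z K)))"
  using assms(2)
  by (induction rule: chains_induct)
     (use assms isotopic_stack_under_assoc in \<open>auto simp: bilinear_ext_linear intro: skein_cong_isotopic skein_cong_add skein_cong_scale\<close>)

section \<open>Divisibility of Laurent polynomials\<close>

lemma t_pow_mult: "t_pow a * t_pow b = t_pow (a + b)"
  by (simp add: Poly_Mapping.mult_single)

lemma const_power: "const a ^ n = const (a ^ n)"
  by (induction n) (simp_all add: Poly_Mapping.mult_single)

lemma t_pow_power: "t_pow 1 ^ n = t_pow (int n)"
  by (induction n) (simp_all add: Poly_Mapping.mult_single add.commute)

text \<open>Up to the factor t^-N the sum is t^(2N) + 1 = t^(2N) - \<xi>^(2N), a difference of equal
  powers.\<close>

lemma t_pow_sum_dvd: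
  assumes "\<xi> ^ (2 * N) = -1"
  shows "(t_pow 1 - const \<xi>) dvd (t_pow (int N) + t_pow (- int N))"
proof -
  have "const \<xi> ^ (2 * N) = - 1"
    using assms by (simp add: const_power single_uminus)
  then have "(t_pow 1 - const \<xi>) dvd (t_pow (int (2 * N)) + 1)"
    using power_diff_sumr2[of "t_pow 1" "2 * N" "const \<xi>"] by (simp add: t_pow_power)
  then have "(t_pow 1 - const \<xi>) dvd t_pow (- int N) * (t_pow (int (2 * N)) + 1)"
    by (rule dvd_mult)
  also have "t_pow (- int N) * (t_pow (int (2 * N)) + 1) = t_pow (int N) + t_pow (- int N)"
    by (simp add: distrib_left t_pow_mult)
  finally show ?thesis .
qed

text \<open>The recursion of the Chebyshev polynomials is that of \<open>x ^ n + x ^ -n\<close> where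
  \<open>x + x ^ -1\<close> is multiplication by \<open>Z\<close>: it shifts \<open>U\<close> by one in both directions.\<close>

locale spiral_module =
  fixes P :: "point set" and Z :: framed_set and U :: "int \<Rightarrow> framed_set"
  assumes P: "\<forall>p\<in>P. p $ 3 = 0" and Z: "Z \<in> links {}" and U: "U k \<in> links P"
    and empty: "\<bar>c\<bar> = 3/4 \<Longrightarrow> skein_cong P (gen (stack c {} (U k))) (gen (U k))"
    and over: "skein_cong P (gen (stack (3/4) Z (U k)))
       (chain_scale (t_pow 1) (gen (U (k + 1))) + chain_scale (t_pow (-1)) (gen (U (k - 1))))"
    and under: "skein_cong P (gen (stack (-3/4) Z (U k)))
       (chain_scale (t_pow 1) (gen (U (k - 1))) + chain_scale (t_pow (-1)) (gen (U (k + 1))))"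
begin

text \<open>The expected value of T_n(z) on \<open>U k\<close> from above, namely x^n + x^-n for x =
  t u; \<open>untwist\<close> below is the one from below, for x = t^-1 u.\<close>

definition twist :: "int \<Rightarrow> int \<Rightarrow> chain" where
  "twist n k = chain_scale (t_pow n) (gen (U (k + n))) + chain_scale (t_pow (-n)) (gen (U (k - n)))"

definition untwist :: "int \<Rightarrow> int \<Rightarrow> chain" where
  "untwist n k = chain_scale (t_pow n) (gen (U (k - n))) + chain_scale (t_pow (-n)) (gen (U (k + n)))"

lemma twist_in_chains: "twist n k \<in> chains P" "untwist n k \<in> chains P"
  unfolding twist_def untwist_def by (intro chains_add chains_scale chains_gen U)+

lemma twist_0: "twist 0 k = chain_scale 2 (gen (U k))" "untwist 0 k = chain_scale 2 (gen (U k))"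
proof -
  have "chain_scale 2 x = chain_scale 1 x + chain_scale 1 x" for x
    unfolding chain.scale_left_distrib[symmetric] by simp
  then show "twist 0 k = chain_scale 2 (gen (U k))" "untwist 0 k = chain_scale 2 (gen (U k))"
    unfolding twist_def untwist_def by (simp_all only: minus_zero add_0_right diff_zero single_one)
qed

text \<open>Stacking above is a left action: the additional factor \<open>Z\<close> is applied last,
  to the two spirals in \<open>twist\<close>. The induction can therefore keep \<open>k\<close>
  fixed.\<close>

lemma chebyshev_over: "skein_cong P (bilinear_ext (stack (3/4)) (chebyshev_chain Z n) (gen (U k))) (twist n k)"
proof (induction n rule: induct_nat_012)
  case 0
  then show ?case using empty[of "3/4" k] by (simp add: bilinear_ext_linear twist_0 skein_cong_scale)
next
  case 1
  then show ?case using over by (simp add: bilinear_ext_linear twist_def)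
next
  case (ge2 n)
  let ?act = "bilinear_ext (stack (3/4))" and ?T = "chebyshev_chain Z (Suc n)"
  let ?zT = "bilinear_ext (stack (3/4)) (gen Z) ?T"
  let ?m = "int n + 1"
  have Tn: "?T \<in> chains {}" by (rule chebyshev_chain_in_chains[OF Z])
  have "skein_cong P (?act ?zT (gen (U k)))
      (?act (gen Z) (?act ?T (gen (U k))))"
    by (rule bilinear_ext_over_assoc[OF Z Tn U P])
  also have "skein_cong P \<dots> (?act (gen Z) (twist ?m k))"
    using ge2(2) P Z by (intro skein_cong_bilinear_ext_right) (auto simp: add.commute)
  also have "?act (gen Z) (twist ?m k) =
      chain_scale (t_pow ?m) (gen (stack (3/4) Z (U (k + ?m)))) + chain_scale (t_pow (- ?m)) (gen (stack (3/4) Z (U (k - ?m))))"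
    by (simp add: twist_def bilinear_ext_linear)
  also have "skein_cong P \<dots> (chain_scale (t_pow ?m) (twist 1 (k + ?m)) + chain_scale (t_pow (- ?m)) (twist 1 (k - ?m)))"
    unfolding twist_def by (intro skein_cong_add skein_cong_scale over)
  \<comment> \<open>This is (x^m + x^-m)(x + x^-1) = (x^(m+1) + x^-(m+1)) + (x^(m-1) + x^-(m-1))
    with m - 1 = n.\<close>
  also have "\<dots> = twist (?m + 1) k + twist (int n) k"
  proof -
    have e: "- 2 - int n = - int n - 2" by simp
    show ?thesis
      by (simp add: twist_def chain.scale_right_distrib t_pow_mult algebra_simps) (simp only: e)
  qed
  finally have "skein_cong P (?act ?zT (gen (U k)))
      (twist (?m + 1) k + twist (int n) k)" .
  moreover have "twist (?m + 1) k + twist (int n) k - twist (int n) k = twist (int (Suc (Suc n))) k"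
    by (simp add: add.commute)
  ultimately show ?case
    using skein_cong_diff[OF _ ge2(1)] by (metis chebyshev_chain.simps(3) bilinear_ext_diff_left)
qed

text \<open>Stacking below is a right action: \<open>Z\<close> is applied first and moves
  \<open>U k\<close> to both neighbours before the rest acts. The induction hypothesis is needed at
  k - 1 and k + 1, so \<open>k\<close> is generalised.\<close>

lemma chebyshev_under: "skein_cong P (bilinear_ext (stack (-3/4)) (chebyshev_chain Z n) (gen (U k))) (untwist n k)"
proof (induction n arbitrary: k rule: induct_nat_012)
  case 0
  then show ?case using empty[of "-3/4"] by (simp add: bilinear_ext_linear twist_0 skein_cong_scale)
next
  case 1
  then show ?case using under by (simp add: bilinear_ext_linear untwist_def)
next
  case (ge2 n)
  let ?act = "bilinear_ext (stack (-3/4))" and ?T = "chebyshev_chain Z (Suc n)"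
  let ?zT = "bilinear_ext (stack (3/4)) (gen Z) ?T"
  let ?m = "int n + 1"
  have IH: "skein_cong P (?act ?T (gen (U k))) (untwist ?m k)" for k
    using ge2(2) by (simp add: add.commute)
  have Tn: "?T \<in> chains {}" by (rule chebyshev_chain_in_chains[OF Z])
  have "skein_cong P (?act ?zT (gen (U k)))
      (?act ?T (gen (stack (-3/4) Z (U k))))"
    by (rule bilinear_ext_under_assoc[OF Z Tn U P])
  also have "skein_cong P \<dots> (?act ?T
      (chain_scale (t_pow 1) (gen (U (k - 1))) + chain_scale (t_pow (-1)) (gen (U (k + 1)))))"
    using P Tn under by (intro skein_cong_bilinear_ext_right) auto
  also have "\<dots> = chain_scale (t_pow 1) (?act ?T (gen (U (k - 1))))
      + chain_scale (t_pow (-1)) (?act ?T (gen (U (k + 1))))"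
    by (simp add: bilinear_ext_linear)
  also have "skein_cong P \<dots> (chain_scale (t_pow 1) (untwist ?m (k - 1)) + chain_scale (t_pow (-1)) (untwist ?m (k + 1)))"
    by (intro skein_cong_add skein_cong_scale IH)
  also have "\<dots> = untwist (?m + 1) k + untwist (int n) k"
  proof -
    have e: "- 2 - int n = - int n - 2" by simp
    show ?thesis
      by (simp add: untwist_def chain.scale_right_distrib t_pow_mult algebra_simps) (simp only: e)
  qed
  finally have "skein_cong P (?act ?zT (gen (U k)))
      (untwist (?m + 1) k + untwist (int n) k)" .
  moreover have "untwist (?m + 1) k + untwist (int n) k - untwist (int n) k = untwist (int (Suc (Suc n))) k"
    by (simp add: add.commute)
  ultimately show ?case
    using skein_cong_diff[OF _ ge2(1)[of k]] by (metis chebyshev_chain.simps(3) bilinear_ext_diff_left)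
qed

theorem chebyshev_skew_commute:
  assumes "\<xi> ^ (2 * N) = -1"
  shows "(act_over P (chebyshev_T N (cls {} (gen Z))) (cls P (gen (U 0))),
          skein_uminus P (act_under P (chebyshev_T N (cls {} (gen Z))) (cls P (gen (U 0))))) \<in> skein_at_eq \<xi> P"
proof -
  have T: "chebyshev_chain Z N \<in> chains {}" by (rule chebyshev_chain_in_chains[OF Z])
  have U0: "gen (U 0) \<in> chains P" using U by auto
  have over: "act_over P (chebyshev_T N (cls {} (gen Z))) (cls P (gen (U 0))) = cls P (twist (int N) 0)"
    unfolding chebyshev_T_cls[OF Z] act_over_cls[OF P T U0]
    by (intro cls_eqI bilinear_ext_stack_chains P T U0 twist_in_chains chebyshev_over) auto
  have under: "act_under P (chebyshev_T N (cls {} (gen Z))) (cls P (gen (U 0))) = cls P (untwist (int N) 0)"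
    unfolding chebyshev_T_cls[OF Z] act_under_cls[OF P T U0]
    by (intro cls_eqI bilinear_ext_stack_chains P T U0 twist_in_chains chebyshev_under) auto
  obtain q where q: "t_pow (int N) + t_pow (- int N) = (t_pow 1 - const \<xi>) * q"
    using t_pow_sum_dvd[OF assms] by (rule dvdE)
  define w where "w = chain_scale q (gen (U (int N)) + gen (U (- int N)))"
  have w: "w \<in> chains P" unfolding w_def using U by auto
  have "twist (int N) 0 - - untwist (int N) 0 = chain_scale (t_pow (int N) + t_pow (- int N)) (gen (U (int N)) + gen (U (- int N)))"
    by (simp add: twist_def untwist_def chain.scale_left_distrib chain.scale_right_distrib algebra_simps)
  also have "\<dots> = chain_scale (t_pow 1 - const \<xi>) w"
    unfolding q w_def by simp
  finally have eq: "twist (int N) 0 - - untwist (int N) 0 = chain_scale (t_pow 1 - const \<xi>) w" .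
  have "skein_minus P (cls P (twist (int N) 0)) (cls P (- untwist (int N) 0)) = skein_scale P (t_pow 1 - const \<xi>) (cls P w)"
    using eq w twist_in_chains by (simp add: skein_minus_cls skein_scale_cls chains_minus)
  then show ?thesis
    unfolding skein_at_eq_def over under skein_uminus_cls[OF twist_in_chains(2)]
    using cls_in_skein[OF twist_in_chains(1)] cls_in_skein[OF chains_minus[OF twist_in_chains(2)]] cls_in_skein[OF w]
    by blast
qed

end

section \<open>Arcs in cylindrical coordinates\<close>

text \<open>Cylindrical coordinates; angles are measured clockwise from the direction of the marked points.\<close>

definition pt :: "real \<Rightarrow> real \<Rightarrow> real \<Rightarrow> point" where
  "pt r \<theta> z = vector [r * sin \<theta>, r * cos \<theta>, z]"

lemma pt_nth [simp]: "pt r \<theta> z $ 1 = r * sin \<theta>" "pt r \<theta> z $ 2 = r * cos \<theta>" "pt r \<theta> z $ 3 = z"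
  by (simp_all add: pt_def)

lemma norm_proj_pt [simp]: "norm (proj (pt r \<theta> z)) = \<bar>r\<bar>"
proof -
  have "(r * sin \<theta>)\<^sup>2 + (r * cos \<theta>)\<^sup>2 = r\<^sup>2 * ((sin \<theta>)\<^sup>2 + (cos \<theta>)\<^sup>2)"
    by (simp only: power_mult_distrib distrib_left)
  then show ?thesis by (simp add: norm_proj)
qed

lemma pt_eq_iff:
  assumes "r > 0" "r' > 0"
  shows "pt r \<theta> z = pt r' \<theta>' z' \<longleftrightarrow> r = r' \<and> sin \<theta> = sin \<theta>' \<and> cos \<theta> = cos \<theta>' \<and> z = z'"
proof
  assume eq: "pt r \<theta> z = pt r' \<theta>' z'"
  then have "norm (proj (pt r \<theta> z)) = norm (proj (pt r' \<theta>' z'))" by simp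
  then have "r = r'" using assms by (simp only: norm_proj_pt)
  with eq assms show "r = r' \<and> sin \<theta> = sin \<theta>' \<and> cos \<theta> = cos \<theta>' \<and> z = z'"
    by (auto simp: point_eq_iff)
qed (simp add: pt_def)

lemma pt_cong: "sin \<theta> = sin \<theta>' \<Longrightarrow> cos \<theta> = cos \<theta>' \<Longrightarrow> pt r \<theta> z = pt r \<theta>' z"
  by (simp add: pt_def)

lemma pt_add_2pi [simp]: "pt r (\<theta> + 2 * pi * of_int n) z = pt r \<theta> z"
  by (rule pt_cong)
     (simp_all add: sin_add cos_add sin_int_2pin cos_int_2pin mult.assoc[symmetric])

lemma pt_in_thick: "0 \<le> r \<Longrightarrow> pt r \<theta> z \<in> thick_annulus \<longleftrightarrow> 1 \<le> r \<and> r \<le> 2 \<and> -1 \<le> z \<and> z \<le> 1"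
  by (auto simp: thick_annulus_iff)

lemma pt_in_open_thick: "0 \<le> r \<Longrightarrow> pt r \<theta> z \<in> open_thick \<longleftrightarrow> 1 < r \<and> r < 2 \<and> -1 < z \<and> z < 1"
  by (auto simp: open_thick_def)

section \<open>Framed arcs from cylindrical data\<close>

text \<open>The framing is always vertical, but its length \<open>\<phi>\<close> must be recorded,
  since stacking shortens framings.\<close>

definition polar_curve :: "(real \<Rightarrow> real) \<Rightarrow> (real \<Rightarrow> real) \<Rightarrow> (real \<Rightarrow> real) \<Rightarrow> (real \<Rightarrow> real) \<Rightarrow> real \<Rightarrow> point \<times> point" where
  "polar_curve r \<theta> z \<phi> u = (pt (r u) (\<theta> u) (z u), \<phi> u *\<^sub>R vertical)"

lemma polar_curve_simps [simp]:
  "fst (polar_curve r \<theta> z \<phi> u) = pt (r u) (\<theta> u) (z u)" "snd (polar_curve r \<theta> z \<phi> u) = \<phi> u *\<^sub>R vertical"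
  by (simp_all add: polar_curve_def)

lemma smooth_on_polar:
  assumes "smooth_on S r" "smooth_on S \<theta>" "smooth_on S z" "smooth_on S \<phi>"
  shows "smooth_on S (\<lambda>x. (pt (r x) (\<theta> x) (z x), \<phi> x *\<^sub>R vertical))"
  unfolding pt_def by (intro smooth_intros assms)

lemma has_vector_derivative_vector3:
  assumes "(f has_real_derivative f') (at u)" "(g has_real_derivative g') (at u)" "(h has_real_derivative h') (at u)"
  shows "((\<lambda>u. vector [f u, g u, h u] :: real^3) has_vector_derivative vector [f', g', h']) (at u)"
  unfolding vector3_eq_axis
  using assms by (intro has_vector_derivative_add has_vector_derivative_scaleR[where g' = 0, simplified] has_vector_derivative_const)

lemma tangent_polar_curve:
  assumes "(r has_real_derivative r') (at u)" "(\<theta> has_real_derivative \<theta>') (at u)" "(z has_real_derivative z') (at u)"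
  shows "tangent (polar_curve r \<theta> z \<phi>) u =
    vector [r' * sin (\<theta> u) + r u * (\<theta>' * cos (\<theta> u)), r' * cos (\<theta> u) - r u * (\<theta>' * sin (\<theta> u)), z']"
  unfolding tangent_def polar_curve_simps pt_def
  by (rule vector_derivative_at, rule has_vector_derivative_vector3)
     (use assms in \<open>auto intro!: derivative_eq_intros\<close>)

lemma cross3_vertical_eq_0: "c \<noteq> 0 \<Longrightarrow> cross3 t (c *\<^sub>R vertical) = 0 \<longleftrightarrow> t $ 1 = 0 \<and> t $ 2 = 0"
  by (auto simp: cross3_def point_eq_iff axis_def)

text \<open>The two expressions are the Cartesian velocity in the plane; rotating back by
  \<open>\<theta>\<close> recovers the radial velocity r' and the angular one r \<theta>'.\<close>

lemma polar_derivative_eq_0: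
  assumes "r' * sin \<theta> + r * (\<theta>' * cos \<theta>) = 0" "r' * cos \<theta> - r * (\<theta>' * sin \<theta>) = 0" "r \<noteq> 0"
  shows "r' = 0 \<and> \<theta>' = (0 :: real)"
proof -
  have "r' = r' * ((sin \<theta>)\<^sup>2 + (cos \<theta>)\<^sup>2)" by simp
  also have "\<dots> = (r' * sin \<theta> + r * (\<theta>' * cos \<theta>)) * sin \<theta> + (r' * cos \<theta> - r * (\<theta>' * sin \<theta>)) * cos \<theta>"
    by algebra
  finally have "r' = 0" using assms by simp
  have "r * \<theta>' = r * \<theta>' * ((sin \<theta>)\<^sup>2 + (cos \<theta>)\<^sup>2)" by simp
  also have "\<dots> = (r' * sin \<theta> + r * (\<theta>' * cos \<theta>)) * cos \<theta> - (r' * cos \<theta> - r * (\<theta>' * sin \<theta>)) * sin \<theta>"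
    by algebra
  also have "\<dots> = 0" by (simp only: assms mult_zero_left diff_self)
  finally show ?thesis using assms \<open>r' = 0\<close> by simp
qed

text \<open>Conditions sufficient for a relative framed link from the inner to the outer marked
  point. At the ends, vanishing derivatives of angle and height make the tangent radial; elsewhere a
  nonzero derivative of radius or angle keeps the tangent from being vertical, hence independent of
  the framing.\<close>

definition arc_data :: "(real \<Rightarrow> real) \<Rightarrow> (real \<Rightarrow> real) \<Rightarrow> (real \<Rightarrow> real) \<Rightarrow> (real \<Rightarrow> real) \<Rightarrow> bool" where
  "arc_data r \<theta> z \<phi> \<longleftrightarrow>
     smooth_on UNIV r \<and> smooth_on UNIV \<theta> \<and> smooth_on UNIV z \<and> smooth_on UNIV \<phi> \<and>
     r 0 = 1 \<and> r 1 = 2 \<and> (\<forall>u\<in>{0<..<1}. 1 < r u \<and> r u < 2) \<and>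
     (\<forall>u\<in>{0,1}. sin (\<theta> u) = 0 \<and> cos (\<theta> u) = 1 \<and> z u = 0 \<and> deriv \<theta> u = 0 \<and> deriv z u = 0) \<and>
     (\<forall>u\<in>{0..1}. \<bar>z u\<bar> < 1 \<and> 0 < \<phi> u \<and> (deriv r u \<noteq> 0 \<or> deriv \<theta> u \<noteq> 0)) \<and>
     inj_on (\<lambda>u. pt (r u) (\<theta> u) (z u)) {0..1}"

lemma framed_image_singleton: "framed_image [c] = framed_trace c"
  by (simp add: framed_image_def)

lemma arc_data_link:
  assumes "arc_data r \<theta> z \<phi>"
  shows "relative_framed_link io [(False, polar_curve r \<theta> z \<phi>)]"
proof -
  let ?\<gamma> = "polar_curve r \<theta> z \<phi>"
  note A = assms[unfolded arc_data_def]
  have sm: "smooth_on UNIV r" "smooth_on UNIV \<theta>" "smooth_on UNIV z" "smooth_on UNIV \<phi>"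
    and r01: "r 0 = 1" "r 1 = 2" and r: "\<And>u. u \<in> {0<..<1} \<Longrightarrow> 1 < r u \<and> r u < 2"
    and ends: "\<And>u. u \<in> {0,1} \<Longrightarrow> sin (\<theta> u) = 0 \<and> cos (\<theta> u) = 1 \<and> z u = 0 \<and> deriv \<theta> u = 0 \<and> deriv z u = 0"
    and z: "\<And>u. u \<in> {0..1} \<Longrightarrow> \<bar>z u\<bar> < 1 \<and> 0 < \<phi> u \<and> (deriv r u \<noteq> 0 \<or> deriv \<theta> u \<noteq> 0)"
    and inj: "inj_on (\<lambda>u. pt (r u) (\<theta> u) (z u)) {0..1}"
    using A by blast+
  have rb: "1 \<le> r u \<and> r u \<le> 2" if "u \<in> {0..1}" for u
    using that r[of u] r01 by (cases "u = 0 \<or> u = 1") auto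
  have io_eq: "io = {pt (r 0) (\<theta> 0) (z 0), pt (r 1) (\<theta> 1) (z 1)}"
    using ends[of 0] ends[of 1] r01 by (simp add: io_def pt_def)
  have mem_io: "u = 0 \<or> u = 1" if "pt (r u) (\<theta> u) (z u) \<in> io" "u \<in> {0..1}" for u
    using that inj unfolding io_eq inj_on_def by auto
  have tan: "tangent ?\<gamma> u = vector [deriv r u * sin (\<theta> u) + r u * (deriv \<theta> u * cos (\<theta> u)),
      deriv r u * cos (\<theta> u) - r u * (deriv \<theta> u * sin (\<theta> u)), deriv z u]" for u
    by (intro tangent_polar_curve smooth_on_real_differentiable sm)
  have emb: "framed_embedding (False, ?\<gamma>)"
    unfolding framed_embedding_def prod.case
  proof (intro conjI ballI)
    show "smooth_on (smooth_dom False) ?\<gamma>"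
      unfolding polar_curve_def[abs_def] by (rule smooth_on_polar) (use sm in \<open>auto intro: smooth_on_subset\<close>)
    show "inj_on (\<lambda>u. fst (?\<gamma> u)) (param_dom False)" using inj by (simp add: param_dom_def)
    fix u assume "u \<in> param_dom False"
    then have u: "u \<in> {0..1}" by (simp add: param_dom_def)
    show "cross3 (tangent ?\<gamma> u) (snd (?\<gamma> u)) \<noteq> 0"
    proof
      assume "cross3 (tangent ?\<gamma> u) (snd (?\<gamma> u)) = 0"
      then have "deriv r u = 0 \<and> deriv \<theta> u = 0"
        using z[OF u] rb[OF u] by (intro polar_derivative_eq_0[of _ "\<theta> u" "r u"]) (auto simp: cross3_vertical_eq_0 tan)
      then show False using z[OF u] by simp
    qed
  qed simp
  have tr: "point_trace (False, ?\<gamma>) = (\<lambda>u. pt (r u) (\<theta> u) (z u)) ` {0..1}"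
    by (simp add: point_trace_def framed_trace_def param_dom_def image_image)
  have thick: "point_trace (False, ?\<gamma>) \<subseteq> thick_annulus"
    unfolding tr
  proof clarify
    fix u :: real assume u: "u \<in> {0..1}"
    then show "pt (r u) (\<theta> u) (z u) \<in> thick_annulus"
      using rb[OF u] z[OF u] by (subst pt_in_thick) auto
  qed
  have front: "point_trace (False, ?\<gamma>) \<inter> frontier thick_annulus = io"
  proof
    show "point_trace (False, ?\<gamma>) \<inter> frontier thick_annulus \<subseteq> io"
    proof
      fix p assume p: "p \<in> point_trace (False, ?\<gamma>) \<inter> frontier thick_annulus"
      then obtain u where u: "u \<in> {0..1}" "p = pt (r u) (\<theta> u) (z u)" unfolding tr by auto
      have "u = 0 \<or> u = 1"
      proof (rule ccontr)
        assume "\<not> (u = 0 \<or> u = 1)"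
        then have "u \<in> {0<..<1}" using u by auto
        then have "p \<in> open_thick" using r[of u] z[OF u(1)] u(2) by (simp add: pt_in_open_thick abs_less_iff)
        then show False using p by (simp add: frontier_thick_annulus)
      qed
      then show "p \<in> io" using u(2) by (auto simp: io_eq)
    qed
    have "io \<subseteq> point_trace (False, ?\<gamma>)" unfolding tr io_eq by auto
    moreover have "p \<notin> open_thick" if "p \<in> io" for p
      using that r01 by (auto simp: io_eq pt_in_open_thick)
    ultimately show "io \<subseteq> point_trace (False, ?\<gamma>) \<inter> frontier thick_annulus"
      using thick by (auto simp: frontier_thick_annulus)
  qed
  have "boundary_normal io (False, ?\<gamma>)"
    unfolding boundary_normal_def
  proof (intro ballI impI)
    fix u assume "u \<in> param_dom (fst (False, ?\<gamma>))" "fst (snd (False, ?\<gamma>) u) \<in> io"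
    then have u: "u \<in> {0..1}" and u01: "u = 0 \<or> u = 1" using mem_io by (auto simp: param_dom_def)
    then have e: "sin (\<theta> u) = 0" "cos (\<theta> u) = 1" "z u = 0" "deriv \<theta> u = 0" "deriv z u = 0"
      using ends by auto
    \<comment> \<open>The end has height 0 and no angular or vertical velocity, so the tangent is a
      multiple of the position vector.\<close>
    have "tangent ?\<gamma> u = (deriv r u / r u) *\<^sub>R fst (?\<gamma> u)"
      using e rb[OF u] by (simp add: tan point_eq_iff)
    then show "(\<exists>a. tangent (snd (False, ?\<gamma>)) u = a *\<^sub>R fst (snd (False, ?\<gamma>) u)) \<and>
        (\<exists>a>0. snd (snd (False, ?\<gamma>) u) = a *\<^sub>R vertical)"
      using z[OF u] by auto
  qed
  then show ?thesis
    using emb thick front by (simp add: relative_framed_link_iff endpoints_def io_eq)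
qed

definition arc_trace :: "(real \<Rightarrow> real) \<Rightarrow> (real \<Rightarrow> real) \<Rightarrow> (real \<Rightarrow> real) \<Rightarrow> (real \<Rightarrow> real) \<Rightarrow> framed_set" where
  "arc_trace r \<theta> z \<phi> = polar_curve r \<theta> z \<phi> ` {0..1}"

lemma framed_image_arc: "framed_image [(False, polar_curve r \<theta> z \<phi>)] = arc_trace r \<theta> z \<phi>"
  by (simp add: framed_image_singleton framed_trace_def param_dom_def arc_trace_def)

lemma arc_trace_in_links: "arc_data r \<theta> z \<phi> \<Longrightarrow> arc_trace r \<theta> z \<phi> \<in> links io"
  using arc_data_link framed_image_arc unfolding links_def by blast

lemma deriv_affine_combination:
  fixes f g :: "real \<Rightarrow> real"
  assumes "smooth_on UNIV f" "smooth_on UNIV g"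
  shows "deriv (\<lambda>u. (1 - s) * f u + s * g u) u = (1 - s) * deriv f u + s * deriv g u"
  using smooth_on_real_differentiable[OF assms(1), of u] smooth_on_real_differentiable[OF assms(2), of u]
  by (intro DERIV_imp_deriv) (auto intro!: derivative_eq_intros)

text \<open>The isotopy is a straight line in cylindrical coordinates: as soon as the parameter is positive,
  the radius is strictly increasing, so the curve is embedded.\<close>

lemma arc_isotopic:
  assumes A: "arc_data r \<theta> z \<phi>" and B: "arc_data r' \<theta>' z' \<phi>'"
    and r: "\<And>u v. u \<in> {0..1} \<Longrightarrow> v \<in> {0..1} \<Longrightarrow> u \<le> v \<Longrightarrow> r u \<le> r v" "\<And>u. u \<in> {0..1} \<Longrightarrow> 0 \<le> deriv r u"
    and r': "\<And>u v. u \<in> {0..1} \<Longrightarrow> v \<in> {0..1} \<Longrightarrow> u < v \<Longrightarrow> r' u < r' v" "\<And>u. u \<in> {0..1} \<Longrightarrow> 0 < deriv r' u"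
    and \<theta>: "\<theta>' 0 = \<theta> 0" "\<theta>' 1 = \<theta> 1"
  shows "isotopic io (arc_trace r \<theta> z \<phi>) (arc_trace r' \<theta>' z' \<phi>')"
proof -
  define mix where "mix f g s u = (1 - s) * f u + s * g u" for f g :: "real \<Rightarrow> real" and s u :: real
  define F where "F x = polar_curve (mix r r' (fst x)) (mix \<theta> \<theta>' (fst x)) (mix z z' (fst x)) (mix \<phi> \<phi>' (fst x)) (snd x)"
    for x :: "real \<times> real"
  have sm: "smooth_on UNIV r" "smooth_on UNIV \<theta>" "smooth_on UNIV z" "smooth_on UNIV \<phi>"
    "smooth_on UNIV r'" "smooth_on UNIV \<theta>'" "smooth_on UNIV z'" "smooth_on UNIV \<phi>'"
    using A B by (auto simp: arc_data_def)
  have at: "at_time s (False, F) = (False, polar_curve (mix r r' s) (mix \<theta> \<theta>' s) (mix z z' s) (mix \<phi> \<phi>' s))" for s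
    by (simp add: at_time_def F_def fun_eq_iff)
  have mix0: "mix f g 0 = f" and mix1: "mix f g 1 = g" for f g by (auto simp: mix_def)
  have data: "arc_data (mix r r' s) (mix \<theta> \<theta>' s) (mix z z' s) (mix \<phi> \<phi>' s)" if s: "s \<in> {0..1}" for s
  proof (cases "s = 0")
    case True
    then show ?thesis using A by (simp add: mix0)
  next
    case False
    then have s: "0 < s" "0 \<le> 1 - s" using s by auto
    have sm': "smooth_on UNIV (mix f g s)" if "smooth_on UNIV f" "smooth_on UNIV g" for f g
      unfolding mix_def[abs_def] by (intro smooth_intros that)
    have d: "deriv (mix f g s) u = (1 - s) * deriv f u + s * deriv g u" if "smooth_on UNIV f" "smooth_on UNIV g" for f g u
      unfolding mix_def[abs_def] by (rule deriv_affine_combination[OF that])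
    have conv: "a < mix f g s u" if "a < f u" "a < g u" for a f g u
    proof -
      have "a = (1 - s) * a + s * a" by (simp add: algebra_simps)
      also have "\<dots> < mix f g s u" unfolding mix_def using s that
        by (intro add_le_less_mono mult_left_mono mult_strict_left_mono) auto
      finally show ?thesis .
    qed
    have conv': "mix f g s u < a" if "f u < a" "g u < a" for a f g u
    proof -
      have "mix f g s u < (1 - s) * a + s * a" unfolding mix_def using s that
        by (intro add_le_less_mono mult_left_mono mult_strict_left_mono) auto
      also have "\<dots> = a" by (simp add: algebra_simps)
      finally show ?thesis .
    qed
    have mono: "mix r r' s u < mix r r' s v" if "u \<in> {0..1}" "v \<in> {0..1}" "u < v" for u v
      unfolding mix_def using s r(1)[of u v] r'(1)[of u v] that
      by (intro add_le_less_mono mult_left_mono mult_strict_left_mono) auto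
    have m01: "mix r r' s 0 = 1" "mix r r' s 1 = 2"
      using A B by (auto simp: mix_def arc_data_def algebra_simps)
    have pos: "mix r r' s u > 0" if "u \<in> {0..1}" for u
      using mono[of 0 u] m01 that by (cases "u = 0") auto
    have inj: "inj_on (\<lambda>u. pt (mix r r' s u) (mix \<theta> \<theta>' s u) (mix z z' s u)) {0..1}"
    proof (rule linorder_inj_onI')
      fix u v :: real assume uv: "u \<in> {0..1}" "v \<in> {0..1}" "u < v"
      show "pt (mix r r' s u) (mix \<theta> \<theta>' s u) (mix z z' s u) \<noteq> pt (mix r r' s v) (mix \<theta> \<theta>' s v) (mix z z' s v)"
        using mono[OF uv] pos[OF uv(1)] pos[OF uv(2)] by (simp add: pt_eq_iff)
    qed
    have dr: "deriv (mix r r' s) u > 0" if "u \<in> {0..1}" for u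
      using d[OF sm(1,5)] r(2)[OF that] r'(2)[OF that] s by (simp add: add_nonneg_pos)
    \<comment> \<open>Equal end angles keep the ends of all intermediate curves at the marked
      points.\<close>
    have m\<theta>: "mix \<theta> \<theta>' s u = \<theta> u" if "u \<in> {0, 1}" for u
      using \<theta> that by (auto simp: mix_def algebra_simps)
    have Ae: "sin (\<theta> u) = 0" "cos (\<theta> u) = 1" "z u = 0" "deriv \<theta> u = 0" "deriv z u = 0" if "u \<in> {0, 1}" for u
      using A that unfolding arc_data_def by blast+
    have Be: "z' u = 0" "deriv \<theta>' u = 0" "deriv z' u = 0" if "u \<in> {0, 1}" for u
      using B that unfolding arc_data_def by blast+
    have Ai: "\<bar>z u\<bar> < 1" "0 < \<phi> u" if "u \<in> {0..1}" for u
      using A that unfolding arc_data_def by blast+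
    have Bi: "\<bar>z' u\<bar> < 1" "0 < \<phi>' u" if "u \<in> {0..1}" for u
      using B that unfolding arc_data_def by blast+
    show ?thesis
      unfolding arc_data_def
    proof (intro conjI ballI)
      fix u :: real assume u: "u \<in> {0<..<1}"
      show "1 < mix r r' s u" "mix r r' s u < 2"
        using mono[of 0 u] mono[of u 1] m01 u by auto
    next
      fix u :: real assume u: "u \<in> {0, 1}"
      show "sin (mix \<theta> \<theta>' s u) = 0" "cos (mix \<theta> \<theta>' s u) = 1"
        using m\<theta>[OF u] Ae[OF u] by auto
      show "mix z z' s u = 0" "deriv (mix \<theta> \<theta>' s) u = 0" "deriv (mix z z' s) u = 0"
        using d[OF sm(2,6), of u] d[OF sm(3,7), of u] Ae[OF u] Be[OF u] by (auto simp: mix_def)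
    next
      fix u :: real assume u: "u \<in> {0..1}"
      show "\<bar>mix z z' s u\<bar> < 1"
        using conv[of "-1" z u z'] conv'[of z u 1 z'] Ai[OF u] Bi[OF u] by (auto simp: abs_less_iff)
      show "0 < mix \<phi> \<phi>' s u"
        using conv[of 0 \<phi> u \<phi>'] Ai[OF u] Bi[OF u] by auto
      show "deriv (mix r r' s) u \<noteq> 0 \<or> deriv (mix \<theta> \<theta>' s) u \<noteq> 0"
        using dr[OF u] by auto
    qed (use inj m01 sm sm' in auto)
  qed
  have sm2: "smooth_on S (\<lambda>x. mix f g (fst x) (snd x))" if "smooth_on UNIV f" "smooth_on UNIV g"
    for f g and S :: "(real \<times> real) set"
  proof -
    have "smooth_on S (\<lambda>x. f (snd x))" "smooth_on S (\<lambda>x. g (snd x))"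
      using smooth_on_compose[OF that(1) smooth_on_snd[OF smooth_on_id[of S]]]
        smooth_on_compose[OF that(2) smooth_on_snd[OF smooth_on_id[of S]]] by auto
    then show ?thesis unfolding mix_def by (intro smooth_intros)
  qed
  have "isotopy_family io [(False, F)]"
    unfolding isotopy_family_def F_def[abs_def] polar_curve_def
    using smooth_on_polar[OF sm2[OF sm(1,5)] sm2[OF sm(2,6)] sm2[OF sm(3,7)] sm2[OF sm(4,8)]]
      arc_data_link[OF data] at
    by (simp add: F_def[abs_def] polar_curve_def)
  then show ?thesis
    unfolding isotopic_iff
    by (rule exI[of _ "[(False, F)]", OF conjI]) (simp add: at framed_image_arc mix0 mix1)
qed

section \<open>The core circle as a link\<close>

lemma flat_circle_eq: "flat_circle r = (\<lambda>u. (pt r (2 * pi * u) 0, vertical)) ` {0..<1}" if "r > 0"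
proof
  show "flat_circle r \<subseteq> (\<lambda>u. (pt r (2 * pi * u) 0, vertical)) ` {0..<1}"
  proof
    fix x assume "x \<in> flat_circle r"
    then obtain p where p: "x = (p, vertical)" "norm (proj p) = r" "p $ 3 = 0" by (auto simp: flat_circle_def)
    have "(p $ 1)\<^sup>2 + (p $ 2)\<^sup>2 = r\<^sup>2" using p(2) unfolding norm_proj
      by (metis real_sqrt_pow2 sum_power2_ge_zero)
    then have "(p $ 2 / r)\<^sup>2 + (p $ 1 / r)\<^sup>2 = 1"
      using that by (simp add: power_divide add_divide_distrib[symmetric] add.commute)
    then obtain t where t: "0 \<le> t" "t < 2 * pi" "p $ 2 / r = cos t" "p $ 1 / r = sin t"
      using sincos_total_2pi by metis
    have "p = pt r (2 * pi * (t / (2 * pi))) 0"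
      using t p that by (simp add: point_eq_iff field_simps)
    moreover have "t / (2 * pi) \<in> {0..<1}" using t by simp
    ultimately show "x \<in> (\<lambda>u. (pt r (2 * pi * u) 0, vertical)) ` {0..<1}" using p by blast
  qed
  show "(\<lambda>u. (pt r (2 * pi * u) 0, vertical)) ` {0..<1} \<subseteq> flat_circle r"
    using that by (auto simp: flat_circle_def)
qed

lemma flat_circle_in_links: "flat_circle (3/2) \<in> links {}"
proof -
  define \<gamma> where "\<gamma> = polar_curve (\<lambda>_. 3/2) (\<lambda>u. 2 * pi * u) (\<lambda>_. 0) (\<lambda>_. 1)"
  have tan: "tangent \<gamma> u = vector [0 * sin (2 * pi * u) + 3/2 * (2 * pi * cos (2 * pi * u)),
      0 * cos (2 * pi * u) - 3/2 * (2 * pi * sin (2 * pi * u)), 0]" for u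
    unfolding \<gamma>_def by (rule tangent_polar_curve) (auto intro!: derivative_eq_intros)
  have tr: "framed_trace (True, \<gamma>) = flat_circle (3/2)"
    by (simp add: framed_trace_def param_dom_def \<gamma>_def flat_circle_eq polar_curve_def[abs_def])
  have "framed_embedding (True, \<gamma>)"
    unfolding framed_embedding_def prod.case
  proof (intro conjI ballI impI allI)
    show "smooth_on (smooth_dom True) \<gamma>"
      unfolding \<gamma>_def polar_curve_def[abs_def] by (rule smooth_on_polar) (intro smooth_intros)+
    show "\<gamma> (u + 1) = \<gamma> u" for u
      using pt_add_2pi[of "3/2" "2 * pi * u" 1 0] by (simp add: \<gamma>_def polar_curve_def distrib_left)
    show "inj_on (\<lambda>u. fst (\<gamma> u)) (param_dom True)"
    proof (rule inj_onI)
      fix u v assume uv: "u \<in> param_dom True" "v \<in> param_dom True" "fst (\<gamma> u) = fst (\<gamma> v)"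
      then have "sin (2 * pi * u) = sin (2 * pi * v) \<and> cos (2 * pi * u) = cos (2 * pi * v)"
        by (simp add: \<gamma>_def pt_eq_iff)
      then obtain n :: int where "2 * pi * u = 2 * pi * v + 2 * pi * n"
        using sin_cos_eq_iff by blast
      then have "2 * pi * u = 2 * pi * (v + n)" by (simp add: distrib_left)
      then have "u = v + n" by simp
      moreover have "\<bar>u - v\<bar> < 1" using uv by (auto simp: param_dom_def)
      ultimately show "u = v" by auto
    qed
    fix u assume "u \<in> param_dom True"
    have snd: "snd (\<gamma> u) = 1 *\<^sub>R vertical" by (simp add: \<gamma>_def)
    show "cross3 (tangent \<gamma> u) (snd (\<gamma> u)) \<noteq> 0"
    proof
      assume "cross3 (tangent \<gamma> u) (snd (\<gamma> u)) = 0"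
      then have "0 = (0::real) \<and> 2 * pi = 0"
        using cross3_vertical_eq_0[of 1 "tangent \<gamma> u"] snd
        by (intro polar_derivative_eq_0[of _ "2 * pi * u" "3/2"]) (simp_all add: tan)
      then show False by simp
    qed
  qed
  moreover have pt: "point_trace (True, \<gamma>) \<subseteq> open_thick"
    unfolding point_trace_def tr by (auto simp: flat_circle_def open_thick_def)
  moreover have "point_trace (True, \<gamma>) \<subseteq> thick_annulus"
    using pt interior_subset[of thick_annulus] by (simp add: interior_thick_annulus)
  ultimately have "relative_framed_link {} [(True, \<gamma>)]"
    by (auto simp: relative_framed_link_iff endpoints_def frontier_thick_annulus boundary_normal_def)
  moreover have "flat_circle (3/2) = framed_image [(True, \<gamma>)]"
    by (simp only: framed_image_singleton tr)
  ultimately show ?thesis unfolding links_def by blast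
qed

section \<open>Spirals and the smoothed crossing\<close>

text \<open>The spirals wind only where the radius is between 9/8 and 5/4, and are radial in the ball in which
  they cross the circle of radius 3/2.\<close>

definition wind :: "real \<Rightarrow> real" where "wind = step (9/8) (5/4)"

definition spiral_angle :: "int \<Rightarrow> real \<Rightarrow> real" where
  "spiral_angle k u = 2 * pi * of_int k * wind (1 + u)"

definition spiral :: "int \<Rightarrow> framed_set" where
  "spiral k = arc_trace (\<lambda>u. 1 + u) (spiral_angle k) (\<lambda>_. 0) (\<lambda>_. 1)"

lemma smooth_on_real_compose: "smooth_on UNIV f \<Longrightarrow> smooth_on S g \<Longrightarrow> smooth_on S (\<lambda>x. f (g x))"
  for f :: "real \<Rightarrow> 'b::real_normed_vector"
  by (rule smooth_on_compose) auto

lemma locally_constant_has_derivative: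
  fixes f :: "real \<Rightarrow> real"
  assumes "open V" "u \<in> V" "\<And>v. v \<in> V \<Longrightarrow> f v = c"
  shows "(f has_real_derivative 0) (at u)"
  using assms by (intro has_field_derivative_transform_within_open[OF DERIV_const]) auto

lemma step_has_derivative_0:
  assumes "a < b" "u < a \<or> b < u"
  shows "(step a b has_real_derivative 0) (at u)"
  using assms(2)
proof
  assume "u < a"
  then show ?thesis by (intro locally_constant_has_derivative[of "{..<a}" _ _ 0]) auto
next
  assume "b < u"
  then show ?thesis using assms(1) by (intro locally_constant_has_derivative[of "{b<..}" _ _ 1]) auto
qed

lemma wind_simps [simp]: "r \<le> 9/8 \<Longrightarrow> wind r = 0" "5/4 \<le> r \<Longrightarrow> wind r = 1"
  by (simp_all add: wind_def)

lemma smooth_on_wind: "smooth_on UNIV wind"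
  unfolding wind_def using smooth_on_step[OF smooth_on_id, of "9/8" "5/4"] by simp

lemma wind_has_derivative: "(wind has_real_derivative deriv wind u) (at u)"
  by (rule smooth_on_real_differentiable[OF smooth_on_wind])

lemma deriv_wind_0: "u < 9/8 \<or> 5/4 < u \<Longrightarrow> deriv wind u = 0"
  unfolding wind_def by (rule DERIV_imp_deriv, rule step_has_derivative_0) auto

lemma smooth_on_spiral_angle: "smooth_on UNIV (spiral_angle k)"
  unfolding spiral_angle_def[abs_def] by (intro smooth_intros smooth_on_real_compose[OF smooth_on_wind])

lemma deriv_spiral_angle: "deriv (spiral_angle k) u = 2 * pi * of_int k * deriv wind (1 + u)"
proof -
  have "((\<lambda>u. wind (1 + u)) has_real_derivative deriv wind (1 + u) * 1) (at u)"
    by (rule DERIV_chain2[OF wind_has_derivative]) (auto intro!: derivative_eq_intros)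
  then show ?thesis
    unfolding spiral_angle_def[abs_def] by (intro DERIV_imp_deriv) (auto intro!: derivative_eq_intros)
qed

lemma deriv_affine [simp]: "deriv (\<lambda>u. 1 + u) u = (1::real)"
  by (rule DERIV_imp_deriv) (auto intro!: derivative_eq_intros)

lemma sin_cos_2pi_int: "sin (2 * pi * of_int k) = 0" "cos (2 * pi * of_int k) = 1"
  by (simp_all add: sin_int_2pin cos_int_2pin)

lemma spiral_data:
  assumes "\<phi> > 0"
  shows "arc_data (\<lambda>u. 1 + u) (spiral_angle k) (\<lambda>_. 0) (\<lambda>_. \<phi>)"
  unfolding arc_data_def
proof (intro conjI)
  show "inj_on (\<lambda>u. pt (1 + u) (spiral_angle k u) 0) {0..1}"
    by (auto intro!: inj_onI simp: pt_eq_iff)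
  show "\<forall>u\<in>{0, 1}. sin (spiral_angle k u) = 0 \<and> cos (spiral_angle k u) = 1 \<and> 0 = (0::real) \<and>
      deriv (spiral_angle k) u = 0 \<and> deriv (\<lambda>_. 0::real) u = 0"
    by (simp add: deriv_spiral_angle deriv_wind_0) (simp add: spiral_angle_def sin_cos_2pi_int)
qed (use assms in \<open>auto intro: smooth_intros smooth_on_spiral_angle\<close>)

lemma spiral_in_links: "spiral k \<in> links io"
  unfolding spiral_def by (rule arc_trace_in_links) (rule spiral_data, simp)

lemma arc_isotopic_spiral:
  assumes "arc_data r \<theta> z \<phi>"
    and "\<And>u v. u \<in> {0..1} \<Longrightarrow> v \<in> {0..1} \<Longrightarrow> u \<le> v \<Longrightarrow> r u \<le> r v" "\<And>u. u \<in> {0..1} \<Longrightarrow> 0 \<le> deriv r u"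
    and "\<theta> 0 = 0" "\<theta> 1 = 2 * pi * of_int k"
  shows "isotopic io (arc_trace r \<theta> z \<phi>) (spiral k)"
  unfolding spiral_def using assms
  by (intro arc_isotopic spiral_data) (auto simp: spiral_angle_def)

text \<open>The spiral has height 0 and a vertical framing, so only the length of the framing
  changes; \<open>arc_isotopic_spiral\<close> can undo this.\<close>

lemma push_squeeze_spiral:
  "push (hmap (1/4) 0) (spiral k) = arc_trace (\<lambda>u. 1 + u) (spiral_angle k) (\<lambda>_. 0) (\<lambda>_. 1/4)"
proof -
  have "map_prod (hmap (1/4) 0) (hmap (1/4) 0) (polar_curve (\<lambda>u. 1 + u) (spiral_angle k) (\<lambda>_. 0) (\<lambda>_. 1) u) =
      polar_curve (\<lambda>u. 1 + u) (spiral_angle k) (\<lambda>_. 0) (\<lambda>_. 1/4) u" for u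
    by (simp add: polar_curve_def hmap_fixes) (simp add: point_eq_iff axis_def)
  then show ?thesis
    by (simp add: spiral_def arc_trace_def push_hmap image_image)
qed

lemma stack_empty_spiral: "isotopic io (stack c {} (spiral k)) (spiral k)"
proof -
  have "isotopic io (arc_trace (\<lambda>u. 1 + u) (spiral_angle k) (\<lambda>_. 0) (\<lambda>_. 1/4)) (spiral k)"
    by (intro arc_isotopic_spiral spiral_data) (auto simp: spiral_angle_def)
  then show ?thesis by (simp add: stack_def push_squeeze_spiral)
qed

lemma spiral_0: "spiral 0 = {(vector [0, y, 0], vertical) | y. 1 \<le> y \<and> y \<le> 2}"
proof -
  have "spiral 0 = (\<lambda>u. (vector [0, 1 + u, 0], vertical)) ` {0..1}"
    by (simp add: spiral_def arc_trace_def polar_curve_def[abs_def] spiral_angle_def pt_def)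
  also have "\<dots> = (\<lambda>y. (vector [0, y, 0], vertical)) ` ((+) 1 ` {0..1})"
    by (simp only: image_image)
  also have "(+) 1 ` {0..1} = {1..2::real}"
    by (simp add: image_add_atLeastAtMost)
  finally show ?thesis by auto
qed

text \<open>A smoothing of the crossing of a spiral with the circle of radius 3/2 follows the spiral on
  \<open>[0, 1/4]\<close> and \<open>[3/4, 1]\<close>, the circle on \<open>[1/3, 2/3]\<close>, and turns within the ball in between. Its radius is weakly
  increasing and its angle is strictly monotone where the radius is constant. The circle has height
  \<open>\<sigma> * 3/4\<close> and is traversed in the direction \<open>d\<close>.\<close>

definition radius :: "real \<Rightarrow> real" where
  "radius u = 3/2 - exp 3 / 2 * bump (1/3 - u) + exp 3 / 2 * bump (u - 2/3)"

text \<open>Starts at 1/4, before the radius becomes constant at 1/3. This overlap, and its mirror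
  image, rounds the corners and prevents the velocity from vanishing.\<close>

definition turn :: "real \<Rightarrow> real" where
  "turn = step (1/4) (3/4)"

text \<open>A plateau: the height changes only on [1/4, 1/3] and on the mirror image of this
  interval, both of which the curve spends inside the ball.\<close>

definition lift :: "real \<Rightarrow> real" where
  "lift u = step (1/4) (1/3) u * step (1/4) (1/3) (1 - u)"

definition smoothed_angle :: "int \<Rightarrow> int \<Rightarrow> real \<Rightarrow> real" where
  "smoothed_angle k d u = 2 * pi * of_int k * wind (radius u) + 2 * pi * of_int d * turn u"

definition smoothed_height :: "real \<Rightarrow> real \<Rightarrow> real" where
  "smoothed_height \<sigma> u = \<sigma> * (3/4) * lift u"

definition smoothed :: "real \<Rightarrow> int \<Rightarrow> int \<Rightarrow> framed_set" where
  "smoothed \<sigma> k d = arc_trace radius (smoothed_angle k d) (smoothed_height \<sigma>) (\<lambda>_. 1/4)"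

section \<open>Symmetry and estimates for the smoothed curve\<close>

text \<open>Together with \<open>turn_reflect\<close> and \<open>lift_reflect\<close> this reduces
  the second half of the curve to the first.\<close>

lemma radius_reflect: "radius (1 - u) = 3 - radius u"
proof -
  have "1/3 - (1 - u) = u - 2/3" "1 - u - 2/3 = 1/3 - u" by simp_all
  then show ?thesis unfolding radius_def by simp
qed

text \<open>Explains the factor \<open>exp 3 / 2\<close> in \<open>radius\<close>: since bump (1/3)
  = exp (-3), it makes the correction at 0 equal to 1/2.\<close>

lemma radius_0: "radius 0 = 1"
  by (simp add: radius_def bump_eq exp_minus)

lemma radius_1: "radius 1 = 2"
  using radius_reflect[of 0] radius_0 by simp

lemma radius_mid: "1/3 \<le> u \<Longrightarrow> u \<le> 2/3 \<Longrightarrow> radius u = 3/2"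
  by (simp add: radius_def bump_eq)

lemma radius_strict_mono_left: "u < v \<Longrightarrow> u < 1/3 \<Longrightarrow> radius u < radius v"
  unfolding radius_def
  using bump_strict_mono[of "1/3 - v" "1/3 - u"] bump_mono[of "u - 2/3" "v - 2/3"]
  by (intro add_less_le_mono diff_strict_left_mono mult_strict_left_mono mult_left_mono) auto

lemma radius_strict_mono_right: "u < v \<Longrightarrow> 2/3 < v \<Longrightarrow> radius u < radius v"
  using radius_strict_mono_left[of "1 - v" "1 - u"] by (simp add: radius_reflect)

lemma radius_mono: "u \<le> v \<Longrightarrow> radius u \<le> radius v"
  using radius_strict_mono_left[of u v] radius_strict_mono_right[of u v] radius_mid[of u] radius_mid[of v]
  by (cases "u = v"; cases "u < 1/3"; cases "2/3 < v") auto

lemma exp_ge: "1 + x \<le> exp (x::real)"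
  by (rule exp_ge_add_one_self)

text \<open>The factor 4 converts radii to the second coordinate of the ball. Both bumps have
  argument at most 1/3 - 1/4 = 1/12, so the deviation from 3/2 is at most exp 3 / 2 * exp (-12) =
  exp (-9) / 2, which is below 1/20.\<close>

lemma radius_near:
  assumes "1/4 \<le> u" "u \<le> 3/4"
  shows "\<bar>4 * (radius u - 3/2)\<bar> \<le> 1/5"
proof -
  have b: "bump (1/3 - u) \<le> exp (- 12)" "bump (u - 2/3) \<le> exp (- 12)"
    using bump_mono[of "1/3 - u" "1/12"] bump_mono[of "u - 2/3" "1/12"] assms by (auto simp: bump_eq)
  have "\<bar>bump (u - 2/3) - bump (1/3 - u)\<bar> \<le> exp (- 12)"
    using b bump_nonneg[of "u - 2/3"] bump_nonneg[of "1/3 - u"] by linarith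
  then have "exp 3 / 2 * \<bar>bump (u - 2/3) - bump (1/3 - u)\<bar> \<le> exp 3 / 2 * exp (- 12)"
    by (intro mult_left_mono) auto
  also have "\<dots> = exp (- 9) / 2" by (simp add: exp_add[symmetric])
  also have "exp 3 / 2 * \<bar>bump (u - 2/3) - bump (1/3 - u)\<bar> = \<bar>exp 3 / 2 * (bump (u - 2/3) - bump (1/3 - u))\<bar>"
    by (simp add: abs_mult)
  also have "exp 3 / 2 * (bump (u - 2/3) - bump (1/3 - u)) = radius u - 3/2"
    by (simp add: radius_def algebra_simps)
  finally have "\<bar>radius u - 3/2\<bar> \<le> exp (- 9) / 2" .
  moreover have "exp (- 9) \<le> 1 / (10::real)"
    using exp_ge[of 9] by (simp add: exp_minus field_simps)
  moreover have "\<bar>4 * (radius u - 3/2)\<bar> = 4 * \<bar>radius u - 3/2\<bar>"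
    by (simp only: abs_mult abs_numeral)
  ultimately have "\<bar>4 * (radius u - 3/2)\<bar> \<le> 4 * (1/10 / 2)"
    by (auto intro: order_trans)
  then show ?thesis by simp
qed

lemma smooth_on_radius: "smooth_on UNIV radius"
  unfolding radius_def[abs_def] by (intro smooth_intros)

lemma radius_has_derivative:
  "(radius has_real_derivative exp 3 / 2 * (flat 2 (1/3 - u) + flat 2 (u - 2/3))) (at u)"
proof -
  have "((\<lambda>u. bump (1/3 - u)) has_real_derivative flat 2 (1/3 - u) * (-1)) (at u)"
    by (rule DERIV_chain2[OF bump_has_derivative]) (auto intro!: derivative_eq_intros)
  moreover have "((\<lambda>u. bump (u - 2/3)) has_real_derivative flat 2 (u - 2/3) * 1) (at u)"
    by (rule DERIV_chain2[OF bump_has_derivative]) (auto intro!: derivative_eq_intros)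
  ultimately show ?thesis
    unfolding radius_def[abs_def] by (auto intro!: derivative_eq_intros simp: algebra_simps)
qed

lemma deriv_radius: "deriv radius u = exp 3 / 2 * (flat 2 (1/3 - u) + flat 2 (u - 2/3))"
  by (rule DERIV_imp_deriv[OF radius_has_derivative])

lemma deriv_radius_nonneg: "deriv radius u \<ge> 0"
  by (simp add: deriv_radius flat_nonneg)

lemma deriv_radius_pos: "u < 1/3 \<or> 2/3 < u \<Longrightarrow> deriv radius u > 0"
  unfolding deriv_radius using flat_nonneg[of 2 "1/3 - u"] flat_nonneg[of 2 "u - 2/3"]
    flat_pos[of 2 "1/3 - u"] flat_pos[of 2 "u - 2/3"]
  by (intro mult_pos_pos) (auto intro: add_pos_nonneg add_nonneg_pos)

lemma deriv_radius_mid: "1/3 \<le> u \<Longrightarrow> u \<le> 2/3 \<Longrightarrow> deriv radius u = 0"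
  by (simp add: deriv_radius flat_def)

lemma turn_simps [simp]: "u \<le> 1/4 \<Longrightarrow> turn u = 0" "3/4 \<le> u \<Longrightarrow> turn u = 1"
  by (simp_all add: turn_def)

lemma turn_reflect: "turn (1 - u) = 1 - turn u"
  unfolding turn_def by (rule step_reflect) auto

lemma turn_half: "turn (1/2) = 1/2"
  using turn_reflect[of "1/2"] by simp

lemma turn_bounds: "0 \<le> turn u" "turn u \<le> 1"
  by (simp_all add: turn_def step_bounds)

lemma turn_mono: "u \<le> v \<Longrightarrow> turn u \<le> turn v"
  unfolding turn_def by (rule step_mono) auto

lemma turn_strict_mono: "u < v \<Longrightarrow> 1/4 < v \<Longrightarrow> u < 3/4 \<Longrightarrow> turn u < turn v"
  unfolding turn_def by (rule step_strict_mono) auto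

lemma smooth_on_turn: "smooth_on UNIV turn"
  unfolding turn_def using smooth_on_step[OF smooth_on_id, of "1/4" "3/4"] by simp

text \<open>The ball reaches up to angle 1, and the curve has to arrive on the circle, at parameter
  1/3, before that angle. The bound exp x \<ge> 1 + x gives turn (1/3) \<le> 5/53, and pi < 4 then
  gives at most 40/53 < 4/5.\<close>

lemma turn_third: "2 * pi * turn (1/3) \<le> 4/5"
proof -
  have "turn (1/3) = bump (1/12) / (bump (1/12) + bump (5/12))"
    by (simp add: turn_def step_def)
  also have "\<dots> \<le> bump (1/12) / bump (5/12)"
    by (intro divide_left_mono mult_pos_pos add_nonneg_pos) auto
  also have "\<dots> = exp (- 12) / exp (- (12/5))"
    by (simp add: bump_eq)
  also have "\<dots> = exp (- (48/5))"
    by (simp add: exp_diff[symmetric])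
  also have "\<dots> \<le> 5/53"
    using exp_ge[of "48/5"] by (simp add: exp_minus field_simps)
  finally have "turn (1/3) \<le> 5/53" .
  then have "2 * pi * turn (1/3) \<le> 2 * 4 * (5/53)"
    using pi_less_4 turn_bounds by (intro mult_mono) auto
  then show ?thesis by simp
qed

lemma lift_bounds: "0 \<le> lift u" "lift u \<le> 1"
  by (simp_all add: lift_def step_bounds mult_le_one)

lemma lift_simps: "u \<le> 1/4 \<Longrightarrow> lift u = 0" "3/4 \<le> u \<Longrightarrow> lift u = 0" "1/3 \<le> u \<Longrightarrow> u \<le> 2/3 \<Longrightarrow> lift u = 1"
  by (simp_all add: lift_def)

lemma lift_reflect: "lift (1 - u) = lift u"
  by (simp add: lift_def mult.commute)

lemma smooth_on_smoothed_height: "smooth_on UNIV (smoothed_height \<sigma>)"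
  unfolding smoothed_height_def[abs_def] lift_def by (intro smooth_intros) auto

lemma smooth_on_smoothed_angle: "smooth_on UNIV (smoothed_angle k d)"
  unfolding smoothed_angle_def[abs_def]
  by (intro smooth_intros smooth_on_real_compose[OF smooth_on_wind] smooth_on_radius smooth_on_turn)

lemma deriv_smoothed_angle:
  "deriv (smoothed_angle k d) u = 2 * pi * of_int k * (deriv wind (radius u) * deriv radius u) + 2 * pi * of_int d * deriv turn u"
proof -
  have "((\<lambda>u. wind (radius u)) has_real_derivative deriv wind (radius u) * deriv radius u) (at u)"
    by (rule DERIV_chain2[OF wind_has_derivative]) (rule smooth_on_real_differentiable[OF smooth_on_radius])
  moreover have "(turn has_real_derivative deriv turn u) (at u)"
    by (rule smooth_on_real_differentiable[OF smooth_on_turn])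
  ultimately show ?thesis
    unfolding smoothed_angle_def[abs_def] by (intro DERIV_imp_deriv) (auto intro!: derivative_eq_intros)
qed

lemma deriv_turn_0: "u < 1/4 \<or> 3/4 < u \<Longrightarrow> deriv turn u = 0"
  unfolding turn_def by (rule DERIV_imp_deriv, rule step_has_derivative_0) auto

lemma deriv_turn_pos: "1/4 < u \<Longrightarrow> u < 3/4 \<Longrightarrow> deriv turn u > 0"
  unfolding turn_def using step_has_derivative_pos[of "1/4" u "3/4"] DERIV_imp_deriv by metis

lemma deriv_smoothed_height: "u < 1/4 \<or> 3/4 < u \<Longrightarrow> deriv (smoothed_height \<sigma>) u = 0"
proof (rule DERIV_imp_deriv, erule disjE)
  assume "u < 1/4"
  then show "(smoothed_height \<sigma> has_real_derivative 0) (at u)"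
    by (intro locally_constant_has_derivative[of "{..<1/4}" _ _ 0]) (auto simp: smoothed_height_def lift_simps)
next
  assume "3/4 < u"
  then show "(smoothed_height \<sigma> has_real_derivative 0) (at u)"
    by (intro locally_constant_has_derivative[of "{3/4<..}" _ _ 0]) (auto simp: smoothed_height_def lift_simps)
qed

lemma smoothed_angle_ends: "smoothed_angle k d 0 = 0" "smoothed_angle k d 1 = 2 * pi * of_int (k + d)"
  by (simp_all add: smoothed_angle_def radius_0 radius_1 distrib_left)

lemma radius_pos: "u \<in> {0..1} \<Longrightarrow> 1 \<le> radius u \<and> radius u \<le> 2"
  using radius_mono[of 0 u] radius_mono[of u 1] by (simp add: radius_0 radius_1)

text \<open>Points of equal radius lie on the constant part [1/3, 2/3], where their angles differ by
  a nonzero amount of less than a full turn. On that part the angular velocity also replaces the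
  vanishing radial one.\<close>

lemma smoothed_data:
  assumes d: "\<bar>d\<bar> = 1" and \<sigma>: "\<bar>\<sigma>\<bar> = 1"
  shows "arc_data radius (smoothed_angle k d) (smoothed_height \<sigma>) (\<lambda>_. 1/4)"
proof -
  have inj: "inj_on (\<lambda>u. pt (radius u) (smoothed_angle k d u) (smoothed_height \<sigma> u)) {0..1}"
  proof (rule linorder_inj_onI')
    fix u v :: real assume uv: "u \<in> {0..1}" "v \<in> {0..1}" "u < v"
    show "pt (radius u) (smoothed_angle k d u) (smoothed_height \<sigma> u) \<noteq> pt (radius v) (smoothed_angle k d v) (smoothed_height \<sigma> v)"
    proof
      assume "pt (radius u) (smoothed_angle k d u) (smoothed_height \<sigma> u) = pt (radius v) (smoothed_angle k d v) (smoothed_height \<sigma> v)"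
      then have eq: "radius u = radius v" "sin (smoothed_angle k d u) = sin (smoothed_angle k d v)"
          "cos (smoothed_angle k d u) = cos (smoothed_angle k d v)"
        using radius_pos[OF uv(1)] radius_pos[OF uv(2)] by (simp_all add: pt_eq_iff)
      then obtain n :: int where n: "smoothed_angle k d u = smoothed_angle k d v + 2 * pi * n"
        using sin_cos_eq_iff by blast
      have "1/3 \<le> u" "v \<le> 2/3"
        using eq(1) uv(3) radius_strict_mono_left[of u v] radius_strict_mono_right[of u v] by force+
      then have t: "turn u < turn v" "0 < turn u" "turn v < 1"
        using uv(3) turn_strict_mono[of u v] turn_strict_mono[of 0 u] turn_strict_mono[of v 1] by auto
      have "2 * pi * (of_int d * turn u) = 2 * pi * (of_int d * turn v + of_int n)"
        using n eq(1) by (simp add: smoothed_angle_def algebra_simps)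
      then have "of_int d * turn u = of_int d * turn v + of_int n"
        by (subst (asm) mult_left_cancel) auto
      then have "of_int d * (turn u - turn v) = of_int n" by (simp add: algebra_simps)
      then have "\<bar>of_int n\<bar> = \<bar>of_int d * (turn u - turn v)\<bar>" by simp
      also have "\<dots> = turn v - turn u" using d t by (simp add: abs_mult of_int_abs[symmetric] del: of_int_abs)
      finally have "\<bar>of_int n\<bar> = turn v - turn u" .
      with t have "0 < \<bar>real_of_int n\<bar>" "\<bar>real_of_int n\<bar> < 1" by auto
      then show False using of_int_less_1_iff[of "\<bar>n\<bar>", where 'a = real] by auto
    qed
  qed
  have nz: "deriv radius u \<noteq> 0 \<or> deriv (smoothed_angle k d) u \<noteq> 0" for u
  proof (cases "u < 1/3 \<or> 2/3 < u")
    case True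
    then show ?thesis using deriv_radius_pos[of u] by auto
  next
    case False
    then have "deriv (smoothed_angle k d) u = 2 * pi * of_int d * deriv turn u"
      by (simp add: deriv_smoothed_angle deriv_radius_mid)
    moreover have "deriv turn u > 0" using False by (intro deriv_turn_pos) auto
    ultimately show ?thesis using d by auto
  qed
  have ends: "sin (smoothed_angle k d u) = 0 \<and> cos (smoothed_angle k d u) = 1 \<and> smoothed_height \<sigma> u = 0 \<and>
      deriv (smoothed_angle k d) u = 0 \<and> deriv (smoothed_height \<sigma>) u = 0" if "u \<in> {0, 1}" for u
  proof -
    have "deriv (smoothed_angle k d) u = 0"
      using that by (auto simp: deriv_smoothed_angle radius_0 radius_1 deriv_wind_0 deriv_turn_0)
    then show ?thesis
      using that smoothed_angle_ends[of k d] sin_cos_2pi_int[of "k + d"]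
      by (auto simp: smoothed_height_def lift_simps intro!: deriv_smoothed_height)
  qed
  have r: "1 < radius u \<and> radius u < 2" if "u \<in> {0<..<1}" for u
    using that radius_strict_mono_left[of 0 u] radius_strict_mono_right[of u 1] by (simp add: radius_0 radius_1)
  have h: "\<bar>smoothed_height \<sigma> u\<bar> < 1" for u
    using \<sigma> lift_bounds[of u] by (simp add: smoothed_height_def abs_mult)
  show ?thesis
    unfolding arc_data_def
    by (intro conjI ballI smooth_on_radius smooth_on_smoothed_angle smooth_on_smoothed_height smooth_on_const
        radius_0 radius_1 inj nz h) (use ends r in auto)
qed

lemma smoothed_in_links: "\<bar>d\<bar> = 1 \<Longrightarrow> \<bar>\<sigma>\<bar> = 1 \<Longrightarrow> smoothed \<sigma> k d \<in> links io"
  unfolding smoothed_def by (intro arc_trace_in_links smoothed_data)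

lemma smoothed_isotopic: "\<bar>d\<bar> = 1 \<Longrightarrow> \<bar>\<sigma>\<bar> = 1 \<Longrightarrow> isotopic io (smoothed \<sigma> k d) (spiral (k + d))"
  unfolding smoothed_def
  by (intro arc_isotopic_spiral smoothed_data radius_mono deriv_radius_nonneg smoothed_angle_ends)

section \<open>The ball around the crossing\<close>

text \<open>The first axis of the model ball is carried to the circle and the second one to a radial segment,
  so that the circle is the overstrand for \<open>\<sigma> = 1\<close>.\<close>

definition chart :: "real \<Rightarrow> point \<Rightarrow> point" where
  "chart \<sigma> p = pt (3/2 + p $ 2 / 4) (p $ 1) (\<sigma> * (3/8) + p $ 3 / 2)"

lemma cylinder_iff: "p \<in> cylinder \<longleftrightarrow> (p $ 1)\<^sup>2 + (p $ 2)\<^sup>2 \<le> 1 \<and> \<bar>p $ 3\<bar> \<le> 1"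
  by (auto simp: cylinder_def norm_proj)

lemma cylinder_bounds:
  assumes "p \<in> cylinder"
  shows "\<bar>p $ 1\<bar> \<le> 1" "\<bar>p $ 2\<bar> \<le> 1" "\<bar>p $ 3\<bar> \<le> 1"
proof -
  have "(p $ 1)\<^sup>2 \<le> 1" "(p $ 2)\<^sup>2 \<le> 1"
    using assms zero_le_power2[of "p $ 1"] zero_le_power2[of "p $ 2"] unfolding cylinder_iff by linarith+
  then show "\<bar>p $ 1\<bar> \<le> 1" "\<bar>p $ 2\<bar> \<le> 1" "\<bar>p $ 3\<bar> \<le> 1"
    using assms by (simp_all add: abs_square_le_1 cylinder_iff)
qed

lemma chart_radius_pos: "p \<in> cylinder \<Longrightarrow> 5/4 \<le> 3/2 + p $ 2 / 4 \<and> 3/2 + p $ 2 / 4 \<le> 7/4"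
  using cylinder_bounds(2)[of p] by auto

lemma smooth_on_chart: "smooth_on S (chart \<sigma>)"
  unfolding chart_def[abs_def] pt_def by (intro smooth_intros) auto

lemma has_derivative_vector3:
  assumes "(f has_derivative f') F" "(g has_derivative g') F" "(h has_derivative h') F"
  shows "((\<lambda>x. vector [f x, g x, h x] :: real^3) has_derivative (\<lambda>v. vector [f' v, g' v, h' v])) F"
  unfolding vector3_eq_axis using assms by (intro derivative_intros)

definition chart_deriv :: "point \<Rightarrow> point \<Rightarrow> point" where
  "chart_deriv p v = vector [(v $ 2 / 4) * sin (p $ 1) + (3/2 + p $ 2 / 4) * (v $ 1 * cos (p $ 1)),
     (v $ 2 / 4) * cos (p $ 1) - (3/2 + p $ 2 / 4) * (v $ 1 * sin (p $ 1)), v $ 3 / 2]"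

lemma chart_has_derivative: "(chart \<sigma> has_derivative chart_deriv p) (at p)"
proof -
  have nth: "((\<lambda>p. p $ i) has_derivative (\<lambda>v. v $ i)) (at p)" for i and p :: point
    by (rule bounded_linear_imp_has_derivative) (rule bounded_linear_vec_nth)
  note nth1 = nth[of 1] and nth2 = nth[of 2] and nth3 = nth[of 3]
  show ?thesis
    unfolding chart_def[abs_def] pt_def chart_deriv_def[abs_def]
    by (rule has_derivative_vector3)
       (auto intro!: derivative_eq_intros nth simp: fun_eq_iff add_divide_distrib diff_divide_distrib algebra_simps)
qed

lemma frechet_derivative_chart: "frechet_derivative (chart \<sigma>) (at p) = chart_deriv p"
  using frechet_derivative_at[OF chart_has_derivative] by simp

text \<open>The Jacobian r of polar coordinates times the scalings 1/4 and 1/2. It is positive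
  because the clockwise angle is listed before the radius.\<close>

lemma det_chart_deriv: "det (matrix (chart_deriv p)) = (3/2 + p $ 2 / 4) / 8"
proof -
  let ?r = "3/2 + p $ 2 / 4"
  have "det (matrix (chart_deriv p)) = ?r * ((cos (p $ 1))\<^sup>2 + (sin (p $ 1))\<^sup>2) / 8"
    by (simp add: det_3 matrix_def chart_deriv_def axis_def) (use sin_cos_squared_add[of "p $ 1"] in algebra)
  then show ?thesis by simp
qed

lemma sin_cos_eq_imp_eq:
  assumes "sin x = sin y" "cos x = cos y" "\<bar>x\<bar> \<le> 1" "\<bar>y\<bar> \<le> (1::real)"
  shows "x = y"
proof -
  obtain n :: int where n: "x = y + 2 * pi * n" using assms(1,2) sin_cos_eq_iff by blast
  have "\<bar>2 * pi * of_int n\<bar> \<le> 2" using n assms(3,4) by linarith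
  then have "pi * \<bar>of_int n\<bar> \<le> 1" by (simp add: abs_mult)
  have "n = 0"
  proof (rule ccontr)
    assume "n \<noteq> 0"
    then have "pi * 1 \<le> pi * \<bar>of_int n\<bar>" by (intro mult_left_mono) auto
    then show False using pi_gt3 \<open>pi * \<bar>of_int n\<bar> \<le> 1\<close> by linarith
  qed
  then show ?thesis using n by simp
qed

text \<open>The centre height \<open>\<sigma> * (3/8)\<close> is midway between the heights 0 and
  \<open>\<sigma> * (3/4)\<close> of the strands; with half-height 1/2 the ball stays within height
  7/8. Angles up to 1 in absolute value are determined by sine and cosine, which gives
  injectivity.\<close>

lemma ball_chart_chart:
  assumes "\<bar>\<sigma>\<bar> = 1"
  shows "ball_chart (chart \<sigma>)"
  unfolding ball_chart_def
proof (intro conjI ballI)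
  show "smooth_on cylinder (chart \<sigma>)" by (rule smooth_on_chart)
  show "inj_on (chart \<sigma>) cylinder"
  proof (rule inj_onI)
    fix p q assume pq: "p \<in> cylinder" "q \<in> cylinder" "chart \<sigma> p = chart \<sigma> q"
    have "p $ 2 = q $ 2" "p $ 3 = q $ 3" "sin (p $ 1) = sin (q $ 1)" "cos (p $ 1) = cos (q $ 1)"
      using pq(3) chart_radius_pos[OF pq(1)] chart_radius_pos[OF pq(2)] by (simp_all add: chart_def pt_eq_iff)
    then show "p = q"
      using sin_cos_eq_imp_eq[of "p $ 1" "q $ 1"] cylinder_bounds[OF pq(1)] cylinder_bounds[OF pq(2)]
      by (simp add: point_eq_iff)
  qed
  fix p assume p: "p \<in> cylinder"
  then show "0 < det (matrix (frechet_derivative (chart \<sigma>) (at p)))"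
    using chart_radius_pos[OF p] by (simp add: frechet_derivative_chart det_chart_deriv)
next
  show "chart \<sigma> ` cylinder \<subseteq> interior thick_annulus"
    unfolding interior_thick_annulus
  proof clarify
    fix p assume p: "p \<in> cylinder"
    then show "chart \<sigma> p \<in> open_thick"
      using chart_radius_pos[OF p] cylinder_bounds(3)[OF p] assms
      by (auto simp: chart_def pt_in_open_thick abs_le_iff abs_if split: if_splits)
  qed
qed

text \<open>A crossing whose first strand is the lower one becomes a \<open>crossing\<close> after a quarter turn, which
  exchanges the two smoothings.\<close>

definition quarter_turn :: "point \<Rightarrow> point" where
  "quarter_turn p = vector [- p $ 2, p $ 1, p $ 3]"

definition quarter_turn_inv :: "point \<Rightarrow> point" where
  "quarter_turn_inv p = vector [p $ 2, - p $ 1, p $ 3]"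

definition plane_turn :: "real^2 \<Rightarrow> real^2" where
  "plane_turn v = vector [v $ 2, - v $ 1]"

lemma quarter_turn_nth [simp]:
  "quarter_turn p $ 1 = - p $ 2" "quarter_turn p $ 2 = p $ 1" "quarter_turn p $ 3 = p $ 3"
  by (simp_all add: quarter_turn_def)

lemma quarter_turn_inv_nth [simp]:
  "quarter_turn_inv p $ 1 = p $ 2" "quarter_turn_inv p $ 2 = - p $ 1" "quarter_turn_inv p $ 3 = p $ 3"
  by (simp_all add: quarter_turn_inv_def)

lemma plane_turn_nth [simp]: "plane_turn v $ 1 = v $ 2" "plane_turn v $ 2 = - v $ 1"
  by (simp_all add: plane_turn_def)

lemma quarter_turn_inverse [simp]: "quarter_turn (quarter_turn_inv p) = p" "quarter_turn_inv (quarter_turn p) = p"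
  by (simp_all add: point_eq_iff)

lemma proj_quarter_turn_inv: "proj (quarter_turn_inv p) = plane_turn (proj p)"
  by (simp add: vec_eq_iff forall_2)

lemma quarter_turn_cylinder: "quarter_turn p \<in> cylinder \<longleftrightarrow> p \<in> cylinder" "quarter_turn_inv p \<in> cylinder \<longleftrightarrow> p \<in> cylinder"
  by (auto simp: cylinder_iff add.commute)

lemma quarter_turn_image_cylinder: "quarter_turn ` cylinder = cylinder"
  by (force simp: quarter_turn_cylinder intro: image_eqI[of _ _ "quarter_turn_inv _"])

lemma bounded_linear_quarter_turn: "bounded_linear quarter_turn"
  unfolding linear_conv_bounded_linear[symmetric] by (auto intro!: linearI simp: point_eq_iff)

lemma det_quarter_turn: "det (matrix quarter_turn) = 1"
  by (simp add: det_3 matrix_def axis_def)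

lemma frechet_derivative_compose_quarter_turn:
  assumes "smooth_on cylinder h" "p \<in> cylinder"
  shows "frechet_derivative (\<lambda>p. h (quarter_turn p)) (at p) = (\<lambda>v. frechet_derivative h (at (quarter_turn p)) (quarter_turn v))"
proof -
  have "(h has_derivative frechet_derivative h (at (quarter_turn p))) (at (quarter_turn p))"
    using assms by (intro smooth_on_has_derivative[OF assms(1)]) (simp add: quarter_turn_cylinder)
  from frechet_derivative_at[OF has_derivative_compose[OF bounded_linear_imp_has_derivative[OF bounded_linear_quarter_turn] this]]
  show ?thesis by simp
qed

lemma ball_chart_quarter_turn:
  assumes h: "ball_chart h"
  shows "ball_chart (\<lambda>p. h (quarter_turn p))"
proof -
  have sm: "smooth_on cylinder h" using h by (simp add: ball_chart_def)
  have "smooth_on cylinder (\<lambda>p. h (quarter_turn p))"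
    by (rule smooth_on_compose[OF sm smooth_on_linear[OF bounded_linear_quarter_turn]]) (simp add: quarter_turn_image_cylinder)
  moreover have "inj_on (\<lambda>p. h (quarter_turn p)) cylinder"
    using h unfolding ball_chart_def inj_on_def
    by (metis quarter_turn_cylinder(1) quarter_turn_inverse(2))
  moreover have "det (matrix (frechet_derivative (\<lambda>p. h (quarter_turn p)) (at p))) > 0" if p: "p \<in> cylinder" for p
  proof -
    have "linear (frechet_derivative h (at (quarter_turn p)))"
      using smooth_on_has_derivative[OF sm, of "quarter_turn p"] p by (auto simp: quarter_turn_cylinder has_derivative_linear)
    then have "matrix (\<lambda>v. frechet_derivative h (at (quarter_turn p)) (quarter_turn v))
        = matrix (frechet_derivative h (at (quarter_turn p))) ** matrix quarter_turn"
      using matrix_compose[of quarter_turn "frechet_derivative h (at (quarter_turn p))"] bounded_linear_quarter_turn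
      by (simp add: o_def bounded_linear.linear)
    then show ?thesis
      using h p unfolding frechet_derivative_compose_quarter_turn[OF sm p]
      by (simp add: det_mul det_quarter_turn ball_chart_def quarter_turn_cylinder)
  qed
  moreover have "(\<lambda>p. h (quarter_turn p)) ` cylinder = h ` cylinder"
    using quarter_turn_image_cylinder by (metis image_image)
  ultimately show ?thesis
    using h by (simp add: ball_chart_def)
qed

lemma outside_quarter_turn: "outside (\<lambda>p. h (quarter_turn p)) L = outside h L"
  using quarter_turn_image_cylinder by (simp add: outside_def image_image[of h quarter_turn, symmetric])

text \<open>Precomposing the chart pulls \<open>T\<close> back by the inverse turn; the vertical
  direction is fixed, so the framing condition persists.\<close>

lemma looks_like_quarter_turn:
  assumes h: "ball_chart h" and l: "looks_like h L T"
  shows "looks_like (\<lambda>p. h (quarter_turn p)) L (quarter_turn_inv ` T)"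
proof -
  have sm: "smooth_on cylinder h" using h by (simp add: ball_chart_def)
  have T: "T \<subseteq> cylinder" using l by (simp add: looks_like_def)
  have "(\<lambda>p. h (quarter_turn p)) ` cylinder = h ` cylinder"
    using quarter_turn_image_cylinder by (metis image_image)
  moreover have "quarter_turn vertical = vertical" by (simp add: point_eq_iff axis_def)
  moreover have "quarter_turn_inv p \<in> cylinder" if "p \<in> T" for p using T that by (auto simp: quarter_turn_cylinder)
  ultimately show ?thesis
    using l unfolding looks_like_def
    by (auto simp: image_image frechet_derivative_compose_quarter_turn[OF sm])
qed

lemma crossing_quarter_turn:
  assumes "\<forall>x\<in>{-1..1}. \<bar>f x\<bar> < 1 \<and> \<bar>g x\<bar> < 1" "f 0 < (g 0 :: real)"
    and T: "T = (\<lambda>x. vector [x, 0, f x]) ` {-1..1} \<union> (\<lambda>y. vector [0, y, g y]) ` {-1..1}"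
  shows "crossing (quarter_turn_inv ` T)"
proof -
  have "(\<lambda>x. quarter_turn_inv (vector [x, 0, f x])) ` {-1..1} = (\<lambda>x. vector [0, - x, f (- (- x))]) ` {-1..1}"
    by (simp add: quarter_turn_inv_def)
  also have "\<dots> = (\<lambda>y. vector [0, y, f (- y)]) ` (uminus ` {-1..1})"
    by (simp only: image_image)
  also have "uminus ` {-1..1::real} = {-1..1}" by simp
  finally have "(\<lambda>x. quarter_turn_inv (vector [x, 0, f x])) ` {-1..1} = (\<lambda>y. vector [0, y, f (- y)]) ` {-1..1}" .
  moreover have "(\<lambda>y. quarter_turn_inv (vector [0, y, g y])) ` {-1..1} = (\<lambda>x. vector [x, 0, g x]) ` {-1..1}"
    by (simp add: quarter_turn_inv_def)
  ultimately have eq: "quarter_turn_inv ` T = (\<lambda>x. vector [x, 0, g x]) ` {-1..1} \<union> (\<lambda>y. vector [0, y, f (- y)]) ` {-1..1}"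
    unfolding T image_Un image_image by (simp only: Un_commute)
  \<comment> \<open>The former second strand becomes the overstrand; the former first one becomes
    the understrand with its direction reversed, whence \<open>f (- y)\<close>.\<close>
  show ?thesis
    unfolding crossing_def eq using assms(1,2)
    by (intro exI[of _ g] exI[of _ "\<lambda>y. f (- y)"]) auto
qed

lemma flat_arc_quarter_turn:
  assumes "flat_arc a x y"
  shows "flat_arc (quarter_turn_inv \<circ> a) (plane_turn x) (plane_turn y)"
proof -
  have inj: "inj plane_turn" by (auto intro!: injI simp: vec_eq_iff forall_2)
  have norm: "norm (plane_turn v) = norm v" for v
    by (simp add: norm_vec_def L2_set_def sum_2 add.commute)
  have "linear plane_turn" by (auto intro!: linearI simp: vec_eq_iff forall_2)
  then have c1: "continuous_on UNIV plane_turn" by (simp add: linear_continuous_on linear_conv_bounded_linear)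
  have "linear quarter_turn_inv" by (auto intro!: linearI simp: point_eq_iff)
  then have c2: "continuous_on UNIV quarter_turn_inv" by (simp add: linear_continuous_on linear_conv_bounded_linear)
  have eq: "proj \<circ> (quarter_turn_inv \<circ> a) = plane_turn \<circ> (proj \<circ> a)"
    by (simp add: fun_eq_iff proj_quarter_turn_inv)
  have "path (quarter_turn_inv \<circ> a)"
    using assms by (intro path_continuous_image continuous_on_subset[OF c2]) (auto simp: flat_arc_def)
  moreover have "arc (plane_turn \<circ> (proj \<circ> a))"
    using assms inj unfolding flat_arc_def arc_def
    by (auto intro!: path_continuous_image continuous_on_subset[OF c1] comp_inj_on inj_on_subset[OF inj])
  ultimately show ?thesis
    using assms unfolding flat_arc_def eq by (auto simp: proj_quarter_turn_inv norm dist_norm)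
qed

lemma smoothing_quarter_turn:
  assumes "smoothing x y x' y' T"
  shows "smoothing (plane_turn x) (plane_turn y) (plane_turn x') (plane_turn y') (quarter_turn_inv ` T)"
proof -
  obtain a b where ab: "flat_arc a x y" "flat_arc b x' y'"
      "disjnt (path_image (proj \<circ> a)) (path_image (proj \<circ> b))" "T = path_image a \<union> path_image b"
    using assms unfolding smoothing_def by blast
  have inj: "inj plane_turn" by (auto intro!: injI simp: vec_eq_iff forall_2)
  have "path_image (proj \<circ> (quarter_turn_inv \<circ> c)) = plane_turn ` path_image (proj \<circ> c)" for c
    by (simp add: path_image_def image_comp o_def proj_quarter_turn_inv)
  then have "disjnt (path_image (proj \<circ> (quarter_turn_inv \<circ> a))) (path_image (proj \<circ> (quarter_turn_inv \<circ> b)))"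
    using ab(3) inj by (simp add: disjnt_def image_Int[symmetric])
  moreover have "quarter_turn_inv ` T = path_image (quarter_turn_inv \<circ> a) \<union> path_image (quarter_turn_inv \<circ> b)"
    by (simp add: ab(4) image_Un path_image_compose)
  ultimately show ?thesis
    unfolding smoothing_def using flat_arc_quarter_turn[OF ab(1)] flat_arc_quarter_turn[OF ab(2)] by blast
qed

lemma plane_turn_simps [simp]:
  "plane_turn north = east" "plane_turn east = south" "plane_turn south = west" "plane_turn west = north"
  by (simp_all add: vec_eq_iff forall_2)

lemma flat_arc_reversepath: "flat_arc a x y \<Longrightarrow> flat_arc (reversepath a) y x"
proof -
  assume a: "flat_arc a x y"
  have "proj \<circ> reversepath a = reversepath (proj \<circ> a)"
    by (simp add: reversepath_def fun_eq_iff)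
  then show ?thesis
    using a unfolding flat_arc_def by (auto simp: arc_reversepath) (auto simp: reversepath_def)
qed

text \<open>\<open>smoothing\<close> lists its arcs and their ends in a fixed order. This lemma and
  the next adapt the order to the one required by \<open>skein_triple\<close>.\<close>

lemma smoothing_sym: "smoothing x y x' y' T \<Longrightarrow> smoothing x' y' x y T"
  unfolding smoothing_def by (metis disjnt_sym Un_commute)

lemma smoothing_reverse: "smoothing x y x' y' T \<Longrightarrow> smoothing y x y' x' T"
proof -
  assume "smoothing x y x' y' T"
  then obtain a b where ab: "flat_arc a x y" "flat_arc b x' y'"
      "disjnt (path_image (proj \<circ> a)) (path_image (proj \<circ> b))" "T = path_image a \<union> path_image b"
    unfolding smoothing_def by blast
  have "proj \<circ> reversepath c = reversepath (proj \<circ> c)" for c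
    by (simp add: reversepath_def fun_eq_iff)
  then show ?thesis
    unfolding smoothing_def
    by (intro exI[of _ "reversepath a"] exI[of _ "reversepath b"])
       (use ab in \<open>auto intro: flat_arc_reversepath simp: path_image_reversepath\<close>)
qed

section \<open>The skein triple\<close>

text \<open>What stacking leaves of the unit vertical framing of the circle and the spiral.\<close>

abbreviation framing :: point where "framing \<equiv> (1/4) *\<^sub>R vertical"

definition crossed :: "real \<Rightarrow> int \<Rightarrow> framed_set" where
  "crossed \<sigma> k = stack (\<sigma> * (3/4)) (flat_circle (3/2)) (spiral k)"

text \<open>The circle is parametrised by all real angles and the spiral by its radius, the form in
  which membership is easiest to test.\<close>

lemma crossed_eq:
  "crossed \<sigma> k = range (\<lambda>t. (pt (3/2) t (\<sigma> * (3/4)), framing)) \<union>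
     (\<lambda>r. (pt r (2 * pi * of_int k * wind r) 0, framing)) ` {1..2}"
proof -
  have v: "hmap (1/4) 0 vertical = framing" by (simp add: point_eq_iff axis_def)
  have h: "hmap (1/4) c (pt r t 0) = pt r t c" for c r t by (simp add: point_eq_iff)
  have "push (hmap (1/4) c) (flat_circle (3/2)) = range (\<lambda>t. (pt (3/2) t c, framing))" for c
  proof
    show "push (hmap (1/4) c) (flat_circle (3/2)) \<subseteq> range (\<lambda>t. (pt (3/2) t c, framing))"
      by (auto simp: push_hmap flat_circle_eq h v)
    have "(pt (3/2) t 0, vertical) \<in> flat_circle (3/2)" for t by (simp add: flat_circle_def)
    then show "range (\<lambda>t. (pt (3/2) t c, framing)) \<subseteq> push (hmap (1/4) c) (flat_circle (3/2))"
      unfolding push_hmap by (force simp: h v)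
  qed
  moreover have "push (hmap (1/4) 0) (spiral k) = (\<lambda>r. (pt r (2 * pi * of_int k * wind r) 0, framing)) ` ((+) 1 ` {0..1})"
    unfolding push_squeeze_spiral arc_trace_def polar_curve_def[abs_def] spiral_angle_def image_image by simp
  moreover have "(+) 1 ` {0..1} = {1..2::real}"
    by (simp add: image_add_atLeastAtMost)
  ultimately show ?thesis by (simp add: crossed_def stack_def)
qed

lemma crossed_in_links: "\<bar>\<sigma>\<bar> = 1 \<Longrightarrow> crossed \<sigma> k \<in> links io"
  unfolding crossed_def
  by (rule stack_in_links[OF flat_circle_in_links spiral_in_links]) (auto simp: io_def abs_mult)

section \<open>The smoothed curve in ball coordinates\<close>

text \<open>The coordinates in the model ball of the point with cylindrical coordinates
  \<open>r\<close>, \<open>x\<close>, \<open>z\<close>.\<close>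

definition coord :: "real \<Rightarrow> real \<Rightarrow> real \<Rightarrow> real \<Rightarrow> point" where
  "coord \<sigma> r x z = vector [x, 4 * (r - 3/2), 2 * (z - \<sigma> * (3/8))]"

lemma chart_coord: "chart \<sigma> (coord \<sigma> r x z) = pt r x z"
proof -
  have "3/2 + 4 * (r - 3/2) / 4 = r" "\<sigma> * (3/8) + 2 * (z - \<sigma> * (3/8)) / 2 = z"
    by (simp_all add: field_simps)
  then show ?thesis by (simp only: chart_def coord_def vector_3)
qed

lemma coord_cylinder: "coord \<sigma> r x z \<in> cylinder \<longleftrightarrow> x\<^sup>2 + (4 * (r - 3/2))\<^sup>2 \<le> 1 \<and> \<bar>2 * (z - \<sigma> * (3/8))\<bar> \<le> 1"
  by (simp add: coord_def cylinder_iff)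

lemma pt_in_chart: "coord \<sigma> r x z \<in> cylinder \<Longrightarrow> pt r x z \<in> chart \<sigma> ` cylinder"
  by (metis chart_coord image_eqI)

text \<open>An angle is determined only modulo full turns; \<open>x\<close> is its representative in
  [-1, 1].\<close>

lemma pt_in_chartE:
  assumes "pt r \<theta> z \<in> chart \<sigma> ` cylinder" "r > 0"
  obtains x where "\<bar>x\<bar> \<le> 1" "sin \<theta> = sin x" "cos \<theta> = cos x" "coord \<sigma> r x z \<in> cylinder" "5/4 \<le> r" "r \<le> 7/4"
proof -
  obtain p where p: "p \<in> cylinder" "pt r \<theta> z = chart \<sigma> p" using assms(1) by auto
  then have eq: "r = 3/2 + p $ 2 / 4" "sin \<theta> = sin (p $ 1)" "cos \<theta> = cos (p $ 1)" "z = \<sigma> * (3/8) + p $ 3 / 2"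
    using chart_radius_pos[OF p(1)] assms(2) by (simp_all add: chart_def pt_eq_iff)
  have "coord \<sigma> r (p $ 1) z = p"
    using eq by (simp add: coord_def point_eq_iff)
  with that[of "p $ 1"] eq p(1) cylinder_bounds(1)[OF p(1)] chart_radius_pos[OF p(1)] show ?thesis by simp
qed

lemma frechet_derivative_chart_vertical: "frechet_derivative (chart \<sigma>) (at p) vertical = (1/2) *\<^sub>R vertical"
  by (simp add: frechet_derivative_chart chart_deriv_def point_eq_iff axis_def)

lemma looks_like_chartI:
  assumes "T \<subseteq> cylinder" "fst ` L \<inter> chart \<sigma> ` cylinder = chart \<sigma> ` T" "\<And>p v. (p, v) \<in> L \<Longrightarrow> v = framing"
  shows "looks_like (chart \<sigma>) L T"
  unfolding looks_like_def frechet_derivative_chart_vertical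
proof (intro conjI ballI allI impI assms(1,2))
  fix p v assume "(chart \<sigma> p, v) \<in> L"
  then have "v = (1/2) *\<^sub>R (1/2) *\<^sub>R vertical" using assms(3) by simp
  then show "\<exists>a>0. v = a *\<^sub>R (1/2) *\<^sub>R vertical" by (intro exI[of _ "1/2"]) simp
qed

definition smoothed_point :: "real \<Rightarrow> int \<Rightarrow> int \<Rightarrow> real \<Rightarrow> point" where
  "smoothed_point \<sigma> k d u = pt (radius u) (smoothed_angle k d u) (smoothed_height \<sigma> u)"

lemma smoothed_eq: "smoothed \<sigma> k d = (\<lambda>u. (smoothed_point \<sigma> k d u, framing)) ` {0..1}"
  by (simp add: smoothed_def arc_trace_def polar_curve_def[abs_def] smoothed_point_def)

text \<open>\<open>turn\<close> is 0 or 1 here, so the turn along the circle drops out modulo 2 pi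
  and the point lies exactly on the spiral.\<close>

lemma smoothed_point_ends:
  assumes "u \<le> 1/4 \<or> 3/4 \<le> u"
  shows "smoothed_point \<sigma> k d u = pt (radius u) (2 * pi * of_int k * wind (radius u)) 0"
  using assms pt_add_2pi[of "radius u" "2 * pi * of_int k * wind (radius u)" d 0]
  by (auto simp: smoothed_point_def smoothed_angle_def smoothed_height_def lift_simps)

lemma smoothed_point_mid:
  assumes "1/3 \<le> u" "u \<le> 2/3"
  shows "smoothed_point \<sigma> k d u = pt (3/2) (2 * pi * of_int d * turn u) (\<sigma> * (3/4))"
  using assms pt_add_2pi[of "3/2" "2 * pi * of_int d * turn u" k "\<sigma> * (3/4)"]
  by (simp add: smoothed_point_def smoothed_angle_def smoothed_height_def lift_simps radius_mid add.commute)

text \<open>From radius 5/4 on the winding is complete, and its \<open>k\<close> full turns drop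
  out; what is seen in the ball does not depend on \<open>k\<close>.\<close>

lemma smoothed_point_left:
  assumes "5/4 \<le> radius u"
  shows "smoothed_point \<sigma> k d u = pt (radius u) (2 * pi * of_int d * turn u) (smoothed_height \<sigma> u)"
  using assms pt_add_2pi[of "radius u" "2 * pi * of_int d * turn u" k "smoothed_height \<sigma> u"]
  by (simp add: smoothed_point_def smoothed_angle_def add.commute)

lemma smoothed_point_right:
  assumes "radius u \<le> 7/4"
  shows "smoothed_point \<sigma> k d (1 - u) = pt (3 - radius u) (- (2 * pi * of_int d * turn u)) (smoothed_height \<sigma> u)"
proof -
  have "smoothed_angle k d (1 - u) = - (2 * pi * of_int d * turn u) + 2 * pi * of_int (k + d)"
    using assms by (simp add: smoothed_angle_def radius_reflect turn_reflect algebra_simps)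
  then have "smoothed_point \<sigma> k d (1 - u) = pt (3 - radius u) (- (2 * pi * of_int d * turn u) + 2 * pi * of_int (k + d)) (smoothed_height \<sigma> u)"
    by (simp only: smoothed_point_def radius_reflect) (simp add: smoothed_height_def lift_reflect)
  then show ?thesis by (simp only: pt_add_2pi)
qed

text \<open>In ball coordinates, \<open>\<epsilon> = 1\<close> describes the first half of the curve
  and \<open>\<epsilon> = -1\<close> the second half run backwards; their shadows are exchanged by
  the point reflection of the disc.\<close>

definition strand :: "real \<Rightarrow> real \<Rightarrow> int \<Rightarrow> real \<Rightarrow> point" where
  "strand \<epsilon> \<sigma> d u = vector [\<epsilon> * (2 * pi * of_int d * turn u), \<epsilon> * (4 * (radius u - 3/2)),
     2 * (smoothed_height \<sigma> u - \<sigma> * (3/8))]"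

lemma chart_strand:
  "5/4 \<le> radius u \<Longrightarrow> chart \<sigma> (strand 1 \<sigma> d u) = smoothed_point \<sigma> k d u"
  "radius u \<le> 7/4 \<Longrightarrow> chart \<sigma> (strand (-1) \<sigma> d u) = smoothed_point \<sigma> k d (1 - u)"
proof -
  assume "5/4 \<le> radius u"
  moreover have "strand 1 \<sigma> d u = coord \<sigma> (radius u) (2 * pi * of_int d * turn u) (smoothed_height \<sigma> u)"
    by (simp add: strand_def coord_def)
  ultimately show "chart \<sigma> (strand 1 \<sigma> d u) = smoothed_point \<sigma> k d u"
    by (simp only: chart_coord smoothed_point_left)
next
  assume "radius u \<le> 7/4"
  moreover have "strand (-1) \<sigma> d u = coord \<sigma> (3 - radius u) (- (2 * pi * of_int d * turn u)) (smoothed_height \<sigma> u)"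
    by (simp add: strand_def coord_def)
  ultimately show "chart \<sigma> (strand (-1) \<sigma> d u) = smoothed_point \<sigma> k d (1 - u)"
    by (simp only: chart_coord smoothed_point_right)
qed

lemma smoothed_height_bound: "\<bar>\<sigma>\<bar> = 1 \<Longrightarrow> \<bar>2 * (smoothed_height \<sigma> u - \<sigma> * (3/8))\<bar> \<le> 3/4"
proof -
  assume \<sigma>: "\<bar>\<sigma>\<bar> = 1"
  have "2 * (smoothed_height \<sigma> u - \<sigma> * (3/8)) = \<sigma> * (3/2 * lift u - 3/4)"
    by (simp add: smoothed_height_def algebra_simps)
  then have "\<bar>2 * (smoothed_height \<sigma> u - \<sigma> * (3/8))\<bar> = \<bar>3/2 * lift u - 3/4\<bar>"
    using \<sigma> by (simp add: abs_mult)
  also have "\<dots> \<le> 3/4" using lift_bounds[of u] by (intro abs_leI) simp_all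
  finally show ?thesis .
qed

lemma turn_near: "u \<le> 1/3 \<Longrightarrow> 0 \<le> 2 * pi * turn u \<and> 2 * pi * turn u \<le> 4/5"
proof -
  assume "u \<le> 1/3"
  then have "2 * pi * turn u \<le> 2 * pi * turn (1/3)" by (intro mult_left_mono turn_mono) auto
  from order_trans[OF this turn_third] show ?thesis using turn_bounds by simp
qed

lemma power2_of_int_unit: "\<bar>d\<bar> = 1 \<Longrightarrow> (of_int d :: real)\<^sup>2 = 1"
  by (cases "d = 1"; cases "d = -1") auto

text \<open>On the rounded corner the angle is at most 4/5 and the scaled radius at most 1/5, and
  16/25 + 1/25 < 1.\<close>

lemma near_in_disc:
  assumes "1/4 \<le> u" "u \<le> 1/3"
  shows "(2 * pi * turn u)\<^sup>2 + (4 * (radius u - 3/2))\<^sup>2 < 1"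
proof -
  have "(2 * pi * turn u)\<^sup>2 \<le> (4/5)\<^sup>2"
    using turn_near[of u] assms by (intro power_mono) auto
  moreover have "(4 * (radius u - 3/2))\<^sup>2 \<le> (1/5)\<^sup>2"
    using radius_near[of u] assms by (simp only: power2_le_iff_abs_le)
  ultimately have "(2 * pi * turn u)\<^sup>2 + (4 * (radius u - 3/2))\<^sup>2 \<le> (4/5)\<^sup>2 + (1/5)\<^sup>2"
    by (rule add_mono)
  also have "\<dots> < 1" by (simp add: power2_eq_square)
  finally show ?thesis .
qed

section \<open>Comparison of the links outside and inside the ball\<close>

text \<open>With \<open>cos_ge_cos_1\<close>, the cosine alone tells the angles of the ball from
  those of the remaining part of the circle, in either direction of travel.\<close>

lemma cos_less_cos_1:
  assumes "1 < x" "x < 2 * pi - 1"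
  shows "cos x < cos 1"
proof (cases "x \<le> pi")
  case True
  then show ?thesis using assms by (intro cos_monotone_0_pi) auto
next
  case False
  have "cos (2 * pi - x) < cos 1" using assms False by (intro cos_monotone_0_pi) auto
  then show ?thesis by (simp add: cos_diff)
qed

lemma cos_ge_cos_1: "\<bar>x\<bar> \<le> 1 \<Longrightarrow> cos 1 \<le> cos (x::real)"
  using cos_monotone_0_pi_le[of "\<bar>x\<bar>" 1] pi_gt3 by (simp add: cos_abs_real)

lemma continuous_on_radius: "continuous_on S radius"
  using smooth_on_continuous_on[OF smooth_on_radius] continuous_on_subset by blast

lemma continuous_on_turn: "continuous_on S turn"
  using smooth_on_continuous_on[OF smooth_on_turn] continuous_on_subset by blast

lemma continuous_on_smoothed_height: "continuous_on S (smoothed_height \<sigma>)"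
  using smooth_on_continuous_on[OF smooth_on_smoothed_height] continuous_on_subset by blast

lemma radius_quarter: "5/4 \<le> radius (1/4)"
proof -
  have "\<bar>4 * (radius (1/4) - 3/2)\<bar> \<le> 1/5" by (rule radius_near) auto
  from abs_le_D2[OF this] show ?thesis by simp
qed

text \<open>The smoothed curve lies on the spiral over [0, 1/4] and [3/4, 1], on the circle over
  [1/3, 2/3], and in the ball in between. Conversely, a point of the circle outside the ball is
  reached by the intermediate value theorem for \<open>turn\<close>, and a point of the spiral by
  that for \<open>radius\<close>.\<close>

lemma outside_crossed_eq:
  assumes \<sigma>: "\<bar>\<sigma>\<bar> = 1" and d: "\<bar>d\<bar> = 1"
  shows "outside (chart \<sigma>) (crossed \<sigma> k) = outside (chart \<sigma>) (smoothed \<sigma> k d)"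
proof -
  let ?m = "smoothed_point \<sigma> k d" and ?B = "chart \<sigma> ` cylinder"
  let ?W = "\<lambda>r. pt r (2 * pi * of_int k * wind r) 0"
  have d2: "(of_int d :: real)\<^sup>2 = 1" using d by (rule power2_of_int_unit)
  have \<sigma>h: "\<bar>2 * (smoothed_height \<sigma> u - \<sigma> * (3/8))\<bar> \<le> 1" for u
    using smoothed_height_bound[OF \<sigma>, of u] by linarith
  have ball_left: "?m u \<in> ?B" if "1/4 \<le> u" "u \<le> 1/3" for u
  proof -
    have r: "5/4 \<le> radius u" using radius_quarter radius_mono[OF that(1)] by linarith
    show ?thesis unfolding smoothed_point_left[OF r]
      using near_in_disc[OF that] \<sigma>h d2 by (intro pt_in_chart) (simp add: coord_cylinder power_mult_distrib)
  qed
  have ball_right: "?m (1 - u) \<in> ?B" if "1/4 \<le> u" "u \<le> 1/3" for u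
  proof -
    have r: "radius u \<le> 7/4" using radius_mono[OF that(2)] radius_mid[of "1/3"] by simp
    have "(4 * (3 - radius u - 3/2))\<^sup>2 = (4 * (radius u - 3/2))\<^sup>2" by (simp add: power2_eq_square algebra_simps)
    then show ?thesis unfolding smoothed_point_right[OF r]
      using near_in_disc[OF that] \<sigma>h d2 by (intro pt_in_chart) (simp add: coord_cylinder power_mult_distrib)
  qed
  have sh: "sin (x - 2 * pi) = sin x" "cos (x - 2 * pi) = cos x" for x :: real
    by (simp_all add: sin_diff cos_diff)
  have circle: "\<exists>u\<in>{0..1}. pt (3/2) t (\<sigma> * (3/4)) = ?m u" if out: "pt (3/2) t (\<sigma> * (3/4)) \<notin> ?B" for t
  proof -
    obtain t0 where t0: "0 \<le> t0" "t0 < 2 * pi" "cos t = cos t0" "sin t = sin t0"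
      using sincos_total_2pi[of "cos t" "sin t"] by auto
    have eq: "pt (3/2) t (\<sigma> * (3/4)) = pt (3/2) t0 (\<sigma> * (3/4))" using t0 by (intro pt_cong) auto
    have in_ball: "pt (3/2) x (\<sigma> * (3/4)) \<in> ?B" if "\<bar>x\<bar> \<le> 1" for x
      using that \<sigma> by (intro pt_in_chart) (auto simp: coord_cylinder abs_square_le_1 abs_mult)
    have t1: "1 < t0"
      using in_ball[of t0] out t0(1) unfolding eq by auto
    \<comment> \<open>The ball extends to both sides of angle 0, so the representative just below 0
      has to be excluded as well.\<close>
    have "pt (3/2) (t0 - 2 * pi) (\<sigma> * (3/4)) = pt (3/2) t0 (\<sigma> * (3/4))" by (intro pt_cong sh)
    then have t2: "t0 < 2 * pi - 1"
      using in_ball[of "t0 - 2 * pi"] out t0(2) unfolding eq by force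
    \<comment> \<open>The value of \<open>turn\<close> at which a traversal in direction
      \<open>d\<close> passes the angle \<open>t0\<close>.\<close>
    define q where "q = (if d = 1 then t0 / (2 * pi) else 1 - t0 / (2 * pi))"
    \<comment> \<open>The values of \<open>turn\<close> not taken on [1/3, 2/3] belong to angles
      within the ball, so \<open>q\<close> is taken.\<close>
    have "turn (1/3) \<le> 1 / (2 * pi)" using turn_third by (simp add: field_simps)
    moreover have "1 / (2 * pi) \<le> t0 / (2 * pi)" "1 / (2 * pi) \<le> 1 - t0 / (2 * pi)"
      using t1 t2 by (simp_all add: field_simps)
    ultimately have b: "turn (1/3) \<le> q" "q \<le> 1 - turn (1/3)" by (auto simp: q_def)
    have "1 - turn (1/3) = turn (2/3)" using turn_reflect[of "1/3"] by simp
    then obtain u where u: "1/3 \<le> u" "u \<le> 2/3" "turn u = q"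
      using IVT'[of turn "1/3" q "2/3"] b continuous_on_turn by auto
    have "?m u = pt (3/2) t0 (\<sigma> * (3/4))"
    proof (cases "d = 1")
      case True
      then show ?thesis using u t0 by (simp add: smoothed_point_mid q_def)
    next
      case False
      then have "d = -1" using d by auto
      moreover have "2 * pi * (1 - t0 / (2 * pi)) = 2 * pi - t0" by (simp add: field_simps)
      ultimately have "?m u = pt (3/2) (t0 - 2 * pi) (\<sigma> * (3/4))"
        using u by (simp add: smoothed_point_mid q_def)
      also have "\<dots> = pt (3/2) t0 (\<sigma> * (3/4))" by (intro pt_cong sh)
      finally show ?thesis .
    qed
    then show ?thesis using u eq by (intro bexI[of _ u]) auto
  qed
  have arc: "\<exists>u\<in>{0..1}. ?W r = ?m u" if r12: "r \<in> {1..2}" and out: "?W r \<notin> ?B" for r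
  proof -
    have "r < 5/4 \<or> 7/4 < r"
    proof (rule ccontr)
      assume "\<not> (r < 5/4 \<or> 7/4 < r)"
      then have r: "5/4 \<le> r" "r \<le> 7/4" by auto
      then have "?W r = pt r 0 0" by (intro pt_cong) (simp_all add: sin_int_2pin cos_int_2pin)
      moreover have "(4 * (r - 3/2))\<^sup>2 \<le> 1" using r by (simp add: abs_square_le_1 abs_le_iff)
      then have "pt r 0 0 \<in> ?B" using \<sigma> by (intro pt_in_chart) (simp add: coord_cylinder abs_mult)
      ultimately show False using out by simp
    qed
    then show ?thesis
    proof
      assume "r < 5/4"
      then obtain u where "0 \<le> u" "u \<le> 1/4" "radius u = r"
        using IVT'[of radius 0 r "1/4"] r12 radius_0 radius_quarter continuous_on_radius by auto
      then show ?thesis by (intro bexI[of _ u]) (auto simp: smoothed_point_ends)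
    next
      assume "7/4 < r"
      moreover have "radius (3/4) \<le> 7/4" using radius_reflect[of "1/4"] radius_quarter by simp
      ultimately obtain u where "3/4 \<le> u" "u \<le> 1" "radius u = r"
        using IVT'[of radius "3/4" r 1] r12 radius_1 continuous_on_radius by auto
      then show ?thesis by (intro bexI[of _ u]) (auto simp: smoothed_point_ends)
    qed
  qed
  have conv: "(\<exists>t. ?m u = pt (3/2) t (\<sigma> * (3/4))) \<or> (\<exists>r\<in>{1..2}. ?m u = ?W r)" if "u \<in> {0..1}" "?m u \<notin> ?B" for u
  proof -
    consider "u \<le> 1/4 \<or> 3/4 \<le> u" | "1/4 \<le> u \<and> u \<le> 1/3" | "1/3 \<le> u \<and> u \<le> 2/3" | "2/3 \<le> u \<and> u \<le> 3/4"
      using that by force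
    then show ?thesis
    proof cases
      case 1
      then show ?thesis using smoothed_point_ends[OF 1] radius_pos[OF that(1)] by auto
    next
      case 2
      then show ?thesis using ball_left[of u] that by simp
    next
      case 3
      then show ?thesis using smoothed_point_mid by blast
    next
      case 4
      then show ?thesis using ball_right[of "1 - u"] that by simp
    qed
  qed
  show ?thesis
  proof
    show "outside (chart \<sigma>) (crossed \<sigma> k) \<subseteq> outside (chart \<sigma>) (smoothed \<sigma> k d)"
      unfolding outside_def crossed_eq smoothed_eq using circle arc by (auto simp: image_iff)
    show "outside (chart \<sigma>) (smoothed \<sigma> k d) \<subseteq> outside (chart \<sigma>) (crossed \<sigma> k)"
      unfolding outside_def crossed_eq smoothed_eq using conv by fastforce
  qed
qed

text \<open>Centring at \<open>\<sigma> * (3/8)\<close> and doubling turns the strand heights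
  \<open>\<sigma> * (3/4)\<close> and 0 into plus and minus \<open>\<sigma> * (3/4)\<close>. In the
  ball \<open>wind\<close> is 1, so the spiral runs radially at angle 0.\<close>

lemma looks_like_crossed:
  assumes \<sigma>: "\<bar>\<sigma>\<bar> = 1"
  shows "looks_like (chart \<sigma>) (crossed \<sigma> k)
    ((\<lambda>x. vector [x, 0, \<sigma> * (3/4)]) ` {-1..1} \<union> (\<lambda>y. vector [0, y, - (\<sigma> * (3/4))]) ` {-1..1})"
    (is "looks_like _ _ (?X \<union> ?Y)")
proof (rule looks_like_chartI)
  have X: "chart \<sigma> (vector [x, 0, \<sigma> * (3/4)]) = pt (3/2) x (\<sigma> * (3/4))" for x
    by (simp add: chart_def mult.commute)
  have Y: "chart \<sigma> (vector [0, y, - (\<sigma> * (3/4))]) = pt (3/2 + y/4) (2 * pi * of_int k * wind (3/2 + y/4)) 0" if "y \<in> {-1..1}" for y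
  proof -
    have "wind (3/2 + y/4) = 1" using that by (intro wind_simps) auto
    then have "pt (3/2 + y/4) 0 0 = pt (3/2 + y/4) (2 * pi * of_int k * wind (3/2 + y/4)) 0"
      by (intro pt_cong) (simp_all add: sin_int_2pin cos_int_2pin)
    then show ?thesis by (simp add: chart_def)
  qed
  show T: "?X \<union> ?Y \<subseteq> cylinder"
    using \<sigma> by (auto simp: cylinder_iff abs_mult abs_square_le_1 abs_le_iff)
  have fst: "fst ` crossed \<sigma> k = range (\<lambda>t. pt (3/2) t (\<sigma> * (3/4))) \<union> (\<lambda>r. pt r (2 * pi * of_int k * wind r) 0) ` {1..2}"
    by (simp add: crossed_eq image_Un image_image)
  show "fst ` crossed \<sigma> k \<inter> chart \<sigma> ` cylinder = chart \<sigma> ` (?X \<union> ?Y)"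
  proof
    show "chart \<sigma> ` (?X \<union> ?Y) \<subseteq> fst ` crossed \<sigma> k \<inter> chart \<sigma> ` cylinder"
    proof
      fix q assume q: "q \<in> chart \<sigma> ` (?X \<union> ?Y)"
      then have "q \<in> chart \<sigma> ` cylinder" using T by blast
      moreover have "q \<in> fst ` crossed \<sigma> k"
        using q unfolding fst image_Un image_image X
      proof
        assume "q \<in> (\<lambda>y. chart \<sigma> (vector [0, y, - (\<sigma> * (3/4))])) ` {-1..1}"
        then obtain y where y: "y \<in> {-1..1}" "q = chart \<sigma> (vector [0, y, - (\<sigma> * (3/4))])" by auto
        have "3/2 + y/4 \<in> {1..2}" using y by auto
        then show "q \<in> range (\<lambda>t. pt (3/2) t (\<sigma> * (3/4))) \<union> (\<lambda>r. pt r (2 * pi * of_int k * wind r) 0) ` {1..2}"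
          unfolding y(2) Y[OF y(1)] by blast
      qed blast
      ultimately show "q \<in> fst ` crossed \<sigma> k \<inter> chart \<sigma> ` cylinder" by blast
    qed
    show "fst ` crossed \<sigma> k \<inter> chart \<sigma> ` cylinder \<subseteq> chart \<sigma> ` (?X \<union> ?Y)"
    proof
      fix q assume q: "q \<in> fst ` crossed \<sigma> k \<inter> chart \<sigma> ` cylinder"
      then consider t where "q = pt (3/2) t (\<sigma> * (3/4))"
        | r where "r \<in> {1..2}" "q = pt r (2 * pi * of_int k * wind r) 0" unfolding fst by auto
      then show "q \<in> chart \<sigma> ` (?X \<union> ?Y)"
      proof cases
        case 1
        then have "pt (3/2) t (\<sigma> * (3/4)) \<in> chart \<sigma> ` cylinder" using q by blast
        then obtain x where x: "\<bar>x\<bar> \<le> 1" "sin t = sin x" "cos t = cos x"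
          by (rule pt_in_chartE) auto
        then have "q = chart \<sigma> (vector [x, 0, \<sigma> * (3/4)])" unfolding X 1 by (intro pt_cong)
        then show ?thesis using x(1) by (auto simp: abs_le_iff)
      next
        case 2
        then have "pt r (2 * pi * of_int k * wind r) 0 \<in> chart \<sigma> ` cylinder" using q by blast
        then have "5/4 \<le> r" "r \<le> 7/4" by (rule pt_in_chartE; use 2 in auto)+
        then have y: "4 * (r - 3/2) \<in> {-1..1}" by auto
        have "q = chart \<sigma> (vector [0, 4 * (r - 3/2), - (\<sigma> * (3/4))])"
        proof -
          have "3/2 + 4 * (r - 3/2) / 4 = r" by (simp add: field_simps)
          then show ?thesis unfolding Y[OF y] 2(2) by (simp only:)
        qed
        then show ?thesis using y by blast
      qed
    qed
  qed
qed (auto simp: crossed_eq)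

text \<open>The parameters at which the smoothed curve enters the ball (radially) and leaves it (along the circle).\<close>

lemma smoothed_enters_ball: obtains \<alpha> where "0 < \<alpha>" "\<alpha> \<le> 1/4" "radius \<alpha> = 5/4"
proof -
  obtain a where "0 \<le> a" "a \<le> 1/4" "radius a = 5/4"
    using IVT'[of radius 0 "5/4" "1/4"] radius_0 radius_quarter continuous_on_radius by auto
  then show ?thesis using that[of a] radius_0 by (cases "a = 0") auto
qed

lemma smoothed_leaves_ball: obtains \<beta> where "1/3 < \<beta>" "\<beta> < 1/2" "2 * pi * turn \<beta> = 1"
proof -
  have "turn (1/3) \<le> 1 / (2 * pi)" using turn_third by (simp add: field_simps)
  moreover have "1 / (2 * pi) < turn (1/2)" using pi_gt3 by (simp add: turn_half field_simps)
  ultimately obtain b where b: "1/3 \<le> b" "b \<le> 1/2" "turn b = 1 / (2 * pi)"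
    using IVT'[of turn "1/3" "1 / (2 * pi)" "1/2"] continuous_on_turn by auto
  have "b \<noteq> 1/3"
  proof
    assume "b = 1/3"
    then have "2 * pi * turn (1/3) = 1" using b(3) unfolding \<open>b = 1/3\<close> by simp
    then show False using turn_third by simp
  qed
  moreover have "b \<noteq> 1/2"
  proof
    assume "b = 1/2"
    then have "2 * pi * turn (1/2) = 1" using b(3) unfolding \<open>b = 1/2\<close> by simp
    then show False using pi_gt3 by (simp add: turn_half)
  qed
  ultimately show ?thesis using that[of b] b by auto
qed

context
  fixes \<alpha> \<beta> \<sigma> :: real and d :: int
  assumes \<alpha>: "0 < \<alpha>" "\<alpha> \<le> 1/4" "radius \<alpha> = 5/4"
    and \<beta>: "1/3 < \<beta>" "\<beta> < 1/2" "2 * pi * turn \<beta> = 1"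
    and \<sigma>: "\<bar>\<sigma>\<bar> = 1" and d: "\<bar>d\<bar> = 1"
begin

lemma radius_range: "u \<in> {\<alpha>..\<beta>} \<Longrightarrow> 5/4 \<le> radius u \<and> radius u \<le> 3/2"
  using radius_mono[of \<alpha> u] radius_mono[of u "1/2"] radius_mid[of "1/2"] \<alpha> \<beta> by auto

text \<open>Up to 1/4 only the radius moves and from 1/3 on only the angle, so a single square has
  to be bounded; the corner in between is \<open>near_in_disc\<close>.\<close>

lemma strand_disc:
  assumes u: "u \<in> {\<alpha>..\<beta>}"
  shows "(2 * pi * turn u)\<^sup>2 + (4 * (radius u - 3/2))\<^sup>2 \<le> 1"
    and "u \<noteq> \<alpha> \<Longrightarrow> u \<noteq> \<beta> \<Longrightarrow> (2 * pi * turn u)\<^sup>2 + (4 * (radius u - 3/2))\<^sup>2 < 1"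
proof -
  consider "u \<le> 1/4" | "1/4 \<le> u" "u \<le> 1/3" | "1/3 \<le> u" by linarith
  then have "(2 * pi * turn u)\<^sup>2 + (4 * (radius u - 3/2))\<^sup>2 \<le> 1 \<and>
      (u \<noteq> \<alpha> \<longrightarrow> u \<noteq> \<beta> \<longrightarrow> (2 * pi * turn u)\<^sup>2 + (4 * (radius u - 3/2))\<^sup>2 < 1)"
  proof cases
    case 1
    have "\<bar>4 * (radius u - 3/2)\<bar> \<le> 1" using radius_range[OF u] by (simp add: abs_le_iff)
    moreover have "\<bar>4 * (radius u - 3/2)\<bar> < 1" if "u \<noteq> \<alpha>"
      using radius_range[OF u] radius_strict_mono_left[of \<alpha> u] \<alpha> u that by (simp add: abs_less_iff)
    ultimately show ?thesis using 1 by (simp add: abs_square_le_1 abs_square_less_1)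
  next
    case 2
    then show ?thesis using near_in_disc[of u] by simp
  next
    case 3
    have r: "radius u = 3/2" using 3 u \<beta> by (intro radius_mid) auto
    have "2 * pi * turn u \<le> 2 * pi * turn \<beta>" using u by (intro mult_left_mono turn_mono) auto
    moreover have "2 * pi * turn u < 2 * pi * turn \<beta>" if "u \<noteq> \<beta>"
      using u that \<beta> by (intro mult_strict_left_mono turn_strict_mono) auto
    moreover have "0 \<le> 2 * pi * turn u" using turn_bounds by simp
    ultimately show ?thesis unfolding r using \<beta>(3) by (auto simp: abs_square_le_1 abs_square_less_1)
  qed
  then show "(2 * pi * turn u)\<^sup>2 + (4 * (radius u - 3/2))\<^sup>2 \<le> 1"
    and "u \<noteq> \<alpha> \<Longrightarrow> u \<noteq> \<beta> \<Longrightarrow> (2 * pi * turn u)\<^sup>2 + (4 * (radius u - 3/2))\<^sup>2 < 1" by auto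
qed

lemma strand_norm:
  assumes "\<bar>\<epsilon>\<bar> = 1"
  shows "(norm (proj (strand \<epsilon> \<sigma> d u)))\<^sup>2 = (2 * pi * turn u)\<^sup>2 + (4 * (radius u - 3/2))\<^sup>2"
proof -
  have e: "\<epsilon>\<^sup>2 = 1" using assms by (metis power2_abs one_power2)
  show ?thesis
    unfolding norm_proj by (simp add: strand_def power_mult_distrib e power2_of_int_unit[OF d])
qed

lemma strand_cylinder: "\<bar>\<epsilon>\<bar> = 1 \<Longrightarrow> u \<in> {\<alpha>..\<beta>} \<Longrightarrow> strand \<epsilon> \<sigma> d u \<in> cylinder"
  using strand_norm[of \<epsilon> u] strand_disc(1)[of u] smoothed_height_bound[OF \<sigma>, of u]
  by (auto simp: cylinder_iff norm_proj) (simp add: strand_def)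

definition strand_path :: "real \<Rightarrow> real \<Rightarrow> point" where
  "strand_path \<epsilon> v = strand \<epsilon> \<sigma> d ((1 - v) * \<alpha> + v * \<beta>)"

lemma strand_param_image: "(\<lambda>v. (1 - v) * \<alpha> + v * \<beta>) ` {0..1} = {\<alpha>..\<beta>}"
proof -
  have "(\<lambda>v. (1 - v) * \<alpha> + v * \<beta>) ` {0..1} = closed_segment \<alpha> \<beta>"
    by (auto simp: closed_segment_def)
  also have "\<dots> = {\<alpha>..\<beta>}" using \<alpha> \<beta> by (simp add: closed_segment_eq_real_ivl)
  finally show ?thesis .
qed

lemma path_image_strand: "path_image (strand_path \<epsilon>) = strand \<epsilon> \<sigma> d ` {\<alpha>..\<beta>}"
  unfolding path_image_def strand_path_def strand_param_image[symmetric] image_image ..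

lemma strand_inj:
  assumes "\<bar>\<epsilon>\<bar> = 1"
  shows "inj_on (\<lambda>u. proj (strand \<epsilon> \<sigma> d u)) {\<alpha>..\<beta>}"
proof (rule linorder_inj_onI')
  fix u v assume uv: "u \<in> {\<alpha>..\<beta>}" "v \<in> {\<alpha>..\<beta>}" "u < v"
  have nz: "\<epsilon> \<noteq> 0" "d \<noteq> 0" using assms d by auto
  show "proj (strand \<epsilon> \<sigma> d u) \<noteq> proj (strand \<epsilon> \<sigma> d v)"
  proof
    assume "proj (strand \<epsilon> \<sigma> d u) = proj (strand \<epsilon> \<sigma> d v)"
    then have "turn u = turn v" "radius u = radius v"
      using nz by (auto simp: vec_eq_iff forall_2 strand_def)
    then show False
      using radius_strict_mono_left[OF uv(3)] turn_strict_mono[OF uv(3)] uv \<beta> by (cases "u < 1/3") auto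
  qed
qed

text \<open>At \<open>\<alpha>\<close> the second coordinate is 4 (5/4 - 3/2) = -1 and no turning
  has begun; at \<open>\<beta>\<close> the radius is 3/2 and the angle is \<open>d\<close>. The sign
  \<open>\<epsilon>\<close> reflects both ends.\<close>

lemma flat_arc_strand:
  assumes e: "\<bar>\<epsilon>\<bar> = 1"
  shows "flat_arc (strand_path \<epsilon>) (vector [0, - \<epsilon>]) (vector [\<epsilon> * of_int d, 0])"
proof -
  let ?g = "\<lambda>v. (1 - v) * \<alpha> + v * \<beta>"
  have ab: "\<alpha> < \<beta>" using \<alpha> \<beta> by linarith
  have g: "?g v \<in> {\<alpha>..\<beta>}" if "v \<in> {0..1}" for v using strand_param_image that by blast
  have g0: "?g v \<noteq> \<alpha> \<and> ?g v \<noteq> \<beta>" if "v \<in> {0<..<1}" for v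
  proof -
    have e: "?g v - \<alpha> = v * (\<beta> - \<alpha>)" "\<beta> - ?g v = (1 - v) * (\<beta> - \<alpha>)" by (simp_all add: algebra_simps)
    have "0 < ?g v - \<alpha>" "0 < \<beta> - ?g v" unfolding e using that ab by auto
    then show ?thesis by (metis diff_self less_irrefl)
  qed
  have ginj: "inj_on ?g {0..1}"
  proof (rule linorder_inj_onI')
    fix u v :: real assume "u < v"
    then have "(v - u) * (\<beta> - \<alpha>) > 0" using ab by simp
    then show "?g u \<noteq> ?g v" by (simp add: algebra_simps)
  qed
  have cont: "continuous_on S (strand \<epsilon> \<sigma> d)" for S
    unfolding strand_def[abs_def] vector3_eq_axis
    by (intro continuous_intros continuous_on_turn continuous_on_radius continuous_on_smoothed_height)
  have path: "path (strand_path \<epsilon>)"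
    unfolding path_def strand_path_def[abs_def]
    by (rule continuous_on_compose2[OF cont[of UNIV]]) (auto intro!: continuous_intros)
  have "continuous_on UNIV proj"
  proof -
    have "linear proj" by (auto intro!: linearI simp: vec_eq_iff forall_2)
    then show ?thesis by (simp add: linear_continuous_on linear_conv_bounded_linear)
  qed
  then have "path (proj \<circ> strand_path \<epsilon>)"
    by (rule path_continuous_image[OF path continuous_on_subset]) simp
  moreover have "inj_on (proj \<circ> strand_path \<epsilon>) {0..1}"
  proof -
    have "inj_on ((\<lambda>u. proj (strand \<epsilon> \<sigma> d u)) \<circ> ?g) {0..1}"
      using strand_inj[OF e] ginj by (intro comp_inj_on) (simp_all add: strand_param_image)
    then show ?thesis by (simp add: strand_path_def[abs_def] o_def)
  qed
  ultimately have "arc (proj \<circ> strand_path \<epsilon>)" by (simp add: arc_def)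
  moreover have "proj (strand_path \<epsilon> 0) = vector [0, - \<epsilon>]"
    using \<alpha>(2) by (simp add: strand_path_def strand_def vec_eq_iff forall_2 \<alpha>(3))
  moreover have "proj (strand_path \<epsilon> 1) = vector [\<epsilon> * of_int d, 0]"
  proof -
    have "2 * pi * of_int d * turn \<beta> = of_int d * (2 * pi * turn \<beta>)" by simp
    moreover have "radius \<beta> = 3/2" using \<beta> by (intro radius_mid) auto
    ultimately show ?thesis
      using \<beta>(3) by (simp add: strand_path_def strand_def vec_eq_iff forall_2)
  qed
  moreover have "proj (strand_path \<epsilon> v) \<in> ball 0 1" if "v \<in> {0<..<1}" for v
  proof -
    have "v \<in> {0..1}" using that by auto
    then have "(norm (proj (strand_path \<epsilon> v)))\<^sup>2 < 1\<^sup>2"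
      using strand_norm[OF e] strand_disc(2)[OF g[of v]] g0[OF that] by (simp add: strand_path_def)
    then have "norm (proj (strand_path \<epsilon> v)) < 1" by (rule power2_less_imp_less) simp
    then show ?thesis by simp
  qed
  moreover have "\<bar>strand_path \<epsilon> v $ 3\<bar> < 1" for v
    using smoothed_height_bound[OF \<sigma>, of "(1 - v) * \<alpha> + v * \<beta>"] by (simp add: strand_path_def strand_def)
  ultimately show ?thesis
    using path unfolding flat_arc_def by simp
qed

text \<open>The two shadows lie in opposite closed half discs, so they could meet only at the radius
  of the circle. There \<open>turn\<close> is positive and the two angles have opposite
  signs.\<close>

lemma smoothing_strands:
  "smoothing (vector [0, 1]) (vector [- of_int d, 0]) (vector [0, -1]) (vector [of_int d, 0])
     (strand (-1) \<sigma> d ` {\<alpha>..\<beta>} \<union> strand 1 \<sigma> d ` {\<alpha>..\<beta>})"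
proof -
  have "path_image (proj \<circ> strand_path \<epsilon>) = (\<lambda>u. proj (strand \<epsilon> \<sigma> d u)) ` {\<alpha>..\<beta>}" for \<epsilon>
    by (simp add: path_image_compose path_image_strand image_image)
  moreover have "proj (strand (-1) \<sigma> d u) \<noteq> proj (strand 1 \<sigma> d v)" if uv: "u \<in> {\<alpha>..\<beta>}" "v \<in> {\<alpha>..\<beta>}" for u v
  proof
    assume "proj (strand (-1) \<sigma> d u) = proj (strand 1 \<sigma> d v)"
    then have eq: "- (2 * pi * of_int d * turn u) = 2 * pi * of_int d * turn v" "- (4 * (radius u - 3/2)) = 4 * (radius v - 3/2)"
      by (simp_all add: vec_eq_iff forall_2 strand_def)
    have "radius u = 3/2" using eq(2) radius_range[OF uv(1)] radius_range[OF uv(2)] by simp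
    then have "1/3 \<le> u" using radius_strict_mono_left[of u "1/3"] radius_mid[of "1/3"] by force
    then have "0 < turn u" using turn_strict_mono[of 0 u] uv(1) \<beta> by auto
    moreover have "2 * pi * of_int d * (turn u + turn v) = 0" using eq(1) by (simp add: algebra_simps)
    then have "turn u + turn v = 0" using d by auto
    ultimately show False using turn_bounds(1)[of v] by linarith
  qed
  ultimately have "disjnt (path_image (proj \<circ> strand_path (-1))) (path_image (proj \<circ> strand_path 1))"
    by (auto simp: disjnt_def)
  moreover have "flat_arc (strand_path (-1)) (vector [0, 1]) (vector [- of_int d, 0])"
    "flat_arc (strand_path 1) (vector [0, -1]) (vector [of_int d, 0])"
    using flat_arc_strand[of "-1"] flat_arc_strand[of 1] by simp_all
  ultimately show ?thesis
    unfolding smoothing_def path_image_strand[symmetric] by blast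
qed

text \<open>A point in the ball has radius between 5/4 and 7/4, which confines its parameter to
  \<alpha>, ..., 1 - \<alpha>; the angle excludes the parameters strictly between \<beta> and 1 -
  \<beta>. What remains are the two strands.\<close>

lemma looks_like_smoothed:
  "looks_like (chart \<sigma>) (smoothed \<sigma> k d) (strand (-1) \<sigma> d ` {\<alpha>..\<beta>} \<union> strand 1 \<sigma> d ` {\<alpha>..\<beta>})"
proof (rule looks_like_chartI)
  let ?m = "smoothed_point \<sigma> k d" and ?T = "strand (-1) \<sigma> d ` {\<alpha>..\<beta>} \<union> strand 1 \<sigma> d ` {\<alpha>..\<beta>}"
  show T: "?T \<subseteq> cylinder" using strand_cylinder by auto
  have fst: "fst ` smoothed \<sigma> k d = ?m ` {0..1}" by (simp add: smoothed_eq image_image)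
  have s1: "chart \<sigma> (strand 1 \<sigma> d u) = ?m u" and s2: "chart \<sigma> (strand (-1) \<sigma> d u) = ?m (1 - u)"
    if "u \<in> {\<alpha>..\<beta>}" for u
    using radius_range[OF that] by (auto intro: chart_strand)
  show "fst ` smoothed \<sigma> k d \<inter> chart \<sigma> ` cylinder = chart \<sigma> ` ?T"
  proof
    show "chart \<sigma> ` ?T \<subseteq> fst ` smoothed \<sigma> k d \<inter> chart \<sigma> ` cylinder"
    proof
      fix q assume q: "q \<in> chart \<sigma> ` ?T"
      then obtain u where u: "u \<in> {\<alpha>..\<beta>}" "q = ?m u \<or> q = ?m (1 - u)" using s1 s2 by auto
      then have "q \<in> ?m ` {0..1}" using \<alpha> \<beta> by auto
      then show "q \<in> fst ` smoothed \<sigma> k d \<inter> chart \<sigma> ` cylinder" using q T by (auto simp: fst)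
    qed
    show "fst ` smoothed \<sigma> k d \<inter> chart \<sigma> ` cylinder \<subseteq> chart \<sigma> ` ?T"
    proof
      fix q assume "q \<in> fst ` smoothed \<sigma> k d \<inter> chart \<sigma> ` cylinder"
      then obtain u where u: "u \<in> {0..1}" "q = ?m u" "?m u \<in> chart \<sigma> ` cylinder" unfolding fst by auto
      obtain x where x: "\<bar>x\<bar> \<le> 1" "cos (smoothed_angle k d u) = cos x" "5/4 \<le> radius u" "radius u \<le> 7/4"
        using u(3) radius_pos[OF u(1)] unfolding smoothed_point_def by (elim pt_in_chartE) auto
      have a: "\<alpha> \<le> u" using x(3) radius_strict_mono_left[of u \<alpha>] \<alpha> by force
      have "radius (1 - \<alpha>) = 7/4" using radius_reflect[of \<alpha>] \<alpha> by simp
      then have b: "u \<le> 1 - \<alpha>" using x(4) radius_strict_mono_right[of "1 - \<alpha>" u] \<alpha> by force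
      \<comment> \<open>Here the curve runs along the circle with |angle| strictly between 1 and 2
        pi - 1, where the cosine is below cos 1; evenness of the cosine covers both signs of
        \<open>d\<close>.\<close>
      have "\<not> (\<beta> < u \<and> u < 1 - \<beta>)"
      proof
        assume mid: "\<beta> < u \<and> u < 1 - \<beta>"
        have "turn \<beta> < turn u" "turn u < turn (1 - \<beta>)"
          using mid \<beta> by (auto intro!: turn_strict_mono)
        then have m: "2 * pi * turn \<beta> < 2 * pi * turn u" "2 * pi * turn u < 2 * pi * turn (1 - \<beta>)"
          by (simp_all only: mult_less_cancel_left_pos pi_gt_zero zero_less_mult_iff zero_less_numeral simp_thms)
        have "2 * pi * turn (1 - \<beta>) = 2 * pi - 1"
          using \<beta>(3) by (simp add: turn_reflect right_diff_distrib)
        then have "cos (2 * pi * turn u) < cos 1"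
          using m[unfolded \<beta>(3)] by (intro cos_less_cos_1) simp_all
        moreover have "cos (smoothed_angle k d u) = cos (2 * pi * turn u)"
        proof -
          have "?m u = pt (3/2) (2 * pi * of_int d * turn u) (\<sigma> * (3/4))"
            using mid \<beta> by (intro smoothed_point_mid) auto
          then have "cos (smoothed_angle k d u) = cos (2 * pi * of_int d * turn u)"
            using radius_pos[OF u(1)] by (simp add: smoothed_point_def pt_eq_iff)
          moreover have "d = 1 \<or> d = -1" using d by auto
          ultimately show ?thesis by auto
        qed
        ultimately show False using x(2) cos_ge_cos_1[OF x(1)] by simp
      qed
      then consider "u \<in> {\<alpha>..\<beta>}" | "1 - u \<in> {\<alpha>..\<beta>}" using a b by force
      then show "q \<in> chart \<sigma> ` ?T"
      proof cases
        case 1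
        have "q = chart \<sigma> (strand 1 \<sigma> d u)" using s1[OF 1] u(2) by simp
        then show ?thesis using 1 by blast
      next
        case 2
        have "q = chart \<sigma> (strand (-1) \<sigma> d (1 - u))" using s2[OF 2] u(2) by simp
        then show ?thesis using 2 by blast
      qed
    qed
  qed
qed (auto simp: smoothed_eq)

end

lemma smoothed_smoothing:
  assumes "\<bar>\<sigma>\<bar> = 1" "\<bar>d\<bar> = 1"
  shows "\<exists>T. smoothing (vector [0, 1]) (vector [- of_int d, 0]) (vector [0, -1]) (vector [of_int d, 0]) T \<and>
     looks_like (chart \<sigma>) (smoothed \<sigma> k d) T"
proof -
  obtain \<alpha> where \<alpha>: "0 < \<alpha>" "\<alpha> \<le> 1/4" "radius \<alpha> = 5/4" by (rule smoothed_enters_ball)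
  obtain \<beta> where \<beta>: "1/3 < \<beta>" "\<beta> < 1/2" "2 * pi * turn \<beta> = 1" by (rule smoothed_leaves_ball)
  show ?thesis
    using smoothing_strands[OF \<alpha> \<beta> assms] looks_like_smoothed[OF \<alpha> \<beta> assms] by blast
qed

text \<open>With the circle on top, d = 1 joins north to west and south to east, which is the
  positive smoothing, and d = -1 gives the negative one.\<close>

lemma skein_triple_over: "skein_triple io (crossed 1 k) (smoothed 1 k 1) (smoothed 1 k (-1))"
proof -
  obtain T1 where T1: "smoothing north west south east T1" "looks_like (chart 1) (smoothed 1 k 1) T1"
    using smoothed_smoothing[of 1 1 k] by auto
  obtain T2 where T2: "smoothing north east south west T2" "looks_like (chart 1) (smoothed 1 k (-1)) T2"
    using smoothed_smoothing[of 1 "-1" k] by auto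
  have T3: "smoothing east north west south T2" using smoothing_reverse[OF T2(1)] .
  let ?T = "(\<lambda>x. vector [x, 0, 3/4 :: real]) ` {-1..1} \<union> (\<lambda>y. vector [0, y, - (3/4)]) ` {-1..1} :: point set"
  have "crossing ?T" unfolding crossing_def
    by (rule exI[of _ "\<lambda>_. 3/4"], rule exI[of _ "\<lambda>_. - (3/4)"]) auto
  moreover have "looks_like (chart 1) (crossed 1 k) ?T" using looks_like_crossed[of 1 k] by simp
  ultimately show ?thesis
    unfolding skein_triple_def
    using crossed_in_links[of 1 k] smoothed_in_links[of 1 1 k] smoothed_in_links[of "-1" 1 k]
      ball_chart_chart[of 1] outside_crossed_eq[of 1 1 k] outside_crossed_eq[of 1 "-1" k] T1 T2(2) T3
    by (intro conjI exI[of _ "chart 1"]) auto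
qed

text \<open>The radial strand is now the overstrand. After the quarter turn d = -1 gives the
  positive smoothing, and this exchanges t and t^-1 compared with the circle on top.\<close>

lemma skein_triple_under: "skein_triple io (crossed (-1) k) (smoothed (-1) k (-1)) (smoothed (-1) k 1)"
proof -
  let ?h = "\<lambda>p. chart (-1) (quarter_turn p)"
  have b: "ball_chart (chart (-1))" by (rule ball_chart_chart) simp
  obtain T1 where T1: "smoothing north west south east T1" "looks_like (chart (-1)) (smoothed (-1) k 1) T1"
    using smoothed_smoothing[of "-1" 1 k] by auto
  have T1': "smoothing east north west south (quarter_turn_inv ` T1)"
    using smoothing_quarter_turn[OF T1(1)] by simp
  obtain T2 where T2: "smoothing north east south west T2" "looks_like (chart (-1)) (smoothed (-1) k (-1)) T2"
    using smoothed_smoothing[of "-1" "-1" k] by auto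
  \<comment> \<open>The quarter turn yields the ends east, south, west, north; reversing both arcs
    and swapping them restores the required order.\<close>
  have T2': "smoothing north west south east (quarter_turn_inv ` T2)"
    using smoothing_sym[OF smoothing_reverse[OF smoothing_quarter_turn[OF T2(1)]]] by simp
  let ?T = "(\<lambda>x. vector [x, 0, - (3/4) :: real]) ` {-1..1} \<union> (\<lambda>y. vector [0, y, 3/4]) ` {-1..1} :: point set"
  have "crossing (quarter_turn_inv ` ?T)"
    by (rule crossing_quarter_turn[of "\<lambda>_. - (3/4)" "\<lambda>_. 3/4"]) auto
  moreover have "looks_like (chart (-1)) (crossed (-1) k) ?T" using looks_like_crossed[of "-1" k] by simp
  ultimately show ?thesis
    unfolding skein_triple_def
    using crossed_in_links[of "-1" k] smoothed_in_links[of 1 "-1" k] smoothed_in_links[of "-1" "-1" k]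
      ball_chart_quarter_turn[OF b] outside_crossed_eq[of "-1" 1 k] outside_crossed_eq[of "-1" "-1" k]
      T1' T2' looks_like_quarter_turn[OF b]  T1(2) T2(2)
    by (intro conjI exI[of _ ?h]) (auto simp: outside_quarter_turn)
qed

lemma skein_cong_smoothed:
  assumes "\<bar>d\<bar> = 1" "\<bar>\<sigma>\<bar> = 1"
  shows "skein_cong io (gen (smoothed \<sigma> k d)) (gen (spiral (k + d)))"
  by (intro skein_cong_isotopic smoothed_isotopic assms)

interpretation spiral: spiral_module io "flat_circle (3/2)" spiral
proof
  show "\<forall>p\<in>io. p $ 3 = 0" by (auto simp: io_def)
  show "flat_circle (3/2) \<in> links {}" by (rule flat_circle_in_links)
  show "spiral k \<in> links io" for k by (rule spiral_in_links)
  show "skein_cong io (gen (stack c {} (spiral k))) (gen (spiral k))" for c k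
    by (rule skein_cong_isotopic[OF stack_empty_spiral])
  show "skein_cong io (gen (stack (3/4) (flat_circle (3/2)) (spiral k)))
       (chain_scale (t_pow 1) (gen (spiral (k + 1))) + chain_scale (t_pow (-1)) (gen (spiral (k - 1))))" for k
  proof -
    have "skein_cong io (chain_scale (t_pow 1) (gen (smoothed 1 k 1)) + chain_scale (t_pow (-1)) (gen (smoothed 1 k (-1))))
      (chain_scale (t_pow 1) (gen (spiral (k + 1))) + chain_scale (t_pow (-1)) (gen (spiral (k - 1))))"
      using skein_cong_smoothed[of 1 1 k] skein_cong_smoothed[of "-1" 1 k]
      by (intro skein_cong_add skein_cong_scale) auto
    then show ?thesis
      using skein_cong_trans[OF skein_cong_triple[OF skein_triple_over[of k]]] by (simp add: crossed_def)
  qed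
  show "skein_cong io (gen (stack (-3/4) (flat_circle (3/2)) (spiral k)))
       (chain_scale (t_pow 1) (gen (spiral (k - 1))) + chain_scale (t_pow (-1)) (gen (spiral (k + 1))))" for k
  proof -
    have "skein_cong io (chain_scale (t_pow 1) (gen (smoothed (-1) k (-1))) + chain_scale (t_pow (-1)) (gen (smoothed (-1) k 1)))
      (chain_scale (t_pow 1) (gen (spiral (k - 1))) + chain_scale (t_pow (-1)) (gen (spiral (k + 1))))"
      using skein_cong_smoothed[of 1 "-1" k] skein_cong_smoothed[of "-1" "-1" k]
      by (intro skein_cong_add skein_cong_scale) auto
    then show ?thesis
      using skein_cong_trans[OF skein_cong_triple[OF skein_triple_under[of k]]] by (simp add: crossed_def)
  qed
qed

theorem corollary2p6:
  fixes N :: nat and \<xi> :: complex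
  assumes "N > 0" and "\<xi> \<noteq> 0" and "\<xi> ^ (2 * N) = -1"
  shows "(act_over io (chebyshev_T N core_z) arc_e,
          skein_uminus io (act_under io (chebyshev_T N core_z) arc_e)) \<in> skein_at_eq \<xi> io"
  using spiral.chebyshev_skew_commute[OF assms(3)]
  unfolding core_z_def arc_e_def spiral_0 .

end
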